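(* Let $1/2<s\le1$ and assume that the solution $u$ of the periodic problem $iu_t-(-\partial_{xx})^su+|u|^2u=0$, $u(x,0)=u_0(x)$, belongs to $H^\mu$ for $\mu$ large enough. Assume that $k$ is small enough, that $$3\|U^0\|^2\,kN\max_{1\le j\le q}|b_j|<1,$$ and that the local temporal errors satisfy $$\max_{0\le n\le M-1}\|\Theta^n\|_s\lesssim k^{\alpha+1}$$ for some integer $\alpha>1$. Then the fully discrete scheme $$Y^{n,0}=U^n,\quad Y^{n,j}=Y^{n,j-1}+kb_jF\Big(\tfrac{Y^{n,j}+Y^{n,j-1}}2\Big)\ (1\le j\le q),\quad U^{n+1}=Y^{n,q},\qquad U^0=P_Nu_0,$$ has for all $n$ a unique solution, and it satisfies $$\max_{0\le n\le M}\|U^n-u(t_n)\|_s\lesssim k^\alpha+N^{s-\mu}.$$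
   Context: $T>0$ fixed; $u_0$ is smooth and $2\pi$-periodic. Functions are complex-valued, $2\pi$-periodic in $x$; $\|\cdot\|$ is the norm of $L^2(-\pi,\pi)$. $\widehat u(k)=\frac1{2\pi}\int_{-\pi}^{\pi}u(x)e^{-ikx}dx$; $H^\mu$ has norm $\|u\|_\mu=(\sum_{k\in\mathbb Z}(1+k^2)^\mu|\widehat u(k)|^2)^{1/2}$; "$u$ belongs to $H^\mu$" means $u(t)\in H^\mu$ with bounded norm for $0\le t\le T$. $(-\partial_{xx})^s$ has Fourier symbol $|k|^{2s}$. $N\ge1$ is an integer, $S_N=\mathrm{span}\{e^{ikx}:-N\le k\le N\}$, $P_Nu=\sum_{|k|\le N}\widehat u(k)e^{ikx}$, and $F:S_N\to S_N$, $F(u)=-i(-\partial_{xx})^su+iP_N(|u|^2u)$. The semidiscrete solution $u^N$ with values in $S_N$ solves $\frac{d}{dt}u^N=F(u^N)$, $u^N(0)=P_Nu_0$. Time discretization: $k>0$ is the time step, $M$ an integer with $T=Mk$, $t_n=nk$. For $p\ge1$ the method has $q=3^{p-1}$ stages with nonzero real coefficients $b_1,\dots,b_q$ of Yoshida's triple-jump composition: for $p=1$, $b_1=1$; if $b=(b_1,\dots,b_q)$ is the vector for $p$, the one for $p+1$ is the concatenation $(\gamma b,(1-2\gamma)b,\gamma b)$ with $\gamma=1/(2-2^{1/(2p+1)})$. The stages $U^n,Y^{n,j}$ belong to $S_N$. If needed, $u$ and $u^N$ are understood as extended to $[-k,T+k]$ with the same properties. Local temporal error: let $Z^{n,0}=Z^n=u^N(t_n)$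 and let $Z^{n,j}\in S_N$ satisfy $Z^{n,j}=Z^{n,j-1}+kb_jF\big(\frac{Z^{n,j}+Z^{n,j-1}}2\big)$, $1\le j\le q$; then $\Theta^n=u^N(t_{n+1})-Z^{n,q}$, $0\le n\le M-1$. $g_1\lesssim g_2$ means $g_1\le Cg_2$ with a constant $C$ independent of $k$, $N$ and $n$. *)

theory Defs
  imports "HOL-Analysis.Analysis"
begin

section \<open>Periodic functions, Fourier coefficients and Sobolev norms\<close>

definition periodic_2pi :: "(real \<Rightarrow> complex) \<Rightarrow> bool" where
  "periodic_2pi f \<longleftrightarrow> (\<forall>x. f (x + 2 * pi) = f x)"

text \<open>\<open>D n\<close> is the \<open>n\<close>-th derivative of \<open>f\<close>.\<close>

definition smooth :: "(real \<Rightarrow> complex) \<Rightarrow> bool" where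
  "smooth f \<longleftrightarrow> (\<exists>D :: nat \<Rightarrow> real \<Rightarrow> complex. D 0 = f \<and>
      (\<forall>n x. (D n has_vector_derivative D (Suc n) x) (at x)))"

definition fourier_coeff :: "(real \<Rightarrow> complex) \<Rightarrow> int \<Rightarrow> complex" where
  "fourier_coeff f l =
     (LINT x:{-pi..pi}|lborel. f x * cis (- (of_int l * x))) / of_real (2 * pi)"

definition L2_norm :: "(real \<Rightarrow> complex) \<Rightarrow> real" where
  "L2_norm f = sqrt (LINT x:{-pi..pi}|lborel. (cmod (f x))\<^sup>2)"

definition sobolev_norm :: "real \<Rightarrow> (real \<Rightarrow> complex) \<Rightarrow> real" where
  "sobolev_norm \<mu> f =
     sqrt (\<Sum>\<^sub>\<infinity>l\<in>(UNIV :: int set). (1 + (of_int l)\<^sup>2) powr \<mu> * (cmod (fourier_coeff f l))\<^sup>2)"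

text \<open>Only used for \<open>\<mu> \<ge> 0\<close>, where \<open>H\<^sup>\<mu>\<close> is a subspace of \<open>L\<^sup>2\<close>. The summability
  condition is what makes the infinite sum in \<^const>\<open>sobolev_norm\<close> meaningful.\<close>

definition in_sobolev :: "real \<Rightarrow> (real \<Rightarrow> complex) \<Rightarrow> bool" where
  "in_sobolev \<mu> f \<longleftrightarrow> periodic_2pi f \<and> f \<in> borel_measurable borel \<and>
     set_integrable lborel {-pi..pi} (\<lambda>x. (cmod (f x))\<^sup>2) \<and>
     (\<lambda>l::int. (1 + (of_int l)\<^sup>2) powr \<mu> * (cmod (fourier_coeff f l))\<^sup>2) summable_on UNIV"

definition bounded_in_sobolev :: "real \<Rightarrow> real \<Rightarrow> (real \<Rightarrow> real \<Rightarrow> complex) \<Rightarrow> bool" where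
  "bounded_in_sobolev \<mu> T u \<longleftrightarrow>
     (\<exists>B. \<forall>t\<in>{0..T}. in_sobolev \<mu> (u t) \<and> sobolev_norm \<mu> (u t) \<le> B)"

text \<open>The Fourier series is summed pointwise. It converges absolutely on trigonometric
  polynomials and on \<open>H\<^sup>\<mu>\<close> with \<open>\<mu> > 2 * s + 1/2\<close>. For \<open>s > 0\<close> the mode \<open>l = 0\<close> has
  symbol \<open>0 powr (2 * s) = 0\<close>, as it should.\<close>

definition frac_laplacian :: "real \<Rightarrow> (real \<Rightarrow> complex) \<Rightarrow> real \<Rightarrow> complex" where
  "frac_laplacian s f x =
     (\<Sum>\<^sub>\<infinity>l\<in>(UNIV :: int set).
        of_real (\<bar>of_int l\<bar> powr (2 * s)) * fourier_coeff f l * cis (of_int l * x))"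

definition cubic :: "(real \<Rightarrow> complex) \<Rightarrow> real \<Rightarrow> complex" where
  "cubic f x = of_real ((cmod (f x))\<^sup>2) * f x"


section \<open>The continuous and the semidiscrete problem\<close>

text \<open>Space-time functions are written \<open>u t x\<close>. Derivatives in time are pointwise in \<open>x\<close>
  and one-sided at \<open>0\<close> and \<open>T\<close>.\<close>

definition fnls_solution ::
    "real \<Rightarrow> real \<Rightarrow> (real \<Rightarrow> complex) \<Rightarrow> (real \<Rightarrow> real \<Rightarrow> complex) \<Rightarrow> bool" where
  "fnls_solution s T u0 u \<longleftrightarrow>
     continuous_on ({0..T} \<times> UNIV) (\<lambda>(t, x). u t x) \<and>
     (\<forall>t\<in>{0..T}. periodic_2pi (u t)) \<and>
     (\<forall>x. u 0 x = u0 x) \<and>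
     (\<forall>t\<in>{0..T}. \<forall>x. \<exists>u\<^sub>t.
        ((\<lambda>\<tau>. u \<tau> x) has_vector_derivative u\<^sub>t) (at t within {0..T}) \<and>
        \<i> * u\<^sub>t - frac_laplacian s (u t) x + cubic (u t) x = 0)"

definition trig_space :: "nat \<Rightarrow> (real \<Rightarrow> complex) set" where
  "trig_space N =
     {f. \<exists>c :: int \<Rightarrow> complex. f = (\<lambda>x. \<Sum>l\<in>{- int N..int N}. c l * cis (of_int l * x))}"

definition fourier_proj :: "nat \<Rightarrow> (real \<Rightarrow> complex) \<Rightarrow> real \<Rightarrow> complex" where
  "fourier_proj N f x = (\<Sum>l\<in>{- int N..int N}. fourier_coeff f l * cis (of_int l * x))"

definition semidiscrete_rhs :: "real \<Rightarrow> nat \<Rightarrow> (real \<Rightarrow> complex) \<Rightarrow> real \<Rightarrow> complex" where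
  "semidiscrete_rhs s N f x = - \<i> * frac_laplacian s f x + \<i> * fourier_proj N (cubic f) x"

text \<open>As \<^term>\<open>trig_space N\<close> is finite-dimensional, the pointwise time derivative is the
  derivative of a curve in that space.\<close>

definition semidiscrete_solution ::
    "real \<Rightarrow> nat \<Rightarrow> real \<Rightarrow> (real \<Rightarrow> complex) \<Rightarrow> (real \<Rightarrow> real \<Rightarrow> complex) \<Rightarrow> bool" where
  "semidiscrete_solution s N T u0 uN \<longleftrightarrow>
     uN 0 = fourier_proj N u0 \<and>
     (\<forall>t\<in>{0..T}. uN t \<in> trig_space N \<and>
        (\<forall>x. ((\<lambda>\<tau>. uN \<tau> x) has_vector_derivative semidiscrete_rhs s N (uN t) x)
               (at t within {0..T})))"


section \<open>The fully discrete scheme\<close>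

text \<open>The list for \<open>p \<ge> 1\<close>; the value at \<open>0\<close> is irrelevant. The step from \<open>p\<close> to \<open>p + 1\<close>
  uses the exponent \<open>1 / (2 * p + 1)\<close>.\<close>

fun yoshida :: "nat \<Rightarrow> real list" where
  "yoshida 0 = []"
| "yoshida (Suc 0) = [1]"
| "yoshida (Suc (Suc m)) =
     (let p = Suc m; b = yoshida p; \<gamma> = 1 / (2 - 2 powr (1 / (2 * real p + 1)))
      in map (\<lambda>c. \<gamma> * c) b @ map (\<lambda>c. (1 - 2 * \<gamma>) * c) b @ map (\<lambda>c. \<gamma> * c) b)"

definition stages :: "nat \<Rightarrow> nat" where
  "stages p = 3 ^ (p - 1)"

lemma length_yoshida: "1 \<le> p \<Longrightarrow> length (yoshida p) = stages p"
  by (induction p rule: yoshida.induct) (auto simp: stages_def Let_def)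

text \<open>Coefficients are numbered from \<open>1\<close>, lists from \<open>0\<close>.\<close>

definition yoshida_coeff :: "nat \<Rightarrow> nat \<Rightarrow> real" where
  "yoshida_coeff p j = yoshida p ! (j - 1)"

text \<open>\<open>Y 0, \<dots>, Y q\<close> are the stages of one time step of length \<open>k\<close> starting at \<open>v\<close>.\<close>

definition is_step ::
    "real \<Rightarrow> nat \<Rightarrow> nat \<Rightarrow> real \<Rightarrow> (real \<Rightarrow> complex) \<Rightarrow> (nat \<Rightarrow> real \<Rightarrow> complex) \<Rightarrow> bool" where
  "is_step s N p k v Y \<longleftrightarrow> Y 0 = v \<and>
     (\<forall>j\<le>stages p. Y j \<in> trig_space N) \<and>
     (\<forall>j\<in>{1..stages p}. \<forall>x. Y j x = Y (j - 1) x +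
        of_real (k * yoshida_coeff p j) *
          semidiscrete_rhs s N (\<lambda>y. (Y j y + Y (j - 1) y) / 2) x)"

definition fully_discrete_solution ::
    "real \<Rightarrow> nat \<Rightarrow> nat \<Rightarrow> real \<Rightarrow> nat \<Rightarrow> (real \<Rightarrow> complex) \<Rightarrow>
     (nat \<Rightarrow> real \<Rightarrow> complex) \<Rightarrow> (nat \<Rightarrow> nat \<Rightarrow> real \<Rightarrow> complex) \<Rightarrow> bool" where
  "fully_discrete_solution s N p k M u0 U Y \<longleftrightarrow>
     U 0 = fourier_proj N u0 \<and>
     (\<forall>n\<le>M. U n \<in> trig_space N) \<and>
     (\<forall>n<M. is_step s N p k (U n) (Y n) \<and> U (Suc n) = Y n (stages p))"

end

theory Submission
  imports Defs "HOL-Library.Real_Mod"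
begin

text \<open>
  Everything is rewritten in terms of Fourier coefficients on the finite frequency set
  \<open>{-N..N}\<close>, where the cubic term becomes a trilinear convolution. As \<open>s > 1/2\<close>, this convolution
  is bounded in \<open>H\<^sup>s\<close> uniformly in \<open>N\<close>, hence locally Lipschitz.

  Space: the difference of \<open>u\<^sup>N\<close> and \<open>P\<^sub>N u\<close> satisfies a Gronwall inequality in \<open>H\<^sup>s\<close> as long as it
      is
  at most \<open>1\<close>, which for large \<open>N\<close> never fails; the finitely many small \<open>N\<close> are covered by mass
  conservation and an inverse inequality.

  Time: the step size restriction makes the midpoint equation a contraction in \<open>L\<^sup>2\<close> on a ball that
  is fixed by mass conservation, which gives existence and uniqueness. The same Picard iterates stay
  in an \<open>H\<^sup>s\<close> ball independent of \<open>N\<close>, so one full step is stable in \<open>H\<^sup>s\<close> with constant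
  \<open>exp (\<Lambda> k)\<close>, and the local errors add up to \<open>O(k\<^sup>\<alpha>)\<close>.
\<close>

section \<open>Trilinear estimates for Fourier coefficients\<close>

text \<open>The obstacle is that solvability and error are measured in different norms. In L2 the
  trilinear bound costs a factor 2N + 1, which the step size condition pays for, and mass
  conservation renews that condition at every stage. The H^s norm has uniform constants but is not
  conserved. Two devices connect them. Uniqueness in L2 transfers the H^s bound of the Picard limit
  to every solution of a stage. A bootstrap replaces the missing conservation law: while the error
  is at most 1 the approximation stays in a fixed ball, the Lipschitz constant is that of the ball,
  and the resulting estimate is again at most 1. The linear part has size N^(2s) and must never be
  estimated. Its symbol is imaginary, so it drops out of the energy identity and enters a stage only
  through factors 1 + i tau of modulus at least 1 and quotients of modulus 1. The cubic term of the
  exact solution enters as a limit of \<open>tri (freqs m)\<close>, and H^\<mu> regularity as a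
  bound of \<open>hs \<mu> F\<close> over all finite \<open>F\<close>, so the estimates themselves
  are about finite sums.\<close>

definition freqs :: "nat \<Rightarrow> int set" where
  "freqs N = {- int N..int N}"

definition weight :: "real \<Rightarrow> int \<Rightarrow> real" where
  "weight s l = (1 + (of_int l)\<^sup>2) powr (s / 2)"

text \<open>Coefficient sequences carry no support conditions: \<open>hs\<close> and \<open>tri\<close> below only see the
  coefficients with index in \<open>A\<close>.\<close>

definition hs :: "real \<Rightarrow> int set \<Rightarrow> (int \<Rightarrow> complex) \<Rightarrow> real" where
  "hs s A c = L2_set (\<lambda>l. weight s l * cmod (c l)) A"

text \<open>The frequency pattern i - j + k is that of u * cnj v * w, conjugation reversing the
  middle frequency. The type is polymorphic because the same sum is applied to complex coefficients
  and to their real moduli.\<close>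

definition conv3 :: "int set \<Rightarrow> (int \<Rightarrow> 'a::comm_semiring_1) \<Rightarrow> (int \<Rightarrow> 'a) \<Rightarrow> (int \<Rightarrow> 'a) \<Rightarrow> int \<Rightarrow> 'a"
    where
  "conv3 A a b c l = (\<Sum>i\<in>A. \<Sum>j\<in>A. \<Sum>k\<in>A. if i - j + k = l then a i * b j * c k else 0)"

definition tri :: "int set \<Rightarrow> (int \<Rightarrow> complex) \<Rightarrow> (int \<Rightarrow> complex) \<Rightarrow> (int \<Rightarrow> complex) \<Rightarrow> int \<Rightarrow> complex"
    where
  "tri A a b c = conv3 A a (\<lambda>j. cnj (b j)) c"

lemma finite_freqs [simp]: "finite (freqs N)" by (simp add: freqs_def)

lemma card_freqs: "card (freqs N) = 2 * N + 1" by (simp add: freqs_def)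

lemma weight_nonneg [simp]: "0 \<le> weight s l" by (simp add: weight_def)

lemma weight_pos [simp]: "0 < weight s l"
proof -
  have "1 + (real_of_int l)\<^sup>2 \<noteq> 0" using zero_le_power2[of "real_of_int l"] by linarith
  then show ?thesis by (simp add: weight_def)
qed

lemma weight_zero [simp]: "weight 0 l = 1"
proof -
  have "1 + (real_of_int l)\<^sup>2 \<noteq> 0" using zero_le_power2[of "real_of_int l"] by linarith
  then show ?thesis by (simp add: weight_def)
qed

lemma weight_power2: "(weight s l)\<^sup>2 = (1 + (of_int l)\<^sup>2) powr s"
proof -
  have "1 + (real_of_int l)\<^sup>2 > 0" using zero_le_power2[of "real_of_int l"] by linarith
  then show ?thesis by (simp add: weight_def power2_eq_square flip: powr_add)
qed

lemma hs_nonneg [simp]: "0 \<le> hs s A c" by (simp add: hs_def L2_set_nonneg)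

lemma hs_power2: "(hs s A c)\<^sup>2 = (\<Sum>l\<in>A. (1 + (of_int l)\<^sup>2) powr s * (cmod (c l))\<^sup>2)"
  by (simp add: hs_def L2_set_def sum_nonneg power_mult_distrib weight_power2)

lemma hs_mono_cmod: "(\<And>l. l \<in> A \<Longrightarrow> cmod (c l) \<le> cmod (d l)) \<Longrightarrow> hs s A c \<le> hs s A d"
  unfolding hs_def by (intro L2_set_mono mult_left_mono) auto

lemma hs_cong: "(\<And>l. l \<in> A \<Longrightarrow> c l = d l) \<Longrightarrow> hs s A c = hs s A d"
  unfolding hs_def by (intro L2_set_cong) auto

lemma hs_triangle: "hs s A (\<lambda>l. c l + d l) \<le> hs s A c + hs s A d"
proof -
  have "hs s A (\<lambda>l. c l + d l) \<le> L2_set (\<lambda>l. weight s l * cmod (c l) + weight s l * cmod (d l)) A"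
    unfolding hs_def
    by (intro L2_set_mono) (auto simp: norm_triangle_ineq mult_left_mono simp flip: distrib_left)
  also have "\<dots> \<le> hs s A c + hs s A d" unfolding hs_def by (rule L2_set_triangle_ineq)
  finally show ?thesis .
qed

lemma hs_scale: "hs s A (\<lambda>l. a * c l) = cmod a * hs s A c"
  unfolding hs_def by (simp add: norm_mult L2_set_right_distrib mult.left_commute)

lemma hs_minus [simp]: "hs s A (\<lambda>l. - c l) = hs s A c"
  by (simp add: hs_def)

lemma hs_triangle_diff: "hs s A (\<lambda>l. c l - d l) \<le> hs s A c + hs s A d"
  using hs_triangle[of s A c "\<lambda>l. - d l"] by simp

text \<open>Meant for estimates that are known only mode by mode, after taking moduli: the
  right-hand side is itself a sequence of nonnegative reals, for which monotonicity and the triangle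
  inequality apply.\<close>

lemma hs_triangle_bound:
  assumes "\<And>l. l \<in> A \<Longrightarrow> cmod (c l) \<le> cmod (d l) + a * cmod (e l)" "0 \<le> a"
  shows "hs s A c \<le> hs s A d + a * hs s A e"
proof -
  have "hs s A c \<le> hs s A (\<lambda>l. of_real (cmod (d l)) + of_real (a * cmod (e l)))"
    using assms by (intro hs_mono_cmod) (simp del: of_real_mult add: norm_of_real flip: of_real_add)
  also have "\<dots> \<le> hs s A (\<lambda>l. of_real (cmod (d l))) + hs s A (\<lambda>l. of_real a * of_real (cmod (e l)))"
    using hs_triangle by simp
  also have "\<dots> = hs s A d + a * hs s A e"
    unfolding hs_scale using assms(2) by (simp add: hs_def)
  finally show ?thesis .
qed

lemma hs_mono_exponent: "s \<le> s' \<Longrightarrow> hs s A c \<le> hs s' A c"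
  unfolding hs_def weight_def by (intro L2_set_mono mult_right_mono powr_mono) auto

lemma hs_subset: "finite B \<Longrightarrow> A \<subseteq> B \<Longrightarrow> hs s A c \<le> hs s B c"
  unfolding hs_def L2_set_def by (intro real_sqrt_le_mono sum_mono2) auto

lemma cmod_le_hs: "finite A \<Longrightarrow> l \<in> A \<Longrightarrow> cmod (c l) \<le> hs 0 A c"
  unfolding hs_def using member_le_L2_set[of A l "\<lambda>l. cmod (c l)"] by simp

lemma hs_eq_0_iff: "finite A \<Longrightarrow> hs s A c = 0 \<longleftrightarrow> (\<forall>l\<in>A. c l = 0)"
  by (auto simp: hs_def L2_set_eq_0_iff) (metis weight_pos less_irrefl)

section \<open>Convolution inequalities on finite frequency sets\<close>

lemma L2_set_sum_le: "L2_set (\<lambda>l. \<Sum>p\<in>P. F p l) B \<le> (\<Sum>p\<in>P. L2_set (F p) B)"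
proof (induction P rule: infinite_finite_induct)
  case (insert p P)
  have "L2_set (\<lambda>l. F p l + (\<Sum>p\<in>P. F p l)) B \<le> L2_set (F p) B + L2_set (\<lambda>l. \<Sum>p\<in>P. F p l) B"
    by (rule L2_set_triangle_ineq)
  with insert show ?case by simp
qed (simp_all add: L2_set_def)

text \<open>An injective change of index, extended by zero outside \<open>A\<close>, rearranges some
  entries and drops the others.\<close>

lemma L2_set_reindex_le:
  fixes f :: "int \<Rightarrow> real"
  assumes "finite A" "finite B" "inj \<phi>"
  shows "L2_set (\<lambda>l. if \<phi> l \<in> A then f (\<phi> l) else 0) B \<le> L2_set f A"
proof -
  have "(\<Sum>l\<in>B. (if \<phi> l \<in> A then f (\<phi> l) else 0)\<^sup>2) = (\<Sum>l\<in>{l\<in>B. \<phi> l \<in> A}. (f (\<phi> l))\<^sup>2)"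
    using assms(2) by (simp add: sum.inter_filter if_distrib[of "\<lambda>x. x\<^sup>2"] cong: if_cong)
  also have "\<dots> = (\<Sum>i\<in>\<phi> ` {l\<in>B. \<phi> l \<in> A}. (f i)\<^sup>2)"
    using assms(3) by (subst sum.reindex) (auto intro: inj_on_subset)
  also have "\<dots> \<le> (\<Sum>i\<in>A. (f i)\<^sup>2)" using assms(1) by (intro sum_mono2) auto
  finally show ?thesis unfolding L2_set_def by (rule real_sqrt_le_mono)
qed

lemma Young_ineq:
  fixes f :: "int \<Rightarrow> real"
  assumes "finite A" "finite B" "\<And>p. p \<in> P \<Longrightarrow> inj (\<phi> p)" "\<And>p. p \<in> P \<Longrightarrow> 0 \<le> g p"
  shows "L2_set (\<lambda>l. \<Sum>p\<in>P. g p * (if \<phi> p l \<in> A then f (\<phi> p l) else 0)) B \<le> sum g P * L2_set f A"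
proof -
  have "L2_set (\<lambda>l. \<Sum>p\<in>P. g p * (if \<phi> p l \<in> A then f (\<phi> p l) else 0)) B
     \<le> (\<Sum>p\<in>P. L2_set (\<lambda>l. g p * (if \<phi> p l \<in> A then f (\<phi> p l) else 0)) B)"
    by (rule L2_set_sum_le)
  also have "\<dots> = (\<Sum>p\<in>P. g p * L2_set (\<lambda>l. (if \<phi> p l \<in> A then f (\<phi> p l) else 0)) B)"
    using assms(4) by (intro sum.cong refl) (simp add: L2_set_right_distrib)
  also have "\<dots> \<le> (\<Sum>p\<in>P. g p * L2_set f A)"
    using assms by (intro sum_mono mult_left_mono L2_set_reindex_le) auto
  finally show ?thesis by (simp add: sum_distrib_right)
qed

lemma conv3_eq1:
  assumes "finite A"
  shows "conv3 A a b c l = (\<Sum>p\<in>A\<times>A. b (fst p) * c (snd p) *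
    (if l + fst p - snd p \<in> A then a (l + fst p - snd p) else 0))"
proof -
  have "conv3 A a b c l = (\<Sum>j\<in>A. \<Sum>k\<in>A. \<Sum>i\<in>A. if i = l + j - k then a i * b j * c k else 0)"
    unfolding conv3_def
    by (subst sum.swap, rule sum.cong[OF refl], subst sum.swap) (auto intro!: sum.cong simp:
        algebra_simps)
  also have "\<dots> = (\<Sum>j\<in>A. \<Sum>k\<in>A. b j * c k * (if l + j - k \<in> A then a (l + j - k) else 0))"
    using assms by (intro sum.cong refl) (simp add: sum.delta mult_ac)
  finally show ?thesis by (simp add: sum.cartesian_product case_prod_beta)
qed

lemma conv3_eq2:
  assumes "finite A"
  shows "conv3 A a b c l = (\<Sum>p\<in>A\<times>A. a (fst p) * c (snd p) *
    (if fst p + snd p - l \<in> A then b (fst p + snd p - l) else 0))"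
proof -
  have "conv3 A a b c l = (\<Sum>i\<in>A. \<Sum>k\<in>A. \<Sum>j\<in>A. if j = i + k - l then a i * b j * c k else 0)"
    unfolding conv3_def
    by (rule sum.cong[OF refl], subst sum.swap) (auto intro!: sum.cong simp: algebra_simps)
  also have "\<dots> = (\<Sum>i\<in>A. \<Sum>k\<in>A. a i * c k * (if i + k - l \<in> A then b (i + k - l) else 0))"
    using assms by (intro sum.cong refl) (simp add: sum.delta mult_ac)
  finally show ?thesis by (simp add: sum.cartesian_product case_prod_beta)
qed

lemma conv3_commute: "conv3 A a b c = conv3 A c b a"
proof
  fix l
  have "conv3 A a b c l = (\<Sum>j\<in>A. \<Sum>i\<in>A. \<Sum>k\<in>A. if i - j + k = l then a i * b j * c k else 0)"
    unfolding conv3_def by (rule sum.swap)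
  also have "\<dots> = (\<Sum>j\<in>A. \<Sum>k\<in>A. \<Sum>i\<in>A. if i - j + k = l then a i * b j * c k else 0)"
    by (rule sum.cong[OF refl], rule sum.swap)
  also have "\<dots> = (\<Sum>k\<in>A. \<Sum>j\<in>A. \<Sum>i\<in>A. if i - j + k = l then a i * b j * c k else 0)"
    by (rule sum.swap)
  also have "\<dots> = conv3 A c b a l"
    unfolding conv3_def by (intro sum.cong refl) (auto simp: mult_ac)
  finally show "conv3 A a b c l = conv3 A c b a l" .
qed

text \<open>One factor is measured in l2 and two in l1. All three placements are proved, since the
  Sobolev weight can fall on any of the factors.\<close>

lemma L2_conv3_le1:
  fixes a b c :: "int \<Rightarrow> real"
  assumes "finite A" "finite B" "\<And>i. 0 \<le> b i" "\<And>i. 0 \<le> c i"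
  shows "L2_set (conv3 A a b c) B \<le> L2_set a A * sum b A * sum c A"
proof -
  have "L2_set (conv3 A a b c) B
     \<le> (\<Sum>p\<in>A\<times>A. b (fst p) * c (snd p)) * L2_set a A"
    using Young_ineq[OF assms(1,2), of "A\<times>A" "\<lambda>p l. l + fst p - snd p" "\<lambda>p. b (fst p) * c (snd p)"
        a]
      assms(3,4) by (simp add: conv3_eq1[OF assms(1), abs_def] inj_def mult.assoc)
  also have "(\<Sum>p\<in>A\<times>A. b (fst p) * c (snd p)) = sum b A * sum c A"
    by (simp add: sum_product sum.cartesian_product case_prod_beta)
  finally show ?thesis by (simp add: mult_ac)
qed

lemma L2_conv3_le2:
  fixes a b c :: "int \<Rightarrow> real"
  assumes "finite A" "finite B" "\<And>i. 0 \<le> a i" "\<And>i. 0 \<le> c i"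
  shows "L2_set (conv3 A a b c) B \<le> sum a A * L2_set b A * sum c A"
proof -
  have "L2_set (conv3 A a b c) B
     \<le> (\<Sum>p\<in>A\<times>A. a (fst p) * c (snd p)) * L2_set b A"
    using Young_ineq[OF assms(1,2), of "A\<times>A" "\<lambda>p l. fst p + snd p - l" "\<lambda>p. a (fst p) * c (snd p)"
        b]
      assms(3,4) by (simp add: conv3_eq2[OF assms(1), abs_def] inj_def mult.assoc)
  also have "(\<Sum>p\<in>A\<times>A. a (fst p) * c (snd p)) = sum a A * sum c A"
    by (simp add: sum_product sum.cartesian_product case_prod_beta)
  finally show ?thesis by (simp add: mult_ac)
qed

lemma L2_conv3_le3:
  fixes a b c :: "int \<Rightarrow> real"
  assumes "finite A" "finite B" "\<And>i. 0 \<le> a i" "\<And>i. 0 \<le> b i"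
  shows "L2_set (conv3 A a b c) B \<le> sum a A * sum b A * L2_set c A"
  using L2_conv3_le1[where a = c and b = b and c = a, OF assms(1,2,4,3)]
  by (simp add: conv3_commute[of A a b c] mult_ac)

lemma cmod_tri_le: "cmod (tri A a b c l) \<le>
    conv3 A (\<lambda>i. cmod (a i)) (\<lambda>i. cmod (b i)) (\<lambda>i. cmod (c i)) l"
  unfolding tri_def conv3_def
  by (intro order.trans[OF norm_sum] sum_mono) (auto simp: norm_mult)

lemma sum_cmod_le_hs0:
  assumes "finite A"
  shows "(\<Sum>i\<in>A. cmod (a i)) \<le> sqrt (card A) * hs 0 A a"
  using L2_set_mult_ineq[of "\<lambda>i. 1" "\<lambda>i. cmod (a i)" A]
  by (simp add: L2_set_def hs_def)

text \<open>Cauchy-Schwarz turns each of the two l1 norms into an l2 norm at the cost of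
  \<open>sqrt (card A)\<close>. With \<open>card (freqs N)\<close> = 2N + 1 this is the origin of
  the product kN in the step size condition.\<close>

lemma hs0_tri_le:
  assumes "finite A" "finite B"
  shows "hs 0 B (tri A a b c) \<le> card A * hs 0 A a * hs 0 A b * hs 0 A c"
proof -
  let ?a = "\<lambda>i. cmod (a i)" and ?b = "\<lambda>i. cmod (b i)" and ?c = "\<lambda>i. cmod (c i)"
  have "hs 0 B (tri A a b c) \<le> L2_set (conv3 A ?a ?b ?c) B"
    unfolding hs_def using cmod_tri_le by (intro L2_set_mono) auto
  also have "\<dots> \<le> hs 0 A a * sum ?b A * sum ?c A"
    using L2_conv3_le1[OF assms, of ?b ?c ?a] by (simp add: hs_def[of 0])
  also have "\<dots> \<le> hs 0 A a * (sqrt (card A) * hs 0 A b) * (sqrt (card A) * hs 0 A c)"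
    using assms by (intro mult_mono sum_cmod_le_hs0) (auto simp: sum_nonneg)
  also have "\<dots> = (sqrt (card A) * sqrt (card A)) * hs 0 A a * hs 0 A b * hs 0 A c"
    by (simp only: mult_ac)
  finally show ?thesis by simp
qed

section \<open>Sobolev weights and the algebra property of H^s\<close>

lemma weight_le_sum:
  assumes "0 \<le> s" "s \<le> 1"
  shows "weight s (i - j + k) \<le> 3 * (weight s i + weight s j + weight s k)"
proof -
  let ?l = "real_of_int (i - j + k)"
  \<comment> \<open>\<open>m\<close> stands for the input frequency of largest modulus, so the
    output frequency is at most 3|m|. The resulting factor 9^(s/2) is at most 3 because s is at most
    1.\<close>
  have main: "weight s (i - j + k) \<le> 3 * weight s m" if "\<bar>i\<bar> \<le> \<bar>m\<bar>" "\<bar>j\<bar> \<le> \<bar>m\<bar>" "\<bar>k\<bar> \<le> \<bar>m\<bar>" for m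
  proof -
    have "\<bar>i - j + k\<bar> \<le> 3 * \<bar>m\<bar>" using that by linarith
    then have "\<bar>?l\<bar> \<le> \<bar>3 * real_of_int m\<bar>" by linarith
    then have "?l\<^sup>2 \<le> (3 * real_of_int m)\<^sup>2" using abs_le_square_iff by blast
    then have "1 + ?l\<^sup>2 \<le> 9 * (1 + (real_of_int m)\<^sup>2)" by (simp add: power_mult_distrib)
    then have "weight s (i - j + k) \<le> (9 * (1 + (real_of_int m)\<^sup>2)) powr (s/2)"
      unfolding weight_def using assms by (intro powr_mono2) auto
    also have "\<dots> = 9 powr (s/2) * weight s m" unfolding weight_def by (rule powr_mult)
    also have "(9::real) powr (s/2) \<le> 9 powr (1/2)" using assms by (intro powr_mono) auto
    also have "(9::real) powr (1/2) = 3" by (simp add: powr_half_sqrt)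
    finally show ?thesis by (simp add: mult_right_mono)
  qed
  consider "\<bar>j\<bar> \<le> \<bar>i\<bar> \<and> \<bar>k\<bar> \<le> \<bar>i\<bar>" | "\<bar>i\<bar> \<le> \<bar>j\<bar> \<and> \<bar>k\<bar> \<le> \<bar>j\<bar>" | "\<bar>i\<bar> \<le> \<bar>k\<bar> \<and> \<bar>j\<bar> \<le> \<bar>k\<bar>" by linarith
  then show ?thesis
  proof cases
    case 1
    then have "weight s (i - j + k) \<le> 3 * weight s i" by (intro main) auto
    then show ?thesis using weight_nonneg[of s j] weight_nonneg[of s k] by (smt (verit))
  next
    case 2
    then have "weight s (i - j + k) \<le> 3 * weight s j" by (intro main) auto
    then show ?thesis using weight_nonneg[of s i] weight_nonneg[of s k] by (smt (verit))
  next
    case 3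
    then have "weight s (i - j + k) \<le> 3 * weight s k" by (intro main) auto
    then show ?thesis using weight_nonneg[of s i] weight_nonneg[of s j] by (smt (verit))
  qed
qed

lemma sum_int_even_le:
  fixes f :: "int \<Rightarrow> real"
  assumes "summable (\<lambda>n. f (int n))" "\<And>l. f (- l) = f l" "\<And>l. 0 \<le> f l" "finite A"
  shows "sum f A \<le> 2 * (\<Sum>n. f (int n))"
proof -
  \<comment> \<open>\<open>insert 0\<close> keeps the maximum meaningful for empty
    \<open>A\<close>.\<close>
  define m where "m = Max (insert 0 ((\<lambda>l. nat \<bar>l\<bar>) ` A))"
  have "nat \<bar>l\<bar> \<le> m" if "l \<in> A" for l unfolding m_def using that assms(4) by (intro Max_ge) auto
  then have "A \<subseteq> int ` {..m} \<union> (\<lambda>n. - int n) ` {..m}"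
  proof (intro subsetI)
    fix l assume *: "l \<in> A" "\<And>l. l \<in> A \<Longrightarrow> nat \<bar>l\<bar> \<le> m"
    then have "l = int (nat \<bar>l\<bar>) \<or> l = - int (nat \<bar>l\<bar>)" "nat \<bar>l\<bar> \<le> m" by auto
    then show "l \<in> int ` {..m} \<union> (\<lambda>n. - int n) ` {..m}" by blast
  qed
  then have "sum f A \<le> sum f (int ` {..m} \<union> (\<lambda>n. - int n) ` {..m})"
    using assms by (intro sum_mono2) auto
  also have "\<dots> \<le> sum f (int ` {..m}) + sum f ((\<lambda>n. - int n) ` {..m})"
    using assms by (simp add: sum_Un sum_nonneg)
  also have "\<dots> = 2 * (\<Sum>n\<le>m. f (int n))"
    using assms(2) by (subst (1 2) sum.reindex) (auto simp: inj_on_def)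
  also have "(\<Sum>n\<le>m. f (int n)) \<le> (\<Sum>n. f (int n))"
    using assms by (intro sum_le_suminf) auto
  finally show ?thesis by simp
qed

lemma summable_weight:
  assumes "1 / 2 < r"
  shows "summable (\<lambda>n. (1 + (real n)\<^sup>2) powr (- r))"
proof -
  have "summable (\<lambda>n. real n powr (- 2 * r))" using assms by (subst summable_real_powr_iff) auto
  \<comment> \<open>The comparison starts at 1: \<open>0 powr (- 2 * r)\<close> is 0 and cannot
    dominate the term 1 at n = 0.\<close>
  then have "summable (\<lambda>n. real (Suc n) powr (- 2 * r))"
    using summable_Suc_iff[of "\<lambda>n. real n powr (- 2 * r)"] by blast
  moreover have "norm ((1 + (real (Suc n))\<^sup>2) powr (- r)) \<le> real (Suc n) powr (- 2 * r)" for n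
  proof -
    have "(1 + (real (Suc n))\<^sup>2) powr (- r) \<le> ((real (Suc n))\<^sup>2) powr (- r)"
      using assms by (intro powr_mono2') auto
    also have "\<dots> = (real (Suc n) powr 2) powr (- r)" by simp
    also have "\<dots> = real (Suc n) powr (- 2 * r)" unfolding powr_powr by simp
    finally show ?thesis by simp
  qed
  ultimately have "summable (\<lambda>n. (1 + (real (Suc n))\<^sup>2) powr (- r))"
    by (rule summable_comparison_test'[where N = 0])
  then show ?thesis using summable_Suc_iff[of "\<lambda>n. (1 + (real n)\<^sup>2) powr (- r)"] by blast
qed

text \<open>Cauchy-Schwarz against the inverse weights, which are square summable for s > 1/2. This
  is the embedding of H^s into the absolutely convergent Fourier series, with a constant that does
  not depend on \<open>A\<close>.\<close>

lemma sum_cmod_le_hs: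
  assumes "1 / 2 < s"
  obtains C where "0 < C" "\<And>A a. finite A \<Longrightarrow> (\<Sum>i\<in>A. cmod (a i)) \<le> C * hs s A a"
proof
  let ?S = "\<Sum>n. (1 + (real n)\<^sup>2) powr (- s)"
  have "0 < ?S" using summable_weight[OF assms]
    by (intro suminf_pos2[where i = 0]) auto
  then show "0 < sqrt (2 * ?S)" by simp
  fix A :: "int set" and a :: "int \<Rightarrow> complex" assume A: "finite A"
  have "(\<Sum>i\<in>A. (1 + (of_int i)\<^sup>2) powr (- s)) \<le> 2 * ?S"
    using sum_int_even_le[of "\<lambda>l. (1 + (of_int l)\<^sup>2) powr (- s)" A] summable_weight[OF assms] A
        by simp
  moreover have "(inverse (weight s i))\<^sup>2 = (1 + (of_int i)\<^sup>2) powr (- s)" for i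
    by (simp add: power_inverse weight_power2 powr_minus)
  ultimately have "L2_set (\<lambda>i. inverse (weight s i)) A \<le> sqrt (2 * ?S)"
    unfolding L2_set_def by simp
  moreover have "(\<Sum>i\<in>A. cmod (a i)) = (\<Sum>i\<in>A. \<bar>inverse (weight s i)\<bar> * \<bar>weight s i * cmod (a i)\<bar>)"
    by (intro sum.cong refl) (simp add: abs_mult less_imp_neq[OF weight_pos, symmetric])
  moreover have "\<dots> \<le> L2_set (\<lambda>i. inverse (weight s i)) A * hs s A a"
    unfolding hs_def by (rule L2_set_mult_ineq)
  ultimately show "(\<Sum>i\<in>A. cmod (a i)) \<le> sqrt (2 * ?S) * hs s A a"
    by (smt (verit) hs_nonneg mult_right_mono)
qed

text \<open>A substitute for the Leibniz rule: \<open>weight_le_sum\<close> distributes the weight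
  at the output frequency over the three factors.\<close>

lemma conv3_weight_le:
  assumes "0 \<le> s" "s \<le> 1"
  shows "weight s l * conv3 A (\<lambda>i. cmod (a i)) (\<lambda>i. cmod (b i)) (\<lambda>i. cmod (c i)) l \<le>
    3 * (conv3 A (\<lambda>i. weight s i * cmod (a i)) (\<lambda>i. cmod (b i)) (\<lambda>i. cmod (c i)) l +
         conv3 A (\<lambda>i. cmod (a i)) (\<lambda>i. weight s i * cmod (b i)) (\<lambda>i. cmod (c i)) l +
         conv3 A (\<lambda>i. cmod (a i)) (\<lambda>i. cmod (b i)) (\<lambda>i. weight s i * cmod (c i)) l)"
proof -
  have "weight s l * (if i - j + k = l then cmod (a i) * cmod (b j) * cmod (c k) else 0) \<le>
    3 * (if i - j + k = l then weight s i * cmod (a i) * cmod (b j) * cmod (c k) else 0) +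
    3 * (if i - j + k = l then cmod (a i) * (weight s j * cmod (b j)) * cmod (c k) else 0) +
    3 * (if i - j + k = l then cmod (a i) * cmod (b j) * (weight s k * cmod (c k)) else 0)" for i j
        k
    using mult_right_mono[OF weight_le_sum[OF assms, of i j k],
        of "cmod (a i) * cmod (b j) * cmod (c k)"]
    by (auto simp: algebra_simps)
  then have "weight s l * conv3 A (\<lambda>i. cmod (a i)) (\<lambda>i. cmod (b i)) (\<lambda>i. cmod (c i)) l \<le>
    (\<Sum>i\<in>A. \<Sum>j\<in>A. \<Sum>k\<in>A. 
    3 * (if i - j + k = l then weight s i * cmod (a i) * cmod (b j) * cmod (c k) else 0) +
    3 * (if i - j + k = l then cmod (a i) * (weight s j * cmod (b j)) * cmod (c k) else 0) +
    3 * (if i - j + k = l then cmod (a i) * cmod (b j) * (weight s k * cmod (c k)) else 0))"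
    unfolding conv3_def sum_distrib_left by (intro sum_mono)
  then show ?thesis by (simp only: conv3_def sum_distrib_left sum.distrib distrib_left)
qed

text \<open>In each of the three terms the weighted factor is kept in l2 and the other two are put
  in l1, where the embedding bounds them. The constant is independent of \<open>A\<close> and
  \<open>B\<close>; all uniformity in N comes from here.\<close>

lemma tri_bound:
  assumes "1 / 2 < s" "s \<le> 1"
  obtains C where "0 < C"
    "\<And>A B a b c. finite A \<Longrightarrow> finite B \<Longrightarrow> hs s B (tri A a b c) \<le> C * hs s A a * hs s A b * hs s A c"
proof -
  obtain K where K: "0 < K" "\<And>A a. finite A \<Longrightarrow> (\<Sum>i\<in>A. cmod (a i)) \<le> K * hs s A a"
    using sum_cmod_le_hs[OF assms(1)] by blast
  show thesis
  proof
    \<comment> \<open>A factor 3 from the weight, 3 for the number of terms, and one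
      \<open>K\<close> for each of the two l1 norms.\<close>
    show "0 < 9 * K\<^sup>2" using K by simp
    fix A B :: "int set" and a b c :: "int \<Rightarrow> complex" assume fin: "finite A" "finite B"
    let ?a = "\<lambda>i. cmod (a i)" and ?b = "\<lambda>i. cmod (b i)" and ?c = "\<lambda>i. cmod (c i)"
    let ?wa = "\<lambda>i. weight s i * cmod (a i)" and ?wb = "\<lambda>i. weight s i * cmod (b i)"
      and ?wc = "\<lambda>i. weight s i * cmod (c i)"
    have s: "0 \<le> s" using assms by simp
    have "hs s B (tri A a b c) \<le>
        L2_set (\<lambda>l. 3 * (conv3 A ?wa ?b ?c l + conv3 A ?a ?wb ?c l + conv3 A ?a ?b ?wc l)) B"
      unfolding hs_def
      by (intro L2_set_mono order.trans[OF mult_left_mono[OF cmod_tri_le] conv3_weight_le[OF s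
          assms(2)]]) auto
    also have "\<dots> = 3 * L2_set (\<lambda>l. conv3 A ?wa ?b ?c l + conv3 A ?a ?wb ?c l + conv3 A ?a ?b ?wc l)
        B"
      by (simp only: L2_set_right_distrib[of 3, symmetric])
    also have "\<dots> \<le> 3 * (L2_set (conv3 A ?wa ?b ?c) B + L2_set (conv3 A ?a ?wb ?c) B + L2_set (conv3
        A ?a ?b ?wc) B)"
      by (intro mult_left_mono order.trans[OF L2_set_triangle_ineq] add_right_mono) auto
    also have "\<dots> \<le> 3 * (hs s A a * (K * hs s A b) * (K * hs s A c) + (K * hs s A a) * hs s A b * (K
        * hs s A c)
        + (K * hs s A a) * (K * hs s A b) * hs s A c)"
    proof (intro mult_left_mono add_mono)
      show "L2_set (conv3 A ?wa ?b ?c) B \<le> hs s A a * (K * hs s A b) * (K * hs s A c)"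
        by (rule order.trans[OF L2_conv3_le1[OF fin]], simp, simp, unfold hs_def[symmetric])
           (use K fin in \<open>intro mult_mono, auto simp: sum_nonneg\<close>)
      show "L2_set (conv3 A ?a ?wb ?c) B \<le> (K * hs s A a) * hs s A b * (K * hs s A c)"
        by (rule order.trans[OF L2_conv3_le2[OF fin]], simp, simp, unfold hs_def[symmetric])
           (use K fin in \<open>intro mult_mono, auto simp: sum_nonneg\<close>)
      show "L2_set (conv3 A ?a ?b ?wc) B \<le> (K * hs s A a) * (K * hs s A b) * hs s A c"
        by (rule order.trans[OF L2_conv3_le3[OF fin]], simp, simp, unfold hs_def[symmetric])
           (use K fin in \<open>intro mult_mono, auto simp: sum_nonneg\<close>)
    qed simp
    finally show "hs s B (tri A a b c) \<le> 9 * K\<^sup>2 * hs s A a * hs s A b * hs s A c"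
      by (simp add: power2_eq_square algebra_simps)
  qed
qed

section \<open>Algebra of the cubic term\<close>

lemma tri_diff:
  "tri A a a a l - tri A b b b l =
    tri A (\<lambda>i. a i - b i) a a l + tri A b (\<lambda>i. a i - b i) a l + tri A b b (\<lambda>i. a i - b i) l"
  unfolding tri_def conv3_def sum.distrib[symmetric] sum_subtractf[symmetric]
  by (intro sum.cong refl) (auto simp: algebra_simps)

lemma tri_cong:
  assumes "\<And>i. i \<in> A \<Longrightarrow> a i = a' i" "\<And>i. i \<in> A \<Longrightarrow> b i = b' i" "\<And>i. i \<in> A \<Longrightarrow> c i = c' i"
  shows "tri A a b c l = tri A a' b' c' l"
  unfolding tri_def conv3_def using assms by (intro sum.cong refl) auto

text \<open>The trilinear bound is a hypothesis, so that the same Lipschitz estimate serves in L2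
  with constant \<open>card A\<close> and in H^s with a constant independent of N. The 3 counts the
  slots that the difference can occupy.\<close>

lemma hs_tri_diff_le:
  assumes tri: "\<And>a b c. hs s A (tri A a b c) \<le> C * hs s A a * hs s A b * hs s A c" and "0 \<le> C"
    and R: "hs s A a \<le> R" "hs s A b \<le> R"
  shows "hs s A (\<lambda>l. tri A a a a l - tri A b b b l) \<le> 3 * C * R\<^sup>2 * hs s A (\<lambda>l. a l - b l)"
proof -
  let ?d = "\<lambda>l. a l - b l"
  have R0: "0 \<le> R" using R hs_nonneg order.trans by blast
  have "hs s A (\<lambda>l. tri A a a a l - tri A b b b l) \<le>
     hs s A (tri A ?d a a) + hs s A (tri A b ?d a) + hs s A (tri A b b ?d)"
    unfolding tri_diff by (intro order.trans[OF hs_triangle] add_right_mono) simp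
  also have "\<dots> \<le> C * hs s A ?d * R * R + C * R * hs s A ?d * R + C * R * R * hs s A ?d"
    using assms R0 by (intro add_mono order.trans[OF tri] mult_mono) auto
  finally show ?thesis by (simp add: power2_eq_square algebra_simps)
qed

text \<open>Extension by zero allows convolutions over different frequency sets to be compared by
  the Lipschitz estimate on the larger one.\<close>

lemma tri_restrict:
  assumes "finite B" "A \<subseteq> B"
  shows "tri A a a a l = tri B (\<lambda>i. if i \<in> A then a i else 0) (\<lambda>i. if i \<in> A then a i else 0)
     (\<lambda>i. if i \<in> A then a i else 0) l" (is "_ = tri B ?a ?a ?a l")
proof -
  have *: "(\<Sum>i\<in>A. f i) = (\<Sum>i\<in>B. f i)" if "\<And>i. i \<notin> A \<Longrightarrow> f i = 0" for f :: "int \<Rightarrow> complex"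
    using assms that by (intro sum.mono_neutral_left) auto
  have "tri A a a a l = tri A ?a ?a ?a l" by (rule tri_cong) auto
  also have "\<dots> = tri B ?a ?a ?a l"
    unfolding tri_def conv3_def
    by (subst (1 2 3) *) (auto intro!: sum.neutral)
  finally show ?thesis .
qed

text \<open>For finite \<open>A\<close> the sum is a multiple of the integral of |u|^4. On
  coefficients, conjugation rotates the four indices cyclically and preserves the constraint i - j +
  k = l, so the sum equals its conjugate. This is the source of mass conservation, discrete and
  continuous.\<close>

lemma tri_inner_real:
  "Im (\<Sum>l\<in>A. cnj (a l) * tri A a a a l) = 0"
proof -
  let ?F = "\<lambda>i j k l. if i - j + k = l then a i * cnj (a j) * a k * cnj (a l) else 0"
  have "(\<Sum>l\<in>A. cnj (a l) * tri A a a a l) = (\<Sum>l\<in>A. \<Sum>i\<in>A. \<Sum>j\<in>A. \<Sum>k\<in>A. ?F i j k l)"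
    unfolding tri_def conv3_def sum_distrib_left by (intro sum.cong refl) (auto simp: mult_ac)
  also have "\<dots> = (\<Sum>i\<in>A. \<Sum>l\<in>A. \<Sum>j\<in>A. \<Sum>k\<in>A. ?F i j k l)" by (rule sum.swap)
  also have "\<dots> = (\<Sum>i\<in>A. \<Sum>l\<in>A. \<Sum>k\<in>A. \<Sum>j\<in>A. ?F i j k l)"
    by (rule sum.cong[OF refl], rule sum.cong[OF refl], rule sum.swap)
  also have "\<dots> = (\<Sum>i\<in>A. \<Sum>k\<in>A. \<Sum>l\<in>A. \<Sum>j\<in>A. ?F i j k l)"
    by (rule sum.cong[OF refl], rule sum.swap)
  finally have S: "(\<Sum>l\<in>A. cnj (a l) * tri A a a a l) = (\<Sum>i\<in>A. \<Sum>k\<in>A. \<Sum>l\<in>A. \<Sum>j\<in>A. ?F i j k l)" .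
  have "cnj (\<Sum>i\<in>A. \<Sum>k\<in>A. \<Sum>l\<in>A. \<Sum>j\<in>A. ?F i j k l) = (\<Sum>i\<in>A. \<Sum>k\<in>A. \<Sum>l\<in>A. \<Sum>j\<in>A. ?F l i j k)"
    unfolding cnj_sum by (intro sum.cong refl) (auto simp: mult_ac)
  also have "\<dots> = (\<Sum>l\<in>A. \<Sum>j\<in>A. \<Sum>i\<in>A. \<Sum>k\<in>A. ?F l i j k)"
  proof -
    have "(\<Sum>i\<in>A. \<Sum>k\<in>A. \<Sum>l\<in>A. \<Sum>j\<in>A. ?F l i j k) = (\<Sum>i\<in>A. \<Sum>l\<in>A. \<Sum>k\<in>A. \<Sum>j\<in>A. ?F l i j k)"
      by (rule sum.cong[OF refl], rule sum.swap)
    also have "\<dots> = (\<Sum>l\<in>A. \<Sum>i\<in>A. \<Sum>k\<in>A. \<Sum>j\<in>A. ?F l i j k)" by (rule sum.swap)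
    also have "\<dots> = (\<Sum>l\<in>A. \<Sum>i\<in>A. \<Sum>j\<in>A. \<Sum>k\<in>A. ?F l i j k)"
      by (rule sum.cong[OF refl], rule sum.cong[OF refl], rule sum.swap)
    also have "\<dots> = (\<Sum>l\<in>A. \<Sum>j\<in>A. \<Sum>i\<in>A. \<Sum>k\<in>A. ?F l i j k)"
      by (rule sum.cong[OF refl], rule sum.swap)
    finally show ?thesis .
  qed
  also have "\<dots> = (\<Sum>i\<in>A. \<Sum>k\<in>A. \<Sum>l\<in>A. \<Sum>j\<in>A. ?F i j k l)"
    by (rule sum.cong[OF refl], rule sum.cong[OF refl], rule sum.swap)
  finally have "cnj (\<Sum>l\<in>A. cnj (a l) * tri A a a a l) = (\<Sum>l\<in>A. cnj (a l) * tri A a a a l)"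
    unfolding S .
  then show ?thesis using Reals_cnj_iff complex_is_Real_iff by blast
qed

section \<open>The implicit midpoint rule\<close>

text \<open>One stage in Fourier coefficients. Only indices in \<open>A\<close> are constrained, so
  uniqueness of \<open>z\<close> can be expected on \<open>A\<close> only.\<close>

definition midpoint_step :: "real \<Rightarrow> int set \<Rightarrow> real \<Rightarrow> (int \<Rightarrow> complex) \<Rightarrow> (int \<Rightarrow> complex) \<Rightarrow> bool" where
  "midpoint_step s A h y z \<longleftrightarrow> (\<forall>l\<in>A. z l = y l + of_real h *
     (- \<i> * of_real (\<bar>of_int l\<bar> powr (2 * s)) * ((z l + y l) / 2) +
      \<i> * tri A (\<lambda>i. (z i + y i) / 2) (\<lambda>i. (z i + y i) / 2) (\<lambda>i. (z i + y i) / 2) l))"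

text \<open>Pair the equation with the midpoint: the linear part contributes an imaginary number and
  the cubic part cancels after summation by \<open>tri_inner_real\<close>. The argument holds for
  either sign of \<open>h\<close>, as negative triple-jump coefficients require.\<close>

lemma midpoint_step_mass:
  assumes "midpoint_step s A h y z"
  shows "hs 0 A z = hs 0 A y"
proof -
  define m where "m = (\<lambda>i. (z i + y i) / 2)"
  have "(cmod (z l))\<^sup>2 - (cmod (y l))\<^sup>2 = - (2 * h) * Im (cnj (m l) * tri A m m m l)" if "l \<in> A"
      for l
  proof -
    have "(cmod (z l))\<^sup>2 - (cmod (y l))\<^sup>2 = 2 * Re (cnj (m l) * (z l - y l))"
      unfolding m_def cmod_power2 by (simp add: algebra_simps power2_eq_square)
    also have "z l - y l = of_real h * (- \<i> * of_real (\<bar>of_int l\<bar> powr (2 * s)) * m l + \<i> * tri A m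
        m m l)"
      using assms that unfolding midpoint_step_def m_def by (simp add: algebra_simps)
    also have "2 * Re (cnj (m l) * \<dots>) = - (2 * h) * Im (cnj (m l) * tri A m m m l)"
      by (simp add: algebra_simps)
    finally show ?thesis .
  qed
  then have "(\<Sum>l\<in>A. (cmod (z l))\<^sup>2) - (\<Sum>l\<in>A. (cmod (y l))\<^sup>2) =
      - (2 * h) * Im (\<Sum>l\<in>A. cnj (m l) * tri A m m m l)"
    by (simp add: sum_subtractf[symmetric] sum_distrib_left Im_sum)
  then have "(\<Sum>l\<in>A. (cmod (z l))\<^sup>2) = (\<Sum>l\<in>A. (cmod (y l))\<^sup>2)"
    unfolding tri_inner_real by simp
  then show ?thesis by (simp add: hs_def L2_set_def)
qed

text \<open>Inverting the linear part never enlarges a coefficient. This is why no restriction on k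
  N^(2s) arises.\<close>

lemma cmod_le_resolvent: "cmod x \<le> cmod ((1 + \<i> * of_real \<tau>) * x)"
proof -
  have "1 \<le> cmod (1 + \<i> * of_real \<tau>)" by (simp add: cmod_def)
  then show ?thesis by (simp add: norm_mult mult_le_cancel_right1)
qed

text \<open>The fixed-point form of a stage: with the midpoint as unknown, the step is halved and
  the linear part is collected on the left, ready for \<open>cmod_le_resolvent\<close>.\<close>

lemma midpoint_step_iff:
  "midpoint_step s A h y z \<longleftrightarrow>
      (\<forall>l\<in>A. (1 + \<i> * of_real (h / 2 * \<bar>of_int l\<bar> powr (2 * s))) * ((z l + y l) / 2) =
      y l + \<i> * of_real (h / 2) * tri A (\<lambda>i. (z i + y i) / 2) (\<lambda>i. (z i + y i) / 2) (\<lambda>i. (z i + y i)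
          / 2) l)"
proof -
  have "Z = Y + H * (- \<i> * Q * ((Z + Y) / 2) + \<i> * X) \<longleftrightarrow>
     (1 + \<i> * (H / 2 * Q)) * ((Z + Y) / 2) = Y + \<i> * (H / 2) * X" for Z Y H Q X :: complex
  proof -
    have "Z - (Y + H * (- \<i> * Q * ((Z + Y) / 2) + \<i> * X)) =
      2 * ((1 + \<i> * (H / 2 * Q)) * ((Z + Y) / 2) - (Y + \<i> * (H / 2) * X))"
      by (simp add: field_simps)
    then show ?thesis by (metis mult_eq_0_iff right_minus_eq zero_neq_numeral)
  qed
  then show ?thesis unfolding midpoint_step_def by simp
qed

lemma hs0_tri_diff_le:
  assumes "finite A" "hs 0 A a \<le> R" "hs 0 A b \<le> R"
  shows "hs 0 A (\<lambda>l. tri A a a a l - tri A b b b l) \<le>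
      3 * real (card A) * R\<^sup>2 * hs 0 A (\<lambda>l. a l - b l)"
  using assms by (intro hs_tri_diff_le hs0_tri_le) auto

text \<open>By mass conservation the midpoint of any solution lies in the L2 ball of radius
  \<open>hs 0 A y\<close>, so uniqueness is global and not confined to a neighbourhood of
  \<open>y\<close>. On that ball the hypothesis on \<open>h\<close> gives the contraction factor
  1/4.\<close>

lemma midpoint_step_unique:
  fixes h :: real
  assumes "finite A" and h: "6 * \<bar>h\<bar> * card A * (hs 0 A y)\<^sup>2 \<le> 1"
    and z: "midpoint_step s A h y z" and z': "midpoint_step s A h y z'" and "l \<in> A"
  shows "z l = z' l"
proof -
  define m where "m = (\<lambda>i. (z i + y i) / 2)"
  define m' where "m' = (\<lambda>i. (z' i + y i) / 2)"
  have m_le: "hs 0 A (\<lambda>i. (x i + y i) / 2) \<le> hs 0 A y" if "midpoint_step s A h y x" for x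
  proof -
    have "hs 0 A (\<lambda>i. (x i + y i) / 2) = hs 0 A (\<lambda>i. x i + y i) / 2"
      using hs_scale[of 0 A "1/2" "\<lambda>i. x i + y i"] by simp
    also have "\<dots> \<le> (hs 0 A x + hs 0 A y) / 2" by (simp add: hs_triangle)
    finally show ?thesis using midpoint_step_mass[OF that] by simp
  qed
  have "hs 0 A (\<lambda>l. m l - m' l) \<le> hs 0 A (\<lambda>l. of_real (h / 2) * (tri A m m m l - tri A m' m' m' l))"
  proof (rule hs_mono_cmod)
    fix l assume "l \<in> A"
    have m: "(1 + \<i> * of_real (h / 2 * \<bar>of_int l\<bar> powr (2 * s))) * m l =
        y l + \<i> * of_real (h / 2) * tri A m m m l"
      using z \<open>l \<in> A\<close> unfolding midpoint_step_iff m_def by blast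
    have m': "(1 + \<i> * of_real (h / 2 * \<bar>of_int l\<bar> powr (2 * s))) * m' l =
        y l + \<i> * of_real (h / 2) * tri A m' m' m' l"
      using z' \<open>l \<in> A\<close> unfolding midpoint_step_iff m'_def by blast
    have eq: "(1 + \<i> * of_real (h / 2 * \<bar>of_int l\<bar> powr (2 * s))) * (m l - m' l) =
      \<i> * (of_real (h / 2) * (tri A m m m l - tri A m' m' m' l))"
      unfolding right_diff_distrib m m' by (simp add: algebra_simps)
    show "cmod (m l - m' l) \<le> cmod (of_real (h / 2) * (tri A m m m l - tri A m' m' m' l))"
      using cmod_le_resolvent[of "m l - m' l" "h / 2 * \<bar>of_int l\<bar> powr (2 * s)"]
      unfolding eq by (simp add: norm_mult)
  qed
  also have "\<dots> = \<bar>h\<bar> / 2 * hs 0 A (\<lambda>l. tri A m m m l - tri A m' m' m' l)"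
      by (simp add: hs_scale del: of_real_divide)
  also have "\<dots> \<le> \<bar>h\<bar> / 2 * (3 * real (card A) * (hs 0 A y)\<^sup>2 * hs 0 A (\<lambda>l. m l - m' l))"
    using m_le[OF z] m_le[OF z'] assms(1)
        by (intro mult_left_mono hs0_tri_diff_le) (auto simp: m_def m'_def)
  also have "\<dots> = (6 * \<bar>h\<bar> * card A * (hs 0 A y)\<^sup>2) / 4 * hs 0 A (\<lambda>l. m l - m' l)" by simp
  also have "\<dots> \<le> 1 / 4 * hs 0 A (\<lambda>l. m l - m' l)" using h by (intro mult_right_mono) auto
  finally have "hs 0 A (\<lambda>l. m l - m' l) = 0" using hs_nonneg[of 0 A "\<lambda>l. m l - m' l"] by simp
  then have "m l = m' l" using hs_eq_0_iff[OF assms(1)] assms(5) by fastforce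
  then show ?thesis by (simp add: m_def m'_def)
qed

lemma tendsto_tri:
  assumes "\<And>i. i \<in> A \<Longrightarrow> ((\<lambda>n. V n i) \<longlongrightarrow> v i) F"
  shows "((\<lambda>n. tri A (V n) (V n) (V n) l) \<longlongrightarrow> tri A v v v l) F"
  unfolding tri_def conv3_def
  by (intro tendsto_sum) (auto intro!: tendsto_intros assms)

lemma tendsto_hs:
  assumes "\<And>i. i \<in> A \<Longrightarrow> ((\<lambda>n. V n i) \<longlongrightarrow> v i) F"
  shows "((\<lambda>n. hs s A (V n)) \<longlongrightarrow> hs s A v) F"
  unfolding hs_def L2_set_def by (intro tendsto_intros assms)

text \<open>The solution is the limit of a Picard iteration in \<open>l\<^sup>2\<close>; every iterate obeys the
  \<open>H\<^sup>s\<close> bound, and hence so does the limit.\<close>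

lemma midpoint_step_exists:
  fixes h :: real
  assumes "finite A" and h: "6 * \<bar>h\<bar> * card A * (hs 0 A y)\<^sup>2 \<le> 1"
    and C: "\<And>a b c. hs s A (tri A a b c) \<le> C * hs s A a * hs s A b * hs s A c" "0 \<le> C"
  obtains z where "midpoint_step s A h y z"
    "\<And>B. \<lbrakk>hs s A y \<le> B; 4 * C * \<bar>h\<bar> * B\<^sup>2 \<le> 1\<rbrakk> \<Longrightarrow> hs s A (\<lambda>l. (z l + y l) / 2) \<le> 2 * B"
proof -
  define r where "r = hs 0 A y"
  define \<tau> where "\<tau> l = h / 2 * \<bar>of_int l\<bar> powr (2 * s)" for l :: int
  \<comment> \<open>One Picard step for the midpoint, implicit in the linear part and explicit in
    the cubic term. The iteration starts from 0.\<close>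
  define G where "G v = (\<lambda>l. (y l + \<i> * of_real (h / 2) * tri A v v v l) / (1 + \<i> * of_real (\<tau> l)))"
      for v
  define V where "V n = (G ^^ n) (\<lambda>l. 0)" for n
  have nz: "1 + \<i> * of_real x \<noteq> 0" for x by (auto simp: complex_eq_iff)
  have V_Suc: "(1 + \<i> * of_real (\<tau> l)) * V (Suc n) l =
      y l + \<i> * of_real (h / 2) * tri A (V n) (V n) (V n) l" for n l
    using nz by (simp add: V_def G_def)
  have V_Suc_le: "hs \<sigma> A (V (Suc n)) \<le> hs \<sigma> A y + \<bar>h\<bar> / 2 * hs \<sigma> A (tri A (V n) (V n) (V n))"
      for \<sigma> n
  proof (rule hs_triangle_bound)
    fix l assume "l \<in> A"
    have "cmod (V (Suc n) l) \<le> cmod (y l + \<i> * of_real (h / 2) * tri A (V n) (V n) (V n) l)"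
      using cmod_le_resolvent[of "V (Suc n) l" "\<tau> l"] by (simp only: V_Suc)
    also have "\<dots> \<le> cmod (y l) + cmod (\<i> * of_real (h / 2) * tri A (V n) (V n) (V n) l)"
      by (rule norm_triangle_ineq)
    finally show "cmod (V (Suc n) l) \<le> cmod (y l) + \<bar>h\<bar> / 2 * cmod (tri A (V n) (V n) (V n) l)"
      by (simp add: norm_mult del: of_real_divide)
  qed simp
  \<comment> \<open>The iterates do not conserve mass, hence a ball larger than \<open>r\<close>. It
    is invariant because half of |h| times \<open>card A * (3 / 2 * r)^3\<close> is at most 9/32 of
    \<open>r\<close>.\<close>
  have bound0: "hs 0 A (V n) \<le> 3 / 2 * r" for n
  proof (induction n)
    case (Suc n)
    have "hs 0 A (V (Suc n)) \<le> r + \<bar>h\<bar> / 2 * (card A * hs 0 A (V n) * hs 0 A (V n) * hs 0 A (V n))"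
      unfolding r_def using assms(1)
      by (intro order.trans[OF V_Suc_le] add_left_mono mult_left_mono hs0_tri_le) auto
    also have "\<dots> \<le> r + \<bar>h\<bar> / 2 * (card A * (3 / 2 * r) * (3 / 2 * r) * (3 / 2 * r))"
      using Suc by (intro add_left_mono mult_left_mono mult_mono) (auto simp: r_def)
    also have "\<dots> = r + (6 * \<bar>h\<bar> * card A * r\<^sup>2) * (9 / 32 * r)" by (simp add: power2_eq_square)
    also have "\<dots> \<le> r + 1 * (9 / 32 * r)"
      using h by (intro add_left_mono mult_right_mono) (auto simp: r_def)
    finally show ?case using hs_nonneg[of 0 A y] unfolding r_def by linarith
  qed (simp add: V_def hs_def L2_set_0' r_def)
  \<comment> \<open>\<open>B\<close> is local to this fact: convergence rests on the L2 condition
    alone, and the H^s bound is added for every admissible \<open>B\<close>. On radius 2B the cubic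
    contribution is 4 C |h| B^3, at most B.\<close>
  have bounds: "hs s A (V n) \<le> 2 * B" if B: "hs s A y \<le> B" "4 * C * \<bar>h\<bar> * B\<^sup>2 \<le> 1" for n B
  proof (induction n)
    case 0
    have "0 \<le> B" using B(1) hs_nonneg order.trans by blast
    then show ?case by (simp add: V_def hs_def L2_set_0')
  next
    case (Suc n)
    have B0: "0 \<le> B" using B(1) hs_nonneg order.trans by blast
    have "hs s A (V (Suc n)) \<le> B + \<bar>h\<bar> / 2 * (C * hs s A (V n) * hs s A (V n) * hs s A (V n))"
      using B by (intro order.trans[OF V_Suc_le] add_mono mult_left_mono C) auto
    also have "\<dots> \<le> B + \<bar>h\<bar> / 2 * (C * (2 * B) * (2 * B) * (2 * B))"
      using Suc C(2) B0 by (intro add_left_mono mult_left_mono mult_mono) auto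
    also have "\<dots> = B + (4 * C * \<bar>h\<bar> * B\<^sup>2) * B" by (simp add: power2_eq_square)
    also have "\<dots> \<le> B + 1 * B" using B B0 by (intro add_left_mono mult_right_mono) auto
    finally show ?case by simp
  qed
  \<comment> \<open>The Lipschitz constant on radius \<open>3 / 2 * r\<close> times |h|/2 is at most
    9/16, so the increments decay geometrically.\<close>
  have step: "hs 0 A (\<lambda>l. V (Suc (Suc n)) l - V (Suc n) l) \<le>
      9 / 16 * hs 0 A (\<lambda>l. V (Suc n) l - V n l)" for n
  proof -
    have "hs 0 A (\<lambda>l. V (Suc (Suc n)) l - V (Suc n) l) \<le>
      hs 0 A (\<lambda>l. of_real (h / 2) * (tri A (V (Suc n)) (V (Suc n)) (V (Suc n)) l - tri A (V n) (V n)
          (V n) l))"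
    proof (rule hs_mono_cmod)
      fix l
      have eq: "(1 + \<i> * of_real (\<tau> l)) * (V (Suc (Suc n)) l - V (Suc n) l) =
        \<i> * (of_real (h / 2) * (tri A (V (Suc n)) (V (Suc n)) (V (Suc n)) l - tri A (V n) (V n) (V
            n) l))"
        unfolding right_diff_distrib V_Suc by (simp add: algebra_simps)
      show "cmod (V (Suc (Suc n)) l - V (Suc n) l) \<le> cmod (of_real (h / 2) *
          (tri A (V (Suc n)) (V (Suc n)) (V (Suc n)) l - tri A (V n) (V n) (V n) l))"
        using cmod_le_resolvent[of "V (Suc (Suc n)) l - V (Suc n) l" "\<tau> l"] unfolding eq
            by (simp add: norm_mult)
    qed
    also have "\<dots> = \<bar>h\<bar> / 2 * hs 0 A (\<lambda>l. tri A (V (Suc n)) (V (Suc n)) (V (Suc n)) l - tri A (V n)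
        (V n) (V n) l)"
      by (simp add: hs_scale del: of_real_divide)
    also have "\<dots> \<le> \<bar>h\<bar> / 2 * (3 * real (card A) * (3 / 2 * r)\<^sup>2 * hs 0 A (\<lambda>l. V (Suc n) l - V n l))"
      using assms(1) bound0 by (intro mult_left_mono hs0_tri_diff_le) auto
    also have "\<dots> = (6 * \<bar>h\<bar> * card A * r\<^sup>2) * (9 / 16 * hs 0 A (\<lambda>l. V (Suc n) l - V n l))"
      by (simp add: power2_eq_square)
    also have "\<dots> \<le> 1 * (9 / 16 * hs 0 A (\<lambda>l. V (Suc n) l - V n l))"
      using h by (intro mult_right_mono) (auto simp: r_def)
    finally show ?thesis by simp
  qed
  define D where "D = hs 0 A (\<lambda>l. V (Suc 0) l - V 0 l)"
  have geo: "hs 0 A (\<lambda>l. V (Suc n) l - V n l) \<le> (9 / 16) ^ n * D" for n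
  proof (induction n)
    case (Suc n)
    then show ?case using order.trans[OF step mult_left_mono[OF Suc, of "9/16"]]
        by (simp add: mult_ac)
  qed (simp add: D_def)
  have "convergent (\<lambda>n. V n l)" if "l \<in> A" for l
  proof -
    have "summable (\<lambda>n. (9 / 16) ^ n * D)" by (intro summable_mult2 summable_geometric) simp
    moreover have "norm (V (Suc n) l - V n l) \<le> (9 / 16) ^ n * D" for n
      using cmod_le_hs[OF assms(1) that, of "\<lambda>l. V (Suc n) l - V n l"] geo[of n] by linarith
    ultimately have "summable (\<lambda>n. V (Suc n) l - V n l)"
      by (rule summable_comparison_test'[where N = 0])
    then have "convergent (\<lambda>n. V n l - V 0 l)"
      unfolding summable_iff_convergent sum_lessThan_telescope[of "\<lambda>n. V n l"] .
    then show ?thesis by (simp add: convergent_diff_const_right_iff)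
  qed
  then obtain m where m: "\<And>l. l \<in> A \<Longrightarrow> (\<lambda>n. V n l) \<longlonglongrightarrow> m l"
    unfolding convergent_def by metis
  \<comment> \<open>The limit is the midpoint; the end point is recovered from it and
    \<open>y\<close>.\<close>
  define z where "z l = 2 * m l - y l" for l
  have mz: "(z l + y l) / 2 = m l" for l by (simp add: z_def)
  show thesis
  proof
    show "midpoint_step s A h y z"
      unfolding midpoint_step_iff mz \<tau>_def[symmetric]
    proof
      fix l assume "l \<in> A"
      have "(\<lambda>n. (1 + \<i> * of_real (\<tau> l)) * V (Suc n) l) \<longlonglongrightarrow> (1 + \<i> * of_real (\<tau> l)) * m l"
        using m[OF \<open>l \<in> A\<close>] by (intro tendsto_intros LIMSEQ_Suc)
      moreover have "(\<lambda>n. (1 + \<i> * of_real (\<tau> l)) * V (Suc n) l) \<longlonglongrightarrow>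
          y l + \<i> * of_real (h / 2) * tri A m m m l"
        unfolding V_Suc by (intro tendsto_intros tendsto_tri m)
      ultimately show "(1 + \<i> * of_real (\<tau> l)) * m l = y l + \<i> * of_real (h / 2) * tri A m m m l"
        by (rule LIMSEQ_unique)
    qed
    show "hs s A (\<lambda>l. (z l + y l) / 2) \<le> 2 * B" if "hs s A y \<le> B" "4 * C * \<bar>h\<bar> * B\<^sup>2 \<le> 1" for B
    proof -
      have "(\<lambda>n. hs s A (V n)) \<longlonglongrightarrow> hs s A m" by (intro tendsto_hs m)
      then show ?thesis unfolding mz by (rule LIMSEQ_le_const2) (use bounds[OF that] in blast)
    qed
  qed
qed

text \<open>The H^s bound is known for the Picard limit only, and L2 uniqueness identifies an
  arbitrary solution with it on \<open>A\<close>. The factor 5 comes from z = 2m - y with the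
  midpoint m bounded by 2B.\<close>

lemma midpoint_step_bound:
  fixes h :: real
  assumes "finite A" and h: "6 * \<bar>h\<bar> * card A * (hs 0 A y)\<^sup>2 \<le> 1"
    and C: "\<And>a b c. hs s A (tri A a b c) \<le> C * hs s A a * hs s A b * hs s A c" "0 \<le> C"
    and B: "hs s A y \<le> B" "4 * C * \<bar>h\<bar> * B\<^sup>2 \<le> 1"
    and z: "midpoint_step s A h y z"
  shows "hs s A (\<lambda>l. (z l + y l) / 2) \<le> 2 * B" "hs s A z \<le> 5 * B"
proof -
  obtain z' where z': "midpoint_step s A h y z'" and "hs s A (\<lambda>l. (z' l + y l) / 2) \<le> 2 * B"
    using midpoint_step_exists[OF assms(1-4)] B by metis
  moreover have "hs s A (\<lambda>l. (z l + y l) / 2) = hs s A (\<lambda>l. (z' l + y l) / 2)"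
    using midpoint_step_unique[OF assms(1,2) z z'] by (intro hs_cong) auto
  ultimately show m: "hs s A (\<lambda>l. (z l + y l) / 2) \<le> 2 * B" by simp
  have "hs s A z = hs s A (\<lambda>l. 2 * ((z l + y l) / 2) - y l)"
      by (intro hs_cong) (simp add: field_simps)
  also have "\<dots> \<le> hs s A (\<lambda>l. 2 * ((z l + y l) / 2)) + hs s A y" by (rule hs_triangle_diff)
  also have "\<dots> = 2 * hs s A (\<lambda>l. (z l + y l) / 2) + hs s A y" unfolding hs_scale by simp
  finally show "hs s A z \<le> 5 * B" using m B by linarith
qed

text \<open>Solved for the new difference, the linear part becomes the Cayley factor (1 - i tau)/(1
  + i tau) of modulus one, so only the Lipschitz term causes growth. The growth factor must be 1 +
  O(h), not merely bounded, because it is compounded over T/k steps.\<close>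

lemma midpoint_step_stable:
  assumes C: "\<And>a b c. hs s A (tri A a b c) \<le> C * hs s A a * hs s A b * hs s A c" "0 \<le> C"
    and z: "midpoint_step s A h y z" and z': "midpoint_step s A h y' z'"
    and R: "hs s A (\<lambda>l. (z l + y l) / 2) \<le> R" "hs s A (\<lambda>l. (z' l + y' l) / 2) \<le> R"
    and \<kappa>: "3 / 2 * C * R\<^sup>2 * \<bar>h\<bar> \<le> \<kappa>" "\<kappa> \<le> 1 / 2"
  shows "hs s A (\<lambda>l. z l - z' l) \<le> exp (4 * \<kappa>) * hs s A (\<lambda>l. y l - y' l)"
proof -
  define m where "m = (\<lambda>i. (z i + y i) / 2)"
  define m' where "m' = (\<lambda>i. (z' i + y' i) / 2)"
  define e where "e = hs s A (\<lambda>l. y l - y' l)"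
  define e' where "e' = hs s A (\<lambda>l. z l - z' l)"
  have "e' \<le> e + \<bar>h\<bar> * hs s A (\<lambda>l. tri A m m m l - tri A m' m' m' l)"
    unfolding e_def e'_def
  proof (rule hs_triangle_bound)
    fix l assume l: "l \<in> A"
    let ?t = "h / 2 * \<bar>of_int l\<bar> powr (2 * s)"
    let ?g = "tri A m m m l - tri A m' m' m' l"
    have diff: "(1 + \<i> * of_real ?t) * (z l - z' l) =
        (1 - \<i> * of_real ?t) * (y l - y' l) + \<i> * of_real h * ?g"
    proof -
      have eq: "(1 + \<i> * (H / 2 * Q)) * Z = (1 - \<i> * (H / 2 * Q)) * Y + \<i> * H * X"
        if "Z = Y + H * (- \<i> * Q * ((Z + Y) / 2) + \<i> * X)" for Z Y H Q X :: complex
      proof -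
        have "(1 + \<i> * (H / 2 * Q)) * Z - ((1 - \<i> * (H / 2 * Q)) * Y + \<i> * H * X) =
           Z - (Y + H * (- \<i> * Q * ((Z + Y) / 2) + \<i> * X))"
          by (simp add: field_simps)
        with that show ?thesis by (metis right_minus_eq)
      qed
      have "z l = y l + of_real h * (- \<i> * of_real (\<bar>of_int l\<bar> powr (2 * s)) * ((z l + y l) / 2) + \<i>
          * tri A m m m l)"
        using z l unfolding midpoint_step_def m_def by blast
      from eq[OF this] have 1: "(1 + \<i> * of_real ?t) * z l =
          (1 - \<i> * of_real ?t) * y l + \<i> * of_real h * tri A m m m l"
        by simp
      have "z' l = y' l + of_real h * (- \<i> * of_real (\<bar>of_int l\<bar> powr (2 * s)) * ((z' l + y' l) / 2)
          + \<i> * tri A m' m' m' l)"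
        using z' l unfolding midpoint_step_def m'_def by blast
      from eq[OF this] have 2: "(1 + \<i> * of_real ?t) * z' l =
          (1 - \<i> * of_real ?t) * y' l + \<i> * of_real h * tri A m' m' m' l"
        by simp
      show ?thesis unfolding right_diff_distrib 1 2 by simp
    qed
    have "cmod (1 + \<i> * of_real ?t) * cmod (z l - z' l) \<le>
        cmod (1 - \<i> * of_real ?t) * cmod (y l - y' l) + \<bar>h\<bar> * cmod ?g"
      using norm_triangle_ineq[of "(1 - \<i> * of_real ?t) * (y l - y' l)" "\<i> * of_real h * ?g"]
      unfolding diff[symmetric] by (simp add: norm_mult)
    also have "cmod (1 - \<i> * of_real ?t) = cmod (1 + \<i> * of_real ?t)" by (simp add: cmod_def)
    also have "\<bar>h\<bar> * cmod ?g \<le> cmod (1 + \<i> * of_real ?t) * (\<bar>h\<bar> * cmod ?g)"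
      using mult_right_mono[OF cmod_le_resolvent[of 1 ?t], of "\<bar>h\<bar> * cmod ?g"] by simp
    finally have "cmod (1 + \<i> * of_real ?t) * cmod (z l - z' l) \<le>
       cmod (1 + \<i> * of_real ?t) * (cmod (y l - y' l) + \<bar>h\<bar> * cmod ?g)" by (simp add: distrib_left)
    moreover have "0 < cmod (1 + \<i> * of_real ?t)" using cmod_le_resolvent[of 1 ?t]
      unfolding mult_1_right norm_one by linarith
    ultimately show "cmod (z l - z' l) \<le> cmod (y l - y' l) + \<bar>h\<bar> * cmod ?g"
      by (simp only: mult_le_cancel_left_pos)
  qed simp
  also have "hs s A (\<lambda>l. tri A m m m l - tri A m' m' m' l) \<le> 3 * C * R\<^sup>2 * hs s A (\<lambda>l. m l - m' l)"
    using R unfolding m_def m'_def by (intro hs_tri_diff_le C)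
  also have "hs s A (\<lambda>l. m l - m' l) \<le> (e' + e) / 2"
  proof -
    have "hs s A (\<lambda>l. m l - m' l) = hs s A (\<lambda>l. 1/2 * ((z l - z' l) + (y l - y' l)))"
      by (intro hs_cong) (auto simp: m_def m'_def field_simps)
    also have "\<dots> = 1 / 2 * hs s A (\<lambda>l. (z l - z' l) + (y l - y' l))" unfolding hs_scale by simp
    also have "\<dots> \<le> 1 / 2 * (e' + e)" unfolding e_def e'_def
        by (intro mult_left_mono hs_triangle) simp
    finally show ?thesis by simp
  qed
  finally have "e' \<le> e + \<bar>h\<bar> * (3 * C * R\<^sup>2 * ((e' + e) / 2))" using C(2)
      by (simp add: mult_left_mono)
  also have "\<dots> = e + (3 / 2 * C * R\<^sup>2 * \<bar>h\<bar>) * (e' + e)" by simp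
  also have "\<dots> \<le> e + \<kappa> * (e' + e)" using \<kappa>
      by (intro add_left_mono mult_right_mono) (auto simp: e_def e'_def)
  finally have 1: "(1 - \<kappa>) * e' \<le> (1 + \<kappa>) * e" by (simp add: algebra_simps)
  have "0 \<le> 3 / 2 * C * R\<^sup>2 * \<bar>h\<bar>" using C(2) by simp
  with \<kappa>(1) have k0: "0 \<le> \<kappa>" by linarith
  \<comment> \<open>The difference of the two sides is 2\<kappa>(1 - 2\<kappa>), which is where
    \<kappa> \<le> 1/2 enters.\<close>
  have "1 + \<kappa> \<le> (1 - \<kappa>) * (1 + 4 * \<kappa>)"
    using mult_left_mono[OF \<kappa>(2) k0] by (simp add: algebra_simps)
  then have "(1 + \<kappa>) * e \<le> (1 - \<kappa>) * (1 + 4 * \<kappa>) * e" by (intro mult_right_mono) (auto simp: e_def)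
  with 1 have "(1 - \<kappa>) * e' \<le> (1 - \<kappa>) * ((1 + 4 * \<kappa>) * e)" by simp
  then have "e' \<le> (1 + 4 * \<kappa>) * e" using \<kappa>(2) by (subst (asm) mult_le_cancel_left_pos) auto
  also have "\<dots> \<le> exp (4 * \<kappa>) * e" by (intro mult_right_mono exp_ge_add_one_self) (auto simp: e_def)
  finally show ?thesis by (simp add: e_def e'_def)
qed

text \<open>Each stage may enlarge the H^s bound by a factor 5, which is harmless because the number
  of stages is fixed. The L2 condition suffers no such loss, the mass being the same at all
  stages.\<close>

lemma stages_bound:
  fixes h :: "nat \<Rightarrow> real" and \<eta> :: real
  assumes "finite A" and \<eta>: "\<And>j. j \<in> {1..q} \<Longrightarrow> \<bar>h j\<bar> \<le> \<eta>" "0 \<le> \<eta>"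
    and h: "6 * \<eta> * card A * (hs 0 A (Y 0))\<^sup>2 \<le> 1"
    and C: "\<And>a b c. hs s A (tri A a b c) \<le> C * hs s A a * hs s A b * hs s A c" "0 \<le> C"
    and B: "hs s A (Y 0) \<le> B" "4 * C * \<eta> * (5 ^ q * B)\<^sup>2 \<le> 1"
    and Y: "\<And>j. j \<in> {1..q} \<Longrightarrow> midpoint_step s A (h j) (Y (j - 1)) (Y j)"
  shows "j \<le> q \<Longrightarrow> hs s A (Y j) \<le> 5 ^ j * B"
    and "j \<in> {1..q} \<Longrightarrow> hs s A (\<lambda>l. (Y j l + Y (j - 1) l) / 2) \<le> 2 * (5 ^ q * B)"
proof -
  have B0: "0 \<le> B" using B(1) hs_nonneg order.trans by blast
  have mass: "j \<le> q \<Longrightarrow> hs 0 A (Y j) = hs 0 A (Y 0)" for j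
  proof (induction j)
    case (Suc j)
    then show ?case using midpoint_step_mass[OF Y[of "Suc j"]] by simp
  qed simp
  have h': "6 * \<bar>h j\<bar> * card A * (hs 0 A (Y (j - 1)))\<^sup>2 \<le> 1" if "j \<in> {1..q}" for j
  proof -
    have "6 * \<bar>h j\<bar> * card A * (hs 0 A (Y (j - 1)))\<^sup>2 \<le> 6 * \<eta> * card A * (hs 0 A (Y 0))\<^sup>2"
      using that \<eta> mass[of "j - 1"] by (intro mult_mono) auto
    with h show ?thesis by simp
  qed
  have B': "4 * C * \<bar>h j\<bar> * (5 ^ i * B)\<^sup>2 \<le> 1" if "j \<in> {1..q}" "i \<le> q" for i j
  proof -
    have "4 * C * \<bar>h j\<bar> * (5 ^ i * B)\<^sup>2 \<le> 4 * C * \<eta> * (5 ^ q * B)\<^sup>2"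
      using that \<eta> C(2) B0 by (intro mult_mono power_mono) (auto intro: power_increasing)
    with B show ?thesis by simp
  qed
  have main: "j \<le> q \<Longrightarrow> hs s A (Y j) \<le> 5 ^ j * B" for j
  proof (induction j)
    case 0
    then show ?case using B by simp
  next
    case (Suc j)
    then have "hs s A (Y (Suc j)) \<le> 5 * (5 ^ j * B)"
      using h'[of "Suc j"] B'[of "Suc j" j] Y[of "Suc j"]
      by (intro midpoint_step_bound(2)[OF assms(1) _ C, where y = "Y j" and h = "h (Suc j)"]) auto
    then show ?case by simp
  qed
  then show "j \<le> q \<Longrightarrow> hs s A (Y j) \<le> 5 ^ j * B" .
  assume j: "j \<in> {1..q}"
  then have "hs s A (\<lambda>l. (Y j l + Y (j - 1) l) / 2) \<le> 2 * (5 ^ (j - 1) * B)"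
    using h'[OF j] B'[OF j, of "j - 1"] Y[OF j] main[of "j - 1"]
    by (intro midpoint_step_bound(1)[OF assms(1) _ C]) auto
  also have "\<dots> \<le> 2 * (5 ^ q * B)"
    using j B0 by (intro mult_left_mono mult_right_mono power_increasing) auto
  finally show "hs s A (\<lambda>l. (Y j l + Y (j - 1) l) / 2) \<le> 2 * (5 ^ q * B)" .
qed

lemma stages_stable:
  fixes h :: "nat \<Rightarrow> real" and \<eta> :: real
  assumes "finite A" and \<eta>: "\<And>j. j \<in> {1..q} \<Longrightarrow> \<bar>h j\<bar> \<le> \<eta>" "0 \<le> \<eta>"
    and C: "\<And>a b c. hs s A (tri A a b c) \<le> C * hs s A a * hs s A b * hs s A c" "0 \<le> C"
    and B: "12 * C * \<eta> * (5 ^ q * B)\<^sup>2 \<le> 1"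
    and h: "6 * \<eta> * card A * (hs 0 A (Y 0))\<^sup>2 \<le> 1" "6 * \<eta> * card A * (hs 0 A (Y' 0))\<^sup>2 \<le> 1"
    and Y0: "hs s A (Y 0) \<le> B" "hs s A (Y' 0) \<le> B"
    and Y: "\<And>j. j \<in> {1..q} \<Longrightarrow> midpoint_step s A (h j) (Y (j - 1)) (Y j)"
    and Y': "\<And>j. j \<in> {1..q} \<Longrightarrow> midpoint_step s A (h j) (Y' (j - 1)) (Y' j)"
  shows "hs s A (\<lambda>l. Y q l - Y' q l) \<le>
      exp (24 * q * C * (5 ^ q * B)\<^sup>2 * \<eta>) * hs s A (\<lambda>l. Y 0 l - Y' 0 l)"
proof -
  \<comment> \<open>This is 3/2 * C * R^2 * \<eta> for the midpoint radius R = 2 * 5^q * B, and the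
    hypothesis with constant 12 says that it is at most 1/2.\<close>
  let ?\<kappa> = "6 * C * (5 ^ q * B)\<^sup>2 * \<eta>"
  have B4: "4 * C * \<eta> * (5 ^ q * B)\<^sup>2 \<le> 1"
  proof -
    have "0 \<le> C * \<eta> * (5 ^ q * B)\<^sup>2" using C \<eta> by simp
    with B show ?thesis by linarith
  qed
  have "j \<le> q \<Longrightarrow> hs s A (\<lambda>l. Y j l - Y' j l) \<le> exp (j * (4 * ?\<kappa>)) * hs s A (\<lambda>l. Y 0 l - Y' 0 l)"
      for j
  proof (induction j)
    case (Suc j)
    have j: "Suc j \<in> {1..q}" using Suc by simp
    have "hs s A (\<lambda>l. Y (Suc j) l - Y' (Suc j) l) \<le> exp (4 * ?\<kappa>) * hs s A (\<lambda>l. Y j l - Y' j l)"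
    proof (rule midpoint_step_stable[OF C])
      show "midpoint_step s A (h (Suc j)) (Y j) (Y (Suc j))" "midpoint_step s A (h (Suc j)) (Y' j)
          (Y' (Suc j))"
        using Y[OF j] Y'[OF j] by auto
      show "hs s A (\<lambda>l. (Y (Suc j) l + Y j l) / 2) \<le> 2 * (5 ^ q * B)"
        using stages_bound(2)[OF assms(1) \<eta> h(1) C Y0(1) B4 Y j] by simp
      show "hs s A (\<lambda>l. (Y' (Suc j) l + Y' j l) / 2) \<le> 2 * (5 ^ q * B)"
        using stages_bound(2)[OF assms(1) \<eta> h(2) C Y0(2) B4 Y' j] by simp
      have "3 / 2 * C * (2 * (5 ^ q * B))\<^sup>2 * \<bar>h (Suc j)\<bar> \<le> 3 / 2 * C * (2 * (5 ^ q * B))\<^sup>2 * \<eta>"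
        using \<eta>(1)[OF j] C(2) by (intro mult_left_mono) auto
      then show "3 / 2 * C * (2 * (5 ^ q * B))\<^sup>2 * \<bar>h (Suc j)\<bar> \<le> ?\<kappa>"
        by (simp add: power_mult_distrib mult_ac)
      show "?\<kappa> \<le> 1 / 2" using B by (simp add: mult_ac)
    qed
    also have "\<dots> \<le> exp (4 * ?\<kappa>) * (exp (j * (4 * ?\<kappa>)) * hs s A (\<lambda>l. Y 0 l - Y' 0 l))"
      using Suc by (intro mult_left_mono) auto
    also have "\<dots> = exp (4 * ?\<kappa> + j * (4 * ?\<kappa>)) * hs s A (\<lambda>l. Y 0 l - Y' 0 l)" by (simp add: exp_add)
    finally show ?case by (simp add: algebra_simps)
  qed simp
  from this[of q] show ?thesis by (simp add: mult_ac)
qed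

section \<open>Error of the spatial semidiscretization\<close>

text \<open>\<open>exp (- K * t) * (E t + \<epsilon>)\<close> has a nonpositive derivative. As
  derivatives are one-sided at the end points, the mean value theorem is applied within the
  interval.\<close>

lemma Gronwall_linear:
  fixes E E' :: "real \<Rightarrow> real"
  assumes E: "\<And>t. t \<in> {0..\<tau>} \<Longrightarrow> (E has_real_derivative E' t) (at t within {0..\<tau>})"
    and le: "\<And>t. t \<in> {0..\<tau>} \<Longrightarrow> E' t \<le> K * (E t + \<epsilon>)" and t: "t \<in> {0..\<tau>}"
  shows "E t + \<epsilon> \<le> exp (K * t) * (E 0 + \<epsilon>)"
proof -
  define \<phi> where "\<phi> t = exp (- K * t) * (E t + \<epsilon>)" for t
  have "\<exists>x\<in>{0..t}. \<phi> t - \<phi> 0 = (exp (- K * x) * (E' x - K * (E x + \<epsilon>))) * (t - 0)"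
  proof (rule mvt_very_simple)
    show "0 \<le> t" using t by simp
    fix x assume x: "0 \<le> x" "x \<le> t"
    have "(E has_real_derivative E' x) (at x within {0..t})"
      by (rule has_field_derivative_subset[OF E]) (use x t in auto)
    then have "((\<lambda>t. E t + \<epsilon>) has_real_derivative E' x + 0) (at x within {0..t})"
      by (intro DERIV_add DERIV_const)
    moreover have "((\<lambda>t. exp (- K * t)) has_real_derivative exp (- K * x) * (- K)) (at x within
        {0..t})"
      by (rule derivative_eq_intros refl | simp)+
    ultimately have "(\<phi> has_real_derivative exp (- K * x) * (- K) * (E x + \<epsilon>) + (E' x + 0) * exp (-
        K * x)) (at x within {0..t})"
      unfolding \<phi>_def by (intro DERIV_mult)
    also have "exp (- K * x) * (- K) * (E x + \<epsilon>) + (E' x + 0) * exp (- K * x) =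
        exp (- K * x) * (E' x - K * (E x + \<epsilon>))"
      by (simp add: algebra_simps)
    finally have "(\<phi> has_real_derivative exp (- K * x) * (E' x - K * (E x + \<epsilon>))) (at x within
        {0..t})" .
    then show "(\<phi> has_derivative (\<lambda>y. (exp (- K * x) * (E' x - K * (E x + \<epsilon>))) * y)) (at x within
        {0..t})"
      by (simp add: has_field_derivative_def)
  qed
  then obtain x where x: "x \<in> {0..t}" "\<phi> t - \<phi> 0 = (exp (- K * x) * (E' x - K * (E x + \<epsilon>))) * t"
      by auto
  have "(exp (- K * x) * (E' x - K * (E x + \<epsilon>))) * t \<le> 0"
    using le[of x] x t by (intro mult_nonpos_nonneg mult_nonneg_nonpos) auto
  with x have "\<phi> t \<le> \<phi> 0" by simp
  then have "exp (K * t) * \<phi> t \<le> exp (K * t) * \<phi> 0" by (intro mult_left_mono) auto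
  then show ?thesis by (simp add: \<phi>_def mult.assoc[symmetric] flip: exp_add)
qed

text \<open>The square is used because the norm itself need not be differentiable where it vanishes,
  as the error does at t = 0.\<close>

lemma has_derivative_hs_power2:
  assumes "\<And>l. l \<in> A \<Longrightarrow> ((\<lambda>t. x t l) has_vector_derivative x' l) (at t within S)"
  shows "((\<lambda>t. (hs s A (x t))\<^sup>2) has_real_derivative
    2 * (\<Sum>l\<in>A. (weight s l)\<^sup>2 * Re (cnj (x t l) * x' l))) (at t within S)"
proof -
  have "((\<lambda>t. (1 + (of_int l)\<^sup>2) powr s * (cmod (x t l))\<^sup>2) has_real_derivative
      2 * ((weight s l)\<^sup>2 * Re (cnj (x t l) * x' l))) (at t within S)" if "l \<in> A" for l
  proof -
    have 1: "((\<lambda>t. Re (x t l)) has_real_derivative Re (x' l)) (at t within S)"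
      using bounded_linear.has_vector_derivative[OF bounded_linear_Re assms[OF that]]
      by (simp add: has_real_derivative_iff_has_vector_derivative)
    have 2: "((\<lambda>t. Im (x t l)) has_real_derivative Im (x' l)) (at t within S)"
      using bounded_linear.has_vector_derivative[OF bounded_linear_Im assms[OF that]]
      by (simp add: has_real_derivative_iff_has_vector_derivative)
    show ?thesis unfolding cmod_power2 weight_power2
      by (rule derivative_eq_intros 1 2 refl | simp add: algebra_simps)+
  qed
  then show ?thesis unfolding hs_power2 sum_distrib_left by (intro DERIV_sum) auto
qed

lemma semidiscrete_mass:
  assumes c: "\<And>t l. t \<in> {0..T} \<Longrightarrow> l \<in> A \<Longrightarrow> ((\<lambda>t. c t l) has_vector_derivative
      - \<i> * of_real (\<bar>of_int l\<bar> powr (2 * s)) * c t l + \<i> * tri A (c t) (c t) (c t) l) (at t within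
          {0..T})"
    and t: "t \<in> {0..T}"
  shows "hs 0 A (c t) = hs 0 A (c 0)"
proof -
  have "((\<lambda>t. (hs 0 A (c t))\<^sup>2) has_real_derivative 0) (at t within {0..T})" if "t \<in> {0..T}" for t
  proof -
    have "(\<Sum>l\<in>A. (weight 0 l)\<^sup>2 * Re (cnj (c t l) *
        (- \<i> * of_real (\<bar>of_int l\<bar> powr (2 * s)) * c t l + \<i> * tri A (c t) (c t) (c t) l)))
      = - Im (\<Sum>l\<in>A. cnj (c t l) * tri A (c t) (c t) (c t) l)"
      unfolding Im_sum sum_negf[symmetric] by (intro sum.cong refl) (simp add: algebra_simps)
    then show ?thesis using has_derivative_hs_power2[of A c _ t "{0..T}" 0, OF c] that
      unfolding tri_inner_real by simp
  qed
  then have "((\<lambda>t. (hs 0 A (c t))\<^sup>2) has_derivative (*) 0) (at x within {0..t})" if "x \<in> {0..t}"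
      for x
    using that t unfolding has_field_derivative_def
        by (auto intro!: has_derivative_subset[where s = "{0..T}" and t = "{0..t}"])
  then have "\<exists>x\<in>{0..t}. (hs 0 A (c t))\<^sup>2 - (hs 0 A (c 0))\<^sup>2 = 0 * (t - 0)"
    by (intro mvt_very_simple[where f' = "\<lambda>_. (*) 0"]) (use t in \<open>auto simp del: mult_zero_left\<close>)
  then show ?thesis by (simp add: power2_eq_iff_nonneg)
qed

text \<open>\<open>c\<close> is the semidiscrete solution, \<open>u\<close> the exact one and
  \<open>G t\<close> the full cubic term, so the defect bound measures the truncation of the
  convolution. The energy estimate is valid while the error is at most 1; \<open>small\<close> makes
  its conclusion strictly smaller than 1, so the error never reaches 1.\<close>

lemma semidiscrete_error_local:
  assumes "finite A"
    and C: "\<And>a b c. hs s A (tri A a b c) \<le> C * hs s A a * hs s A b * hs s A c" "0 \<le> C"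
    and c: "\<And>t l. t \<in> {0..T} \<Longrightarrow> l \<in> A \<Longrightarrow> ((\<lambda>t. c t l) has_vector_derivative
      - \<i> * of_real (\<bar>of_int l\<bar> powr (2 * s)) * c t l + \<i> * tri A (c t) (c t) (c t) l) (at t within
          {0..T})"
    and u: "\<And>t l. t \<in> {0..T} \<Longrightarrow> l \<in> A \<Longrightarrow> ((\<lambda>t. u t l) has_vector_derivative
      - \<i> * of_real (\<bar>of_int l\<bar> powr (2 * s)) * u t l + \<i> * G t l) (at t within {0..T})"
    and init: "\<And>l. l \<in> A \<Longrightarrow> c 0 l = u 0 l"
    and B: "\<And>t. t \<in> {0..T} \<Longrightarrow> hs s A (u t) \<le> B" "0 \<le> B"
    and G: "\<And>t. t \<in> {0..T} \<Longrightarrow> hs s A (\<lambda>l. tri A (u t) (u t) (u t) l - G t l) \<le> 3 * C * B\<^sup>2 * \<epsilon>" "0 \<le>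
        \<epsilon>"
    and small: "\<epsilon> * exp (9 * C * (B + 1)\<^sup>2 * T) < 1"
    and t: "t \<in> {0..T}"
  shows "hs s A (\<lambda>l. c t l - u t l) \<le> \<epsilon> * exp (9 * C * (B + 1)\<^sup>2 * T)"
proof -
  \<comment> \<open>The Lipschitz constant of the cubic term on radius B + 1, a ball containing both
    solutions while the error is at most 1.\<close>
  define L where "L = 3 * C * (B + 1)\<^sup>2"
  have L0: "0 \<le> L" using C by (simp add: L_def)
  define w where "w t l = c t l - u t l" for t l
  define E where "E t = (hs s A (w t))\<^sup>2" for t
  define g where "g t l = tri A (c t) (c t) (c t) l - G t l" for t l
  define E' where "E' t = 2 * (\<Sum>l\<in>A. (weight s l)\<^sup>2 * Re (cnj (w t l) *
     (- \<i> * of_real (\<bar>of_int l\<bar> powr (2 * s)) * w t l + \<i> * g t l)))" for t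
  have deriv: "(E has_real_derivative E' t) (at t within {0..T})" if "t \<in> {0..T}" for t
    unfolding E_def E'_def
  proof (rule has_derivative_hs_power2)
    fix l assume "l \<in> A"
    then show "((\<lambda>t. w t l) has_vector_derivative
        - \<i> * of_real (\<bar>of_int l\<bar> powr (2 * s)) * w t l + \<i> * g t l) (at t within {0..T})"
      using has_vector_derivative_diff[OF c[OF that] u[OF that], of l l]
          by (simp add: w_def g_def algebra_simps)
  qed
  have E'_le: "E' t \<le> 3 * L * (E t + \<epsilon>\<^sup>2)" if t: "t \<in> {0..T}" and w1: "E t \<le> 1" for t
  proof -
    have w1: "hs s A (w t) \<le> 1" using w1 abs_square_le_1[of "hs s A (w t)"] by (simp add: E_def)
    have "hs s A (c t) \<le> hs s A (\<lambda>l. w t l + u t l)" by (simp add: w_def)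
    also have "\<dots> \<le> 1 + B" using hs_triangle[of s A "w t" "u t"] w1 B(1)[OF t] by simp
    finally have cB: "hs s A (c t) \<le> B + 1" by simp
    have "hs s A (g t) = hs s A (\<lambda>l. (tri A (c t) (c t) (c t) l - tri A (u t) (u t) (u t) l) + (tri
        A (u t) (u t) (u t) l - G t l))"
      by (simp add: g_def[abs_def])
    also have "\<dots> \<le> hs s A (\<lambda>l. tri A (c t) (c t) (c t) l - tri A (u t) (u t) (u t) l) + hs s A (\<lambda>l.
        tri A (u t) (u t) (u t) l - G t l)"
      by (rule hs_triangle)
    also have "\<dots> \<le> L * hs s A (w t) + 3 * C * B\<^sup>2 * \<epsilon>"
      unfolding L_def w_def[abs_def] using B(1)[OF t] cB
      by (intro add_mono G t hs_tri_diff_le C) auto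
    also have "3 * C * B\<^sup>2 * \<epsilon> \<le> L * \<epsilon>"
      unfolding L_def using C(2) G(2) B(2) by (intro mult_right_mono mult_left_mono power_mono) auto
    finally have g_le: "hs s A (g t) \<le> L * (hs s A (w t) + \<epsilon>)" by (simp add: algebra_simps)
    have "E' t \<le> 2 * (\<Sum>l\<in>A. \<bar>weight s l * cmod (w t l)\<bar> * \<bar>weight s l * cmod (g t l)\<bar>)"
      unfolding E'_def
    proof (intro mult_left_mono sum_mono)
      fix l
      \<comment> \<open>The linear part is skew and disappears from the energy identity.\<close>
      have "Re (cnj (w t l) * (- \<i> * of_real (\<bar>of_int l\<bar> powr (2 * s)) * w t l + \<i> * g t l)) =
          Re (cnj (w t l) * (\<i> * g t l))"
        by (simp add: algebra_simps)
      also have "\<dots> \<le> cmod (w t l) * cmod (g t l)"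
        using complex_Re_le_cmod[of "cnj (w t l) * (\<i> * g t l)"]
            by (simp only: norm_mult complex_mod_cnj norm_ii mult_1_left)
      finally show "(weight s l)\<^sup>2 * Re (cnj (w t l) * (- \<i> * of_real (\<bar>of_int l\<bar> powr (2 * s)) * w
          t l + \<i> * g t l))
         \<le> \<bar>weight s l * cmod (w t l)\<bar> * \<bar>weight s l * cmod (g t l)\<bar>"
        using mult_left_mono[of _ _ "(weight s l)\<^sup>2"]
            by (simp add: abs_mult power2_eq_square mult_ac)
    qed simp
    also have "\<dots> \<le> 2 * (hs s A (w t) * hs s A (g t))"
      unfolding hs_def by (intro mult_left_mono L2_set_mult_ineq) simp
    also have "\<dots> \<le> 2 * (hs s A (w t) * (L * (hs s A (w t) + \<epsilon>)))"
      using g_le by (intro mult_left_mono) auto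
    also have "\<dots> = L * (2 * E t + 2 * (hs s A (w t) * \<epsilon>))"
        by (simp add: E_def power2_eq_square algebra_simps)
    also have "\<dots> \<le> L * (3 * (E t + \<epsilon>\<^sup>2))"
    proof (rule mult_left_mono[OF _ L0])
      show "2 * E t + 2 * (hs s A (w t) * \<epsilon>) \<le> 3 * (E t + \<epsilon>\<^sup>2)"
      proof -
        have "2 * b + 2 * a \<le> 3 * (b + c)" if "2 * a \<le> b + c" "0 \<le> c" for a b c :: real
          using that by (simp add: algebra_simps)
        moreover have "2 * (hs s A (w t) * \<epsilon>) \<le> E t + \<epsilon>\<^sup>2"
          using sum_squares_bound[of "hs s A (w t)" \<epsilon>] by (simp add: E_def mult.assoc)
        ultimately show ?thesis using zero_le_power2 by blast
      qed
    qed
    finally show ?thesis by (simp add: algebra_simps)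
  qed
  have local: "E t \<le> (\<epsilon> * exp (9 * C * (B + 1)\<^sup>2 * T))\<^sup>2"
      if \<tau>: "\<tau> \<in> {0..T}" "\<And>t. t \<in> {0..\<tau>} \<Longrightarrow> E t \<le> 1" "t \<in> {0..\<tau>}" for \<tau> t
  proof -
    have E0: "E 0 = 0" using init by (simp add: E_def hs_def L2_set_0' w_def)
    have "E t + \<epsilon>\<^sup>2 \<le> exp (3 * L * t) * (E 0 + \<epsilon>\<^sup>2)"
    proof (rule Gronwall_linear[OF _ _ that(3)])
      show "(E has_real_derivative E' t) (at t within {0..\<tau>})" if "t \<in> {0..\<tau>}" for t
        by (rule has_field_derivative_subset[OF deriv]) (use that \<tau> in auto)
      show "E' t \<le> 3 * L * (E t + \<epsilon>\<^sup>2)" if "t \<in> {0..\<tau>}" for t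
        using that \<tau> by (intro E'_le) auto
    qed
    then have "E t \<le> exp (3 * L * t) * \<epsilon>\<^sup>2" using E0 by (smt (verit) zero_le_power2)
    \<comment> \<open>Doubling the exponent makes the bound a perfect square.\<close>
    also have "\<dots> \<le> exp (2 * (3 * L * T)) * \<epsilon>\<^sup>2"
    proof (intro mult_right_mono)
      have "L * t \<le> L * T" "0 \<le> L * T" using L0 that by (auto intro: mult_left_mono)
      then show "exp (3 * L * t) \<le> exp (2 * (3 * L * T))" by simp
    qed simp
    also have "\<dots> = (\<epsilon> * exp (3 * L * T))\<^sup>2" by (simp add: power_mult_distrib flip: exp_double)
    finally show ?thesis by (simp add: L_def mult_ac)
  qed
  have small2: "(\<epsilon> * exp (9 * C * (B + 1)\<^sup>2 * T))\<^sup>2 < 1"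
    using small G(2) by (simp add: power_less_one_iff)
  have cont: "continuous_on {0..T} E"
    using deriv by (meson DERIV_continuous continuous_on_eq_continuous_within)
  have E1: "E t \<le> 1" if tT: "t \<in> {0..T}" for t
  proof (rule ccontr)
    assume "\<not> E t \<le> 1"
    have E0: "E 0 = 0" using init by (simp add: E_def hs_def L2_set_0' w_def)
    have ivt: "\<exists>x\<in>{0..t}. E x = 1" if "t \<in> {0..T}" "\<not> E t \<le> 1" for t
    proof -
      have "\<exists>x\<ge>0. x \<le> t \<and> E x = 1"
        using that E0 by (intro IVT' continuous_on_subset[OF cont]) auto
      then show ?thesis by auto
    qed
    \<comment> \<open>Compactness of this level set provides the first time at which
      \<open>E\<close> equals 1; up to that time \<open>E\<close> is at most 1 by the intermediate
      value theorem.\<close>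
    define S where "S = {x \<in> {0..T}. E x = 1}"
    have "closed S" unfolding S_def by (rule continuous_closed_preimage_constant[OF cont]) simp
    moreover have "bounded S" by (rule bounded_subset[of "{0..T}"]) (auto simp: S_def)
    ultimately have "compact S" by (simp add: compact_eq_bounded_closed)
    moreover have "S \<noteq> {}"
    proof -
      obtain x where "x \<in> {0..t}" "E x = 1" using ivt[OF tT \<open>\<not> E t \<le> 1\<close>] by blast
      then have "x \<in> S" using tT by (simp add: S_def)
      then show ?thesis by blast
    qed
    ultimately obtain \<tau> where \<tau>: "\<tau> \<in> S" "\<And>x. x \<in> S \<Longrightarrow> \<tau> \<le> x" by (meson compact_attains_inf)
    have "E x \<le> 1" if "x \<in> {0..\<tau>}" for x
    proof (rule ccontr)
      assume "\<not> E x \<le> 1"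
      moreover have "x \<in> {0..T}" using that \<tau>(1) by (auto simp: S_def)
      ultimately obtain y where "y \<in> {0..x}" "E y = 1" using ivt by blast
      then have "y \<in> S" using \<open>x \<in> {0..T}\<close> by (auto simp: S_def)
      then have "\<tau> \<le> y" by (rule \<tau>)
      then have "x = \<tau>" using \<open>y \<in> {0..x}\<close> that by auto
      then show False using \<open>\<not> E x \<le> 1\<close> \<tau>(1) by (simp add: S_def)
    qed
    then have "E \<tau> \<le> (\<epsilon> * exp (9 * C * (B + 1)\<^sup>2 * T))\<^sup>2"
      using \<tau>(1) by (intro local[of \<tau>]) (auto simp: S_def)
    then show False using small2 \<tau>(1) by (simp add: S_def)
  qed
  have "E t \<le> (\<epsilon> * exp (9 * C * (B + 1)\<^sup>2 * T))\<^sup>2" using t E1 by (intro local[of T]) auto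
  then show ?thesis unfolding E_def w_def[abs_def]
    by (rule power2_le_imp_le) (use G(2) in auto)
qed

text \<open>Beyond frequency N the quotient of the two weights is (1 + l^2)^((s - \<mu>)/2), which
  is at most N^(s - \<mu>).\<close>

lemma hs_tail_le:
  assumes F: "\<And>F. finite F \<Longrightarrow> hs \<mu> F v \<le> B" and "1 \<le> N" "s \<le> \<mu>" "finite F" "F \<inter> freqs N = {}"
  shows "hs s F v \<le> real N powr (s - \<mu>) * B"
proof -
  have "hs s F v \<le> L2_set (\<lambda>l. real N powr (s - \<mu>) * (weight \<mu> l * cmod (v l))) F"
    unfolding hs_def
  proof (rule L2_set_mono)
    fix l assume l: "l \<in> F"
    then have "l \<notin> freqs N" using assms(5) by blast
    then have "int N \<le> \<bar>l\<bar>" by (auto simp: freqs_def)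
    then have "real N \<le> \<bar>real_of_int l\<bar>" by linarith
    then have le: "(real N)\<^sup>2 \<le> 1 + (real_of_int l)\<^sup>2"
        using power_mono[of "real N" "\<bar>real_of_int l\<bar>" 2] by simp
    have "weight s l = weight \<mu> l * (1 + (real_of_int l)\<^sup>2) powr ((s - \<mu>) / 2)"
      unfolding weight_def by (simp add: diff_divide_distrib flip: powr_add)
    also have "\<dots> \<le> weight \<mu> l * ((real N)\<^sup>2) powr ((s - \<mu>) / 2)"
      using le assms(2,3) by (intro mult_left_mono powr_mono2') auto
    also have "((real N)\<^sup>2) powr ((s - \<mu>) / 2) = (real N powr 2) powr ((s - \<mu>) / 2)"
      using assms(2) by simp
    also have "\<dots> = real N powr (s - \<mu>)" unfolding powr_powr
        by (rule arg_cong[of _ _ "\<lambda>x. real N powr x"]) simp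
    finally have "weight s l \<le> weight \<mu> l * real N powr (s - \<mu>)" .
    from mult_right_mono[OF this, of "cmod (v l)"]
    show "weight s l * cmod (v l) \<le> real N powr (s - \<mu>) * (weight \<mu> l * cmod (v l))"
      by (simp add: mult_ac)
  qed simp
  also have "\<dots> = real N powr (s - \<mu>) * hs \<mu> F v" unfolding hs_def
      by (simp add: L2_set_right_distrib)
  also have "\<dots> \<le> real N powr (s - \<mu>) * B" using F assms(4) by (intro mult_left_mono) auto
  finally show ?thesis .
qed

lemma freqs_mono: "N \<le> M \<Longrightarrow> freqs N \<subseteq> freqs M" by (auto simp: freqs_def)

text \<open>The convolution over \<open>freqs N\<close> is compared with that over every larger
  \<open>freqs m\<close>. After extension by zero the inputs differ by the tail of \<open>v\<close>,
  so the bound is uniform in m and survives the limit.\<close>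

lemma hs_tri_truncation:
  assumes C: "\<And>A B a b c. finite A \<Longrightarrow> finite B \<Longrightarrow> hs s B (tri A a b c) \<le>
      C * hs s A a * hs s A b * hs s A c" "0 < C"
    and v: "\<And>F. finite F \<Longrightarrow> hs \<mu> F v \<le> B" and "1 \<le> N" "s \<le> \<mu>"
    and G: "\<And>l. l \<in> freqs N \<Longrightarrow> (\<lambda>m. tri (freqs m) v v v l) \<longlonglongrightarrow> G l"
  shows "hs s (freqs N) (\<lambda>l. tri (freqs N) v v v l - G l) \<le> 3 * C * B\<^sup>2 * (real N powr (s - \<mu>) * B)"
proof -
  have "hs s (freqs N) (\<lambda>l. tri (freqs N) v v v l - tri (freqs m) v v v l) \<le>
      3 * C * B\<^sup>2 * (real N powr (s - \<mu>) * B)"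
    if "N \<le> m" for m
  proof -
    define v' where "v' i = (if i \<in> freqs N then v i else 0)" for i
    have vs: "hs s F v \<le> B" if "finite F" for F
        using v[OF that] hs_mono_exponent[OF \<open>s \<le> \<mu>\<close>] order.trans by blast
    have "hs s (freqs N) (\<lambda>l. tri (freqs N) v v v l - tri (freqs m) v v v l)
       = hs s (freqs N) (\<lambda>l. tri (freqs m) v' v' v' l - tri (freqs m) v v v l)"
      unfolding tri_restrict[OF finite_freqs freqs_mono[OF that]] v'_def[abs_def] ..
    also have "\<dots> \<le> hs s (freqs m) (\<lambda>l. tri (freqs m) v' v' v' l - tri (freqs m) v v v l)"
      by (intro hs_subset freqs_mono that finite_freqs)
    also have "\<dots> \<le> 3 * C * B\<^sup>2 * hs s (freqs m) (\<lambda>l. v' l - v l)"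
    proof (intro hs_tri_diff_le C finite_freqs vs)
      have "hs s (freqs m) v' \<le> hs s (freqs m) v" by (rule hs_mono_cmod) (simp add: v'_def)
      then show "hs s (freqs m) v' \<le> B" using vs[of "freqs m"] by simp
    qed (use C in simp)
    also have "hs s (freqs m) (\<lambda>l. v' l - v l) = hs s (freqs m - freqs N) v"
      unfolding hs_def L2_set_def
      by (rule arg_cong[of _ _ sqrt], rule sum.mono_neutral_cong_right) (auto simp: v'_def)
    also have "\<dots> \<le> real N powr (s - \<mu>) * B"
      using v \<open>1 \<le> N\<close> \<open>s \<le> \<mu>\<close> by (intro hs_tail_le) auto
    finally show ?thesis using C(2) by (simp add: mult_left_mono)
  qed
  moreover have "(\<lambda>m. hs s (freqs N) (\<lambda>l. tri (freqs N) v v v l - tri (freqs m) v v v l)) \<longlonglongrightarrow>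
      hs s (freqs N) (\<lambda>l. tri (freqs N) v v v l - G l)"
    by (intro tendsto_hs tendsto_intros G)
  ultimately show ?thesis by (intro LIMSEQ_le_const2) blast+
qed

lemma hs_inverse_ineq:
  assumes "0 \<le> s" "N \<le> N0"
  shows "hs s (freqs N) c \<le> weight s (int N0) * hs 0 (freqs N) c"
proof -
  have "hs s (freqs N) c \<le> L2_set (\<lambda>l. weight s (int N0) * cmod (c l)) (freqs N)"
    unfolding hs_def
  proof (intro L2_set_mono mult_right_mono)
    fix l assume "l \<in> freqs N"
    then have "\<bar>real_of_int l\<bar> \<le> real N0" using assms by (auto simp: freqs_def)
    then have "(real_of_int l)\<^sup>2 \<le> (real N0)\<^sup>2" using power_mono[of "\<bar>real_of_int l\<bar>" "real N0" 2]
        by simp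
    then show "weight s l \<le> weight s (int N0)" unfolding weight_def using assms
        by (intro powr_mono2) auto
  qed auto
  then show ?thesis by (simp add: hs_def L2_set_right_distrib)
qed

lemma semidiscrete_error:
  assumes s: "1 / 2 < s" "s \<le> 1" "s < \<mu>" and "0 < T"
    and u: "\<And>t l. t \<in> {0..T} \<Longrightarrow> ((\<lambda>t. u t l) has_vector_derivative
      - \<i> * of_real (\<bar>of_int l\<bar> powr (2 * s)) * u t l + \<i> * G t l) (at t within {0..T})"
    and B: "\<And>t F. t \<in> {0..T} \<Longrightarrow> finite F \<Longrightarrow> hs \<mu> F (u t) \<le> B"
    and G: "\<And>t l. t \<in> {0..T} \<Longrightarrow> (\<lambda>m. tri (freqs m) (u t) (u t) (u t) l) \<longlonglongrightarrow> G t l"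
  obtains K where "0 < K"
    "\<And>N c t. \<lbrakk>1 \<le> N; \<And>t l. t \<in> {0..T} \<Longrightarrow> l \<in> freqs N \<Longrightarrow> ((\<lambda>t. c t l) has_vector_derivative
        - \<i> * of_real (\<bar>of_int l\<bar> powr (2 * s)) * c t l + \<i> * tri (freqs N) (c t) (c t) (c t) l) (at
            t within {0..T});
      \<And>l. l \<in> freqs N \<Longrightarrow> c 0 l = u 0 l; t \<in> {0..T}\<rbrakk>
     \<Longrightarrow> hs s (freqs N) (\<lambda>l. c t l - u t l) \<le> K * real N powr (s - \<mu>)"
proof -
  obtain C where C: "0 < C"
    "\<And>A B a b c. finite A \<Longrightarrow> finite B \<Longrightarrow> hs s B (tri A a b c) \<le> C * hs s A a * hs s A b * hs s A c"
    using tri_bound[OF s(1,2)] by blast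
  have Bs: "hs s F (u t) \<le> B" if "t \<in> {0..T}" "finite F" for t F
    using B[OF that] hs_mono_exponent[of s \<mu> F] s order.trans by fastforce
  have B0: "0 \<le> B" using B[of 0 "{}"] \<open>0 < T\<close> by (simp add: hs_def)
  define X where "X = exp (9 * C * (B + 1)\<^sup>2 * T)"
  have "(\<lambda>N. real N powr (s - \<mu>) * B * X) \<longlonglongrightarrow> 0 * B * X"
    using s by (intro tendsto_intros tendsto_neg_powr filterlim_real_sequentially) auto
  then have "\<forall>\<^sub>F N in sequentially. real N powr (s - \<mu>) * B * X < 1"
    by (rule order_tendstoD) simp
  then obtain N0 where N0: "\<And>N. N0 \<le> N \<Longrightarrow> real N powr (s - \<mu>) * B * X < 1"
    unfolding eventually_sequentially by blast
  \<comment> \<open>A crude bound for N < N0: the inverse inequality and mass conservation for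
    \<open>c\<close>, plus the bound of \<open>u\<close>.\<close>
  define D where "D = weight s (int N0) * B + B"
  have D0: "0 \<le> D" using B0 by (simp add: D_def)
  \<comment> \<open>\<open>B * X\<close> serves N at least N0. For smaller N the constant
    \<open>D\<close> is rescaled by the power of N0, since N^(s - \<mu>) is then at least N0^(s -
    \<mu>). The 1 makes \<open>K\<close> positive.\<close>
  define K where "K = B * X + D * real N0 powr (\<mu> - s) + 1"
  show thesis
  proof
    have X0: "0 < X" by (simp add: X_def)
    have "0 \<le> B * X" "0 \<le> D * real N0 powr (\<mu> - s)" using B0 D0 X0 by auto
    then show "0 < K" by (simp add: K_def)
    fix N c t
    assume N: "1 \<le> N" and c: "\<And>t l. t \<in> {0..T} \<Longrightarrow> l \<in> freqs N \<Longrightarrow> ((\<lambda>t. c t l) has_vector_derivative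
        - \<i> * of_real (\<bar>of_int l\<bar> powr (2 * s)) * c t l + \<i> * tri (freqs N) (c t) (c t) (c t) l) (at
            t within {0..T})"
      and init: "\<And>l. l \<in> freqs N \<Longrightarrow> c 0 l = u 0 l" and t: "t \<in> {0..T}"
    show "hs s (freqs N) (\<lambda>l. c t l - u t l) \<le> K * real N powr (s - \<mu>)"
    proof (cases "N0 \<le> N")
      case True
      have "hs s (freqs N) (\<lambda>l. c t l - u t l) \<le> real N powr (s - \<mu>) * B * X"
        unfolding X_def
      proof (rule semidiscrete_error_local[where G =
          G, OF finite_freqs C(2)[OF finite_freqs finite_freqs] _ c u init _ B0 _ _ _ t])
        show "real N powr (s - \<mu>) * B * exp (9 * C * (B + 1)\<^sup>2 * T) < 1"
          using N0[OF True] by (simp add: X_def)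
        show "hs s (freqs N) (\<lambda>l. tri (freqs N) (u t) (u t) (u t) l - G t l) \<le>
            3 * C * B\<^sup>2 * (real N powr (s - \<mu>) * B)"
          if "t \<in> {0..T}" for t
          using N s that by (intro hs_tri_truncation C B G) auto
      qed (use C B0 Bs in auto)
      also have "\<dots> \<le> K * real N powr (s - \<mu>)"
        using \<open>0 \<le> D * real N0 powr (\<mu> - s)\<close> mult_right_mono[of "B * X" K "real N powr (s - \<mu>)"]
        by (simp add: K_def mult_ac)
      finally show ?thesis .
    next
      case False
      have "hs s (freqs N) (\<lambda>l. c t l - u t l) \<le> hs s (freqs N) (c t) + hs s (freqs N) (u t)"
        by (rule hs_triangle_diff)
      also have "\<dots> \<le> weight s (int N0) * hs 0 (freqs N) (c t) + B"
        using False s t by (intro add_mono hs_inverse_ineq Bs) auto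
      also have "hs 0 (freqs N) (c t) = hs 0 (freqs N) (u 0)"
        using semidiscrete_mass[OF c t] hs_cong[OF init, where s = 0] by simp
      also have "\<dots> \<le> B" using hs_mono_exponent[of 0 s "freqs N" "u 0"] Bs[of 0 "freqs N"] s t
          by simp
      finally have "hs s (freqs N) (\<lambda>l. c t l - u t l) \<le> D" by (simp add: D_def mult_left_mono)
      also have "\<dots> \<le> D * (real N0 powr (\<mu> - s) * real N powr (s - \<mu>))"
      proof -
        have "1 = real N powr (\<mu> - s) * real N powr (s - \<mu>)" using N by (simp flip: powr_add)
        also have "\<dots> \<le> real N0 powr (\<mu> - s) * real N powr (s - \<mu>)"
          using False s by (intro mult_right_mono powr_mono2) auto
        finally show ?thesis using D0 by (simp add: mult_le_cancel_left1)
      qed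
      also have "\<dots> \<le> K * real N powr (s - \<mu>)"
        using \<open>0 \<le> B * X\<close> mult_right_mono[of "D * real N0 powr (\<mu> - s)" K "real N powr (s - \<mu>)"]
        by (simp add: K_def mult_ac)
      finally show ?thesis .
    qed
  qed
qed

section \<open>Trigonometric polynomials\<close>

definition trigpoly :: "int set \<Rightarrow> (int \<Rightarrow> complex) \<Rightarrow> real \<Rightarrow> complex" where
  "trigpoly A c x = (\<Sum>l\<in>A. c l * cis (of_int l * x))"

lemma continuous_on_trigpoly [continuous_intros]: "continuous_on S (trigpoly A c)"
  unfolding trigpoly_def[abs_def] by (intro continuous_intros)

lemma trig_space_iff: "f \<in> trig_space N \<longleftrightarrow> (\<exists>c. f = trigpoly (freqs N) c)"
  by (simp add: trig_space_def trigpoly_def[abs_def] freqs_def)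

lemma trigpoly_in_trig_space [simp]: "trigpoly (freqs N) c \<in> trig_space N"
  by (auto simp: trig_space_iff)

lemma fourier_proj_eq: "fourier_proj N f = trigpoly (freqs N) (fourier_coeff f)"
  by (simp add: fourier_proj_def trigpoly_def freqs_def fun_eq_iff)

section \<open>Fourier coefficients of continuous functions and of trigonometric polynomials\<close>

lemma continuous_on_coeff_integrand:
  "continuous_on {-pi..pi} f \<Longrightarrow> continuous_on {-pi..pi} (\<lambda>x. f x * cis (- (of_int l * x)))"
  by (intro continuous_intros)

text \<open>For continuous integrands the Lebesgue integral is a gauge integral, which opens the way
  to the fundamental theorem of calculus and the Leibniz rule.\<close>

lemma fourier_coeff_eq_integral:
  assumes "continuous_on {-pi..pi} f"
  shows "fourier_coeff f l =
      integral {-pi..pi} (\<lambda>x. f x * cis (- (of_int l * x))) / of_real (2 * pi)"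
  unfolding fourier_coeff_def
  by (subst set_borel_integral_eq_integral)
     (auto intro!: borel_integrable_atLeastAtMost' continuous_on_coeff_integrand assms)

lemma fourier_coeff_sum:
  assumes "\<And>i. i \<in> I \<Longrightarrow> continuous_on {-pi..pi} (f i)"
  shows "fourier_coeff (\<lambda>x. \<Sum>i\<in>I. f i x) l = (\<Sum>i\<in>I. fourier_coeff (f i) l)"
proof (cases "finite I")
  case True
  have "fourier_coeff (\<lambda>x. \<Sum>i\<in>I. f i x) l =
      integral {-pi..pi} (\<lambda>x. \<Sum>i\<in>I. f i x * cis (- (of_int l * x))) / of_real (2 * pi)"
    using assms by (subst fourier_coeff_eq_integral) (auto intro!: continuous_intros simp:
        sum_distrib_right)
  also have "\<dots> = (\<Sum>i\<in>I. integral {-pi..pi} (\<lambda>x. f i x * cis (- (of_int l * x)))) / of_real (2 * pi)"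
    using assms True
    by (subst integral_sum) (auto intro!: integrable_continuous_real continuous_on_coeff_integrand)
  also have "\<dots> = (\<Sum>i\<in>I. fourier_coeff (f i) l)"
    unfolding sum_divide_distrib using assms
        by (intro sum.cong refl) (simp add: fourier_coeff_eq_integral)
  finally show ?thesis .
qed (simp add: fourier_coeff_def)

lemma fourier_coeff_add:
  assumes "continuous_on {-pi..pi} f" "continuous_on {-pi..pi} g"
  shows "fourier_coeff (\<lambda>x. f x + g x) l = fourier_coeff f l + fourier_coeff g l"
  using fourier_coeff_sum[of UNIV "\<lambda>b. if b then f else g" l] assms
      by (auto simp: UNIV_bool add.commute)

lemma fourier_coeff_cmult: "fourier_coeff (\<lambda>x. a * f x) l = a * fourier_coeff f l"
  by (simp add: fourier_coeff_def mult.assoc)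

lemma fourier_coeff_diff:
  assumes "continuous_on {-pi..pi} f" "continuous_on {-pi..pi} g"
  shows "fourier_coeff (\<lambda>x. f x - g x) l = fourier_coeff f l - fourier_coeff g l"
  using fourier_coeff_add[of f "\<lambda>x. - 1 * g x" l] assms
  by (simp add: fourier_coeff_cmult[of "-1", simplified] continuous_on_minus)

lemma integral_cis:
  "integral {-pi..pi} (\<lambda>x. cis (of_int n * x)) = (if n = 0 then of_real (2 * pi) else 0)"
proof (cases "n = 0")
  case False
  have "((\<lambda>x. cis (of_int n * x)) has_integral
     cis (of_int n * pi) / (\<i> * of_int n) - cis (of_int n * (- pi)) / (\<i> * of_int n)) {-pi..pi}"
  proof (rule fundamental_theorem_of_calculus)
    fix x :: real
    have "((\<lambda>x. cis (of_int n * x)) has_derivative (\<lambda>t. (of_int n * t) *\<^sub>R (\<i> * cis (of_int n *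
        x)))) (at x within {-pi..pi})"
      by (rule derivative_intros)+ 
    then have "((\<lambda>x. cis (of_int n * x)) has_vector_derivative
        of_int n * \<i> * cis (of_int n * x)) (at x within {-pi..pi})"
      by (simp add: has_vector_derivative_def scaleR_conv_of_real mult_ac)
    from has_vector_derivative_divide[OF this, of "\<i> * of_int n"]
    show "((\<lambda>x. cis (of_int n * x) / (\<i> * of_int n)) has_vector_derivative
        cis (of_int n * x)) (at x within {-pi..pi})"
      using False by simp
  qed simp
  moreover have "cis (of_int n * pi) = cis (of_int n * (- pi))"
  proof -
    have "cis (of_int n * pi) = cis (of_int n * (- pi)) * cis (2 * pi * of_int n)"
      by (simp add: cis_mult algebra_simps)
    then show ?thesis by simp
  qed
  ultimately show ?thesis using False by (auto dest: integral_unique)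
qed (simp add: scaleR_conv_of_real)

lemma fourier_coeff_cis: "fourier_coeff (\<lambda>x. cis (of_int m * x)) l = (if m = l then 1 else 0)"
proof -
  have "fourier_coeff (\<lambda>x. cis (of_int m * x)) l =
      integral {-pi..pi} (\<lambda>x. cis (of_int (m - l) * x)) / of_real (2 * pi)"
    by (subst fourier_coeff_eq_integral) (auto intro!: continuous_intros simp: cis_mult
        algebra_simps)
  then show ?thesis unfolding integral_cis by simp
qed

lemma fourier_coeff_trigpoly:
  assumes "finite A"
  shows "fourier_coeff (trigpoly A c) m = (if m \<in> A then c m else 0)"
proof -
  have "fourier_coeff (trigpoly A c) m = (\<Sum>l\<in>A. c l * fourier_coeff (\<lambda>x. cis (of_int l * x)) m)"
    unfolding trigpoly_def[abs_def]
    by (subst fourier_coeff_sum) (auto intro!: continuous_intros simp: fourier_coeff_cmult)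
  then show ?thesis using assms by (simp add: fourier_coeff_cis if_distrib cong: if_cong)
qed

lemma trigpoly_cong: "(\<And>l. l \<in> A \<Longrightarrow> a l = b l) \<Longrightarrow> trigpoly A a = trigpoly A b"
  by (auto simp: trigpoly_def fun_eq_iff intro!: sum.cong)

lemma trigpoly_eq_iff:
  assumes "finite A"
  shows "trigpoly A a = trigpoly A b \<longleftrightarrow> (\<forall>l\<in>A. a l = b l)"
  using fourier_coeff_trigpoly[OF assms] trigpoly_cong by metis

lemma trig_space_eq: "f \<in> trig_space N \<Longrightarrow> f = trigpoly (freqs N) (fourier_coeff f)"
  unfolding trig_space_iff by (auto simp: fourier_coeff_trigpoly intro: trigpoly_cong)

lemma fourier_coeff_trig_space: "f \<in> trig_space N \<Longrightarrow> l \<notin> freqs N \<Longrightarrow> fourier_coeff f l = 0"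
  by (auto simp: trig_space_iff fourier_coeff_trigpoly)

lemma trig_space_continuous: "f \<in> trig_space N \<Longrightarrow> continuous_on S f"
  by (auto simp: trig_space_iff intro!: continuous_on_trigpoly)

lemma trigpoly_add: "trigpoly A a x + trigpoly A b x = trigpoly A (\<lambda>l. a l + b l) x"
  by (simp add: trigpoly_def sum.distrib distrib_right)

lemma trigpoly_diff: "trigpoly A a x - trigpoly A b x = trigpoly A (\<lambda>l. a l - b l) x"
  by (simp add: trigpoly_def sum_subtractf left_diff_distrib)

lemma trigpoly_cmult: "k * trigpoly A a x = trigpoly A (\<lambda>l. k * a l) x"
  by (simp add: trigpoly_def sum_distrib_left mult_ac)

lemma trigpoly_divide: "trigpoly A a x / k = trigpoly A (\<lambda>l. a l / k) x"
  by (simp add: trigpoly_def sum_divide_distrib)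

text \<open>Expanding f * cnj f * f produces the exponents i - j + k, and orthogonality selects
  those equal to l. The identity is exact for every l, also outside \<open>A\<close>.\<close>

lemma fourier_coeff_cubic_trigpoly:
  assumes "finite A"
  shows "fourier_coeff (cubic (trigpoly A c)) l = tri A c c c l"
proof -
  have "cubic (trigpoly A c) =
      (\<lambda>x. \<Sum>i\<in>A. \<Sum>j\<in>A. \<Sum>k\<in>A. (c i * cnj (c j) * c k) * cis (of_int (i - j + k) * x))"
  proof
    fix x
    have "cubic (trigpoly A c) x = trigpoly A c x * (cnj (trigpoly A c x) * trigpoly A c x)"
      by (simp add: cubic_def complex_norm_square del: of_real_power)
    also have "\<dots> = (\<Sum>i\<in>A. c i * cis (of_int i * x)) *
        ((\<Sum>j\<in>A. cnj (c j) * cis (- (of_int j * x))) * (\<Sum>k\<in>A. c k * cis (of_int k * x)))"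
      by (simp add: trigpoly_def cis_cnj)
    also have "\<dots> = (\<Sum>i\<in>A. \<Sum>j\<in>A. \<Sum>k\<in>A. (c i * cis (of_int i * x)) *
       ((cnj (c j) * cis (- (of_int j * x))) * (c k * cis (of_int k * x))))"
    proof -
      have "sum f A * (sum g A * sum h A) = (\<Sum>i\<in>A. \<Sum>j\<in>A. \<Sum>k\<in>A. f i * (g j * h k))"
        for f g h :: "int \<Rightarrow> complex"
      proof -
        have "sum f A * (sum g A * sum h A) = (\<Sum>i\<in>A. f i * (sum g A * sum h A))"
            by (rule sum_distrib_right)
        also have "\<dots> = (\<Sum>i\<in>A. f i * (\<Sum>j\<in>A. \<Sum>k\<in>A. g j * h k))" unfolding sum_product ..
        finally show ?thesis unfolding sum_distrib_left .
      qed
      then show ?thesis .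
    qed
    also have "\<dots> = (\<Sum>i\<in>A. \<Sum>j\<in>A. \<Sum>k\<in>A. (c i * cnj (c j) * c k) * cis (of_int (i - j + k) * x))"
    proof (intro sum.cong refl)
      fix i j k
      have "cis (of_int (i - j + k) * x) =
          cis (of_int i * x) * cis (- (of_int j * x)) * cis (of_int k * x)"
        by (simp add: cis_mult algebra_simps)
      then show "(c i * cis (of_int i * x)) * ((cnj (c j) * cis (- (of_int j * x))) * (c k * cis
          (of_int k * x)))
        = (c i * cnj (c j) * c k) * cis (of_int (i - j + k) * x)" by (simp only: mult_ac)
    qed
    finally show "cubic (trigpoly A c) x = \<dots>" .
  qed
  then have "fourier_coeff (cubic (trigpoly A c)) l = (\<Sum>i\<in>A. \<Sum>j\<in>A. \<Sum>k\<in>A.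
     (c i * cnj (c j) * c k) * fourier_coeff (\<lambda>x. cis (of_int (i - j + k) * x)) l)"
    by (simp only:, subst fourier_coeff_sum fourier_coeff_cmult, fastforce intro!:
        continuous_intros)
       (rule sum.cong[OF refl], subst fourier_coeff_sum, fastforce intro!: continuous_intros,
        rule sum.cong[OF refl], subst fourier_coeff_sum, fastforce intro!: continuous_intros,
        simp only: fourier_coeff_cmult)
  also have "\<dots> = tri A c c c l"
    unfolding tri_def conv3_def fourier_coeff_cis by (intro sum.cong refl) auto
  finally show ?thesis .
qed

lemma frac_laplacian_trigpoly:
  assumes "finite A"
  shows "frac_laplacian s (trigpoly A c) = trigpoly A (\<lambda>l. of_real (\<bar>of_int l\<bar> powr (2 * s)) * c l)"
proof
  fix x
  have "frac_laplacian s (trigpoly A c) x =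
      (\<Sum>\<^sub>\<infinity>l\<in>A. of_real (\<bar>of_int l\<bar> powr (2 * s)) * c l * cis (of_int l * x))"
    unfolding frac_laplacian_def using assms
    by (intro infsum_cong_neutral) (auto simp: fourier_coeff_trigpoly)
  then show "frac_laplacian s (trigpoly A c) x =
      trigpoly A (\<lambda>l. of_real (\<bar>of_int l\<bar> powr (2 * s)) * c l) x"
    using assms by (simp add: trigpoly_def)
qed

lemma semidiscrete_rhs_trigpoly:
  "semidiscrete_rhs s N (trigpoly (freqs N) c) = trigpoly (freqs N)
    (\<lambda>l. - \<i> * of_real (\<bar>of_int l\<bar> powr (2 * s)) * c l + \<i> * tri (freqs N) c c c l)"
proof
  fix x
  have "semidiscrete_rhs s N (trigpoly (freqs N) c) x =
     - \<i> * trigpoly (freqs N) (\<lambda>l. of_real (\<bar>of_int l\<bar> powr (2 * s)) * c l) x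
     + \<i> * trigpoly (freqs N) (tri (freqs N) c c c) x"
    by (simp add: semidiscrete_rhs_def frac_laplacian_trigpoly fourier_proj_eq
        fourier_coeff_cubic_trigpoly[OF finite_freqs, abs_def])
  then show "semidiscrete_rhs s N (trigpoly (freqs N) c) x = trigpoly (freqs N)
    (\<lambda>l. - \<i> * of_real (\<bar>of_int l\<bar> powr (2 * s)) * c l + \<i> * tri (freqs N) c c c l) x"
    by (simp only: trigpoly_cmult trigpoly_add mult.assoc)
qed

lemma midpoint_step_trigpoly_iff:
  "(\<forall>x. trigpoly (freqs N) z x = trigpoly (freqs N) y x + of_real h *
      semidiscrete_rhs s N (\<lambda>y'. (trigpoly (freqs N) z y' + trigpoly (freqs N) y y') / 2) x)
    \<longleftrightarrow> midpoint_step s (freqs N) h y z"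
  unfolding trigpoly_add trigpoly_divide semidiscrete_rhs_trigpoly trigpoly_cmult
      fun_eq_iff[symmetric]
    trigpoly_eq_iff[OF finite_freqs] midpoint_step_def by simp

lemma sobolev_norm_trig_space:
  assumes "f \<in> trig_space N"
  shows "sobolev_norm s f = hs s (freqs N) (fourier_coeff f)"
proof -
  have "(\<Sum>\<^sub>\<infinity>l. (1 + (of_int l)\<^sup>2) powr s * (cmod (fourier_coeff f l))\<^sup>2) =
     (\<Sum>\<^sub>\<infinity>l\<in>freqs N. (1 + (of_int l)\<^sup>2) powr s * (cmod (fourier_coeff f l))\<^sup>2)"
    using fourier_coeff_trig_space[OF assms] by (intro infsum_cong_neutral) auto
  then show ?thesis unfolding sobolev_norm_def by (simp add: hs_power2[symmetric])
qed

text \<open>Parseval's identity, read off from the zeroth coefficient of |f|^2. The factor 2 pi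
  appears because \<open>L2_norm\<close> is not normalised while the coefficients are.\<close>

lemma L2_norm_trig_space:
  assumes "f \<in> trig_space N"
  shows "(L2_norm f)\<^sup>2 = 2 * pi * (hs 0 (freqs N) (fourier_coeff f))\<^sup>2"
proof -
  let ?A = "freqs N" and ?c = "fourier_coeff f"
  have eq: "of_real ((cmod (f x))\<^sup>2) =
      (\<Sum>i\<in>?A. \<Sum>j\<in>?A. (?c i * cnj (?c j)) * cis (of_int (i - j) * x))" for x
  proof -
    have "of_real ((cmod (f x))\<^sup>2) = f x * cnj (f x)" by (rule complex_norm_square)
    also have "\<dots> = trigpoly ?A ?c x * cnj (trigpoly ?A ?c x)"
      using fun_cong[OF trig_space_eq[OF assms], of x] by simp
    also have "\<dots> = (\<Sum>i\<in>?A. \<Sum>j\<in>?A. (?c i * cis (of_int i * x)) * (cnj (?c j) * cis (- (of_int j *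
        x))))"
      by (simp add: trigpoly_def cis_cnj sum_product)
    also have "\<dots> = (\<Sum>i\<in>?A. \<Sum>j\<in>?A. (?c i * cnj (?c j)) * cis (of_int (i - j) * x))"
    proof (intro sum.cong refl)
      fix i j
      have "cis (of_int (i - j) * x) = cis (of_int i * x) * cis (- (of_int j * x))"
        by (simp add: cis_mult algebra_simps)
      then show "(?c i * cis (of_int i * x)) * (cnj (?c j) * cis (- (of_int j * x))) =
          (?c i * cnj (?c j)) * cis (of_int (i - j) * x)"
        by (simp only: mult_ac)
    qed
    finally show ?thesis .
  qed
  have "of_real (LINT x:{-pi..pi}|lborel. (cmod (f x))\<^sup>2) =
      of_real (2 * pi) * fourier_coeff (\<lambda>x. of_real ((cmod (f x))\<^sup>2)) 0"
    by (simp add: fourier_coeff_def set_integral_complex_of_real del: of_real_power)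
  also have "fourier_coeff (\<lambda>x. of_real ((cmod (f x))\<^sup>2)) 0 =
      (\<Sum>i\<in>?A. \<Sum>j\<in>?A. (?c i * cnj (?c j)) * fourier_coeff (\<lambda>x. cis (of_int (i - j) * x)) 0)"
    unfolding eq
    by (subst fourier_coeff_sum, fastforce intro!: continuous_intros,
        rule sum.cong[OF refl], subst fourier_coeff_sum, fastforce intro!: continuous_intros,
        simp only: fourier_coeff_cmult)
  also have "\<dots> = (\<Sum>i\<in>?A. of_real ((cmod (?c i))\<^sup>2))"
    unfolding fourier_coeff_cis complex_norm_square
    by (intro sum.cong refl) (simp add: if_distrib cong: if_cong)
  also have "\<dots> = of_real ((hs 0 ?A ?c)\<^sup>2)"
  proof -
    have "(1 + (real_of_int i)\<^sup>2) powr 0 = 1" for i using weight_power2[of 0 i] by simp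
    then show ?thesis by (simp add: hs_power2)
  qed
  finally have "(LINT x:{-pi..pi}|lborel. (cmod (f x))\<^sup>2) = 2 * pi * (hs 0 ?A ?c)\<^sup>2"
    by (simp only: of_real_mult[symmetric] of_real_eq_iff)
  then show ?thesis by (simp add: L2_norm_def)
qed

text \<open>The pointwise time derivative of a curve of trigonometric polynomials passes to the
  coefficients because these are finite linear combinations of point values.\<close>

lemma trigpoly_discrete_inversion:
  assumes "l \<in> freqs N" and n: "n = 2 * N + 1"
  shows "c l = (\<Sum>j<n. trigpoly (freqs N) c (2 * pi * real j / real n) *
    cis (- (of_int l * (2 * pi * real j / real n)))) / of_nat n"
proof -
  let ?x = "\<lambda>j. 2 * pi * real j / real n"
  have n0: "n \<noteq> 0" using n by simp
  have orth: "(\<Sum>j<n. cis (of_int (m - l) * ?x j)) = (if m = l then of_nat n else 0)"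
      if "m \<in> freqs N" for m
  proof (cases "m = l")
    case False
    define d where "d = m - l"
    let ?w = "cis (of_int d * (2 * pi / real n))"
    \<comment> \<open>The frequencies differ by at most 2N < n, so \<open>d\<close> is not a
      multiple of n: 2N + 1 equispaced nodes separate all modes.\<close>
    have "?w \<noteq> 1"
    proof
      assume "?w = 1"
      then obtain q where "of_int d * (2 * pi / real n) = of_int q * (2 * pi)"
        unfolding cis_eq_1_iff by blast
      then have "real_of_int d = real_of_int (q * int n)" using n0 by (simp add: field_simps)
      then have eq: "d = q * int n" by (simp only: of_int_eq_iff)
      have "\<bar>d\<bar> < int n" using assms(1) that unfolding n d_def by (auto simp: freqs_def)
      moreover have "1 * int n \<le> \<bar>q\<bar> * int n" if "q \<noteq> 0" using that by (intro mult_right_mono) auto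
      ultimately have "q = 0" by (auto simp: eq abs_mult)
      then show False using eq False by (simp add: d_def)
    qed
    have "(\<Sum>j<n. cis (of_int d * ?x j)) = (\<Sum>j<n. ?w ^ j)"
    proof (intro sum.cong refl)
      fix j
      have "of_int d * ?x j = real j * (of_int d * (2 * pi / real n))" by simp
      then show "cis (of_int d * ?x j) = ?w ^ j" by (simp only: Complex.DeMoivre)
    qed
    also have "\<dots> = (?w ^ n - 1) / (?w - 1)" by (rule geometric_sum[OF \<open>?w \<noteq> 1\<close>])
    also have "?w ^ n = cis (2 * pi * of_int d)"
      unfolding Complex.DeMoivre by (rule arg_cong[of _ _ cis]) (use n0 in \<open>simp add: field_simps\<close>)
    also have "\<dots> = 1" by (rule cis_multiple_2pi) simp
    finally show ?thesis using False by (simp add: d_def)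
  qed simp
  have "(\<Sum>j<n. trigpoly (freqs N) c (?x j) * cis (- (of_int l * ?x j)))
    = (\<Sum>j<n. \<Sum>m\<in>freqs N. c m * cis (of_int (m - l) * ?x j))"
    unfolding trigpoly_def sum_distrib_right
    by (intro sum.cong refl) (simp only: mult.assoc cis_mult, simp add: left_diff_distrib
        diff_divide_distrib)
  also have "\<dots> = (\<Sum>m\<in>freqs N. c m * (\<Sum>j<n. cis (of_int (m - l) * ?x j)))"
    unfolding sum_distrib_left by (rule sum.swap)
  also have "\<dots> = (\<Sum>m\<in>freqs N. c m * (if m = l then of_nat n else 0))"
    using orth by (intro sum.cong refl) (simp only:)
  also have "\<dots> = c l * of_nat n" using assms(1) by (simp add: if_distrib cong: if_cong)
  finally show ?thesis using n0 by simp
qed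

lemma fourier_coeff_has_vector_derivative:
  assumes f: "\<And>t. t \<in> S \<Longrightarrow> f t \<in> trig_space N" and g: "g \<in> trig_space N" and "t \<in> S" "l \<in> freqs N"
    and d: "\<And>x. ((\<lambda>t. f t x) has_vector_derivative g x) (at t within S)"
  shows "((\<lambda>t. fourier_coeff (f t) l) has_vector_derivative fourier_coeff g l) (at t within S)"
proof -
  define n where "n = 2 * N + 1"
  let ?x = "\<lambda>j. 2 * pi * real j / real n"
  have inv: "fourier_coeff h l = (\<Sum>j<n. h (?x j) * cis (- (of_int l * ?x j))) / of_nat n"
      if "h \<in> trig_space N" for h
    using trigpoly_discrete_inversion[OF assms(4) n_def, of "fourier_coeff h"]
    unfolding trig_space_eq[OF that, symmetric] .
  show ?thesis unfolding inv[OF g]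
    by (rule has_vector_derivative_transform[OF \<open>t \<in> S\<close> inv[OF f]], assumption)
       (intro has_vector_derivative_divide has_vector_derivative_sum has_vector_derivative_mult_left
           d)
qed

section \<open>Fourier coefficients of the exact solution\<close>

lemma cmod_fourier_coeff_le:
  assumes "continuous_on {-pi..pi} f" "\<And>x. x \<in> {-pi..pi} \<Longrightarrow> cmod (f x) \<le> b"
  shows "cmod (fourier_coeff f l) \<le> b"
proof -
  have "cmod (integral {-pi..pi} (\<lambda>x. f x * cis (- (of_int l * x)))) \<le> b * (pi - (- pi))"
    using assms by (intro integral_bound continuous_on_coeff_integrand) (auto simp: norm_mult)
  then show ?thesis
    unfolding fourier_coeff_eq_integral[OF assms(1)] by (simp add: norm_divide field_simps)
qed

lemma tendsto_fourier_coeff: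
  assumes lim: "uniform_limit {-pi..pi} f g F" and f: "\<And>n. continuous_on {-pi..pi} (f n)" and "F \<noteq>
      bot"
  shows "((\<lambda>n. fourier_coeff (f n) l) \<longlongrightarrow> fourier_coeff g l) F"
proof (rule tendstoI)
  fix e :: real assume "0 < e"
  have g: "continuous_on {-pi..pi} g"
    using f lim \<open>F \<noteq> bot\<close> by (intro uniform_limit_theorem[OF always_eventually lim]) (auto intro:
        always_eventually)
  from lim \<open>0 < e\<close> have "\<forall>\<^sub>F n in F. \<forall>x\<in>{-pi..pi}. dist (f n x) (g x) < e / 2"
    by (intro uniform_limitD) auto
  then show "\<forall>\<^sub>F n in F. dist (fourier_coeff (f n) l) (fourier_coeff g l) < e"
  proof eventually_elim
    case (elim n)
    have "cmod (fourier_coeff (\<lambda>x. f n x - g x) l) \<le> e / 2"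
      using f g elim by (intro cmod_fourier_coeff_le continuous_intros) (auto simp: dist_norm
          less_imp_le)
    then show ?case using \<open>0 < e\<close> fourier_coeff_diff[OF f g] by (simp add: dist_norm)
  qed
qed

text \<open>\<open>Arg\<close> jumps at -1, so continuity cannot be inherited from it. Instead, the
  preimage of a closed set is the \<open>cis\<close> image of a compact set; the end point condition
  reconciles the two parameters of -1.\<close>

lemma continuous_on_circle_lift:
  fixes f :: "real \<Rightarrow> complex"
  assumes f: "continuous_on {-pi..pi} f" and per: "f (- pi) = f pi"
  obtains g where "continuous_on (sphere 0 1) g" "\<And>x. x \<in> {-pi..pi} \<Longrightarrow> g (cis x) = f x"
proof
  define g where "g z = f (Arg z)" for z
  show g_cis: "g (cis x) = f x" if "x \<in> {-pi..pi}" for x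
  proof (cases "x = - pi")
    case True
    have "Arg (cis x) = pi" using True by (intro cis_Arg_unique) (auto simp: complex_eq_iff)
    then show ?thesis using True per by (simp add: g_def)
  next
    case False
    then have "Arg (cis x) = x" using that by (intro cis_Arg_unique) auto
    then show ?thesis by (simp add: g_def)
  qed
  show "continuous_on (sphere 0 1) g"
    unfolding continuous_on_closed_vimage[OF closed_sphere]
  proof (intro allI impI)
    fix B :: "complex set" assume "closed B"
    have eq: "g -` B \<inter> sphere 0 1 = cis ` ({-pi..pi} \<inter> f -` B)"
    proof (intro equalityI subsetI)
      fix z assume "z \<in> g -` B \<inter> sphere 0 1"
      then have z: "cmod z = 1" "f (Arg z) \<in> B" by (auto simp: g_def)
      then have "z \<noteq> 0" by auto
      then have "z = cis (Arg z)" using z(1) by (simp add: cis_Arg sgn_eq)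
      moreover have "Arg z \<in> {-pi..pi} \<inter> f -` B" using Arg_bounded[of z] z(2) by auto
      ultimately show "z \<in> cis ` ({-pi..pi} \<inter> f -` B)" by (rule image_eqI)
    qed (auto simp: g_cis)
    have "closed ({-pi..pi} \<inter> f -` B)"
      using f \<open>closed B\<close> by (intro continuous_closed_preimage) auto
    then have "compact ({-pi..pi} \<inter> f -` B)"
      by (auto simp: compact_eq_bounded_closed intro: bounded_subset[OF bounded_closed_interval[of
          "-pi" pi]])
    then show "closed (g -` B \<inter> sphere 0 1)"
      unfolding eq by (intro compact_imp_closed compact_continuous_image continuous_intros)
  qed
qed

lemma continuous_on_real_polynomial_cis:
  assumes "real_polynomial_function q"
  shows "continuous_on S (\<lambda>x. q (cis x))"
proof -
  have "continuous_on UNIV q"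
    using assms by (intro continuous_at_imp_continuous_on ballI continuous_real_polymonial_function)
  from continuous_on_compose2[OF this continuous_on_cis[OF continuous_on_id]] show ?thesis by simp
qed

text \<open>The multipliers of the class of functions with vanishing Fourier coefficients form an
  algebra; as it contains \<open>cis\<close> and its inverse, it contains all polynomials on the circle.\<close>

lemma fourier_coeff_mult_polynomial_eq_0:
  fixes q :: "complex \<Rightarrow> real"
  assumes "real_polynomial_function q" "continuous_on {-pi..pi} f" "\<And>l. fourier_coeff f l = 0"
  shows "fourier_coeff (\<lambda>x. f x * of_real (q (cis x))) l = 0"
  using assms
proof (induction arbitrary: f l rule: real_polynomial_function.induct)
  case (linear h)
  \<comment> \<open>A real-linear functional at cis x is a combination of cos x and sin x, hence of
    cis x and cis (-x), and these only shift the index of a coefficient.\<close>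
  define \<alpha> \<beta> where "\<alpha> = (of_real (h 1) - \<i> * of_real (h \<i>)) / 2" and "\<beta> =
      (of_real (h 1) + \<i> * of_real (h \<i>)) / 2"
  have eq: "f x * of_real (h (cis x)) = \<alpha> * (f x * cis x) + \<beta> * (f x * cis (- x))" for x
  proof -
    interpret bounded_linear h by fact
    have "cis x = cos x *\<^sub>R 1 + sin x *\<^sub>R \<i>" by (simp add: complex_eq_iff)
    then have "h (cis x) = cos x * h 1 + sin x * h \<i>" by (metis add scaleR real_scaleR_def)
    then have "of_real (h (cis x)) = \<alpha> * cis x + \<beta> * cis (- x)"
      by (simp add: \<alpha>_def \<beta>_def complex_eq_iff field_simps)
    then show ?thesis by (simp add: algebra_simps)
  qed
  have shift1: "fourier_coeff (\<lambda>x. f x * cis x) l = 0"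
  proof -
    have "fourier_coeff (\<lambda>x. f x * cis x) l = fourier_coeff f (l - 1)"
      by (simp add: fourier_coeff_def mult.assoc cis_mult left_diff_distrib)
    then show ?thesis using linear by simp
  qed
  have shift2: "fourier_coeff (\<lambda>x. f x * cis (- x)) l = 0"
  proof -
    have "fourier_coeff (\<lambda>x. f x * cis (- x)) l = fourier_coeff f (l + 1)"
    proof -
      have "f x * cis (- x) * cis (- (of_int l * x)) = f x * cis (- (of_int (l + 1) * x))" for x
        by (simp add: mult.assoc cis_mult algebra_simps)
      then show ?thesis by (simp only: fourier_coeff_def)
    qed
    then show ?thesis using linear by simp
  qed
  show ?case unfolding eq using linear
    by (subst fourier_coeff_add) (auto intro!: continuous_intros simp: fourier_coeff_cmult shift1
        shift2)
next
  case (const c)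
  then show ?case using fourier_coeff_cmult[of "of_real c" f l] by (simp add: mult.commute)
next
  case (add p q)
  have "continuous_on {-pi..pi} (\<lambda>x. p (cis x))" "continuous_on {-pi..pi} (\<lambda>x. q (cis x))"
    using add.hyps by (auto intro: continuous_on_real_polynomial_cis)
  then show ?case using add
    by (simp add: distrib_left, subst fourier_coeff_add) (auto intro!: continuous_intros)
next
  case (mult p q)
  have "continuous_on {-pi..pi} (\<lambda>x. p (cis x))"
    using mult.hyps by (auto intro: continuous_on_real_polynomial_cis)
  then have "fourier_coeff (\<lambda>x. (f x * of_real (p (cis x))) * of_real (q (cis x))) l = 0"
    using mult by (intro mult.IH continuous_intros) auto
  then show ?case by (simp add: mult.assoc)
qed

text \<open>\<open>cnj f\<close> is approximated uniformly by polynomials on the circle. The product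
  of \<open>f\<close> with such a polynomial has integral zero, so the integral of |f|^2 is
  arbitrarily small.\<close>

lemma fourier_coeff_eq_0_imp:
  assumes f: "continuous_on {-pi..pi} f" and per: "f (- pi) =
      f pi" and zero: "\<And>l. fourier_coeff f l = 0"
    and x: "x \<in> {-pi..pi}"
  shows "f x = 0"
proof -
  obtain g where g: "continuous_on (sphere 0 1) g" "\<And>x. x \<in> {-pi..pi} \<Longrightarrow> g (cis x) = f x"
    using continuous_on_circle_lift[OF f per] by blast
  have "compact (f ` {-pi..pi})" using f by (intro compact_continuous_image) auto
  then obtain b where b: "0 < b" "\<And>x. x \<in> {-pi..pi} \<Longrightarrow> cmod (f x) \<le> b"
    using compact_imp_bounded[of "f ` {-pi..pi}"] unfolding bounded_pos by auto
  have cff: "continuous_on {-pi..pi} (\<lambda>x. f x * cnj (f x))" using f by (intro continuous_intros)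
  have small: "cmod (fourier_coeff (\<lambda>x. f x * cnj (f x)) 0) \<le> e" if "0 < e" for e
  proof -
    have "\<exists>p. polynomial_function p \<and> (\<forall>z\<in>sphere 0 1. cmod (cnj (g z) - p z) < e / b)"
      using g \<open>0 < e\<close> b by (intro Stone_Weierstrass_polynomial_function continuous_intros) auto
    then obtain p where p: "polynomial_function p" "\<And>z. z \<in> sphere 0 1 \<Longrightarrow> cmod (cnj (g z) - p z) < e
        / b"
      by blast
    \<comment> \<open>The multiplier lemma concerns real polynomials, so \<open>p\<close> is split
      into its real and imaginary parts.\<close>
    have Re: "real_polynomial_function (\<lambda>z. Re (p z))" and Im: "real_polynomial_function (\<lambda>z. Im (p
        z))"
      using p(1) bounded_linear_Re bounded_linear_Im unfolding polynomial_function_def o_def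
          by blast+
    have cp: "continuous_on {-pi..pi} (\<lambda>x. p (cis x))"
      using continuous_on_compose2[OF continuous_on_polymonial_function[OF p(1), of UNIV]
          continuous_on_cis[OF continuous_on_id]]
      by simp
    have "fourier_coeff (\<lambda>x. f x * p (cis x)) 0 =
      fourier_coeff (\<lambda>x. f x * of_real (Re (p (cis x))) + \<i> * (f x * of_real (Im (p (cis x))))) 0"
      by (rule arg_cong[of _ _ "\<lambda>f. fourier_coeff f 0"]) (auto simp: fun_eq_iff complex_eq_iff
          algebra_simps)
    also have "\<dots> = fourier_coeff (\<lambda>x. f x * of_real (Re (p (cis x)))) 0 + \<i> * fourier_coeff (\<lambda>x. f x
        * of_real (Im (p (cis x)))) 0"
      unfolding fourier_coeff_cmult[symmetric]
      by (intro fourier_coeff_add continuous_intros f cp)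
    also have "\<dots> = 0"
      using fourier_coeff_mult_polynomial_eq_0[OF Re f zero] fourier_coeff_mult_polynomial_eq_0[OF
          Im f zero] by simp
    finally have "fourier_coeff (\<lambda>x. f x * cnj (f x)) 0 =
        fourier_coeff (\<lambda>x. f x * cnj (f x) - f x * p (cis x)) 0"
      by (subst fourier_coeff_diff) (auto intro!: continuous_intros f cp)
    also have "cmod \<dots> \<le> e"
    proof (rule cmod_fourier_coeff_le)
      fix x assume x: "x \<in> {-pi..pi}"
      have "cmod (f x * cnj (f x) - f x * p (cis x)) =
          cmod (f x) * cmod (cnj (g (cis x)) - p (cis x))"
        using g(2)[OF x] by (simp add: norm_mult flip: right_diff_distrib)
      also have "\<dots> \<le> b * (e / b)"
        using b(1) b(2)[OF x] p(2)[of "cis x"] by (intro mult_mono) auto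
      finally show "cmod (f x * cnj (f x) - f x * p (cis x)) \<le> e" using b(1) by simp
    qed (intro continuous_intros f cp)
    finally show ?thesis .
  qed
  have "fourier_coeff (\<lambda>x. f x * cnj (f x)) 0 = 0"
  proof (rule ccontr)
    assume "fourier_coeff (\<lambda>x. f x * cnj (f x)) 0 \<noteq> 0"
    then show False using small[of "cmod (fourier_coeff (\<lambda>x. f x * cnj (f x)) 0) / 2"] by simp
  qed
  then have int0: "integral {-pi..pi} (\<lambda>x. f x * cnj (f x)) = 0"
    unfolding fourier_coeff_eq_integral[OF cff] by simp
  have "integral {-pi..pi} (\<lambda>x. (cmod (f x))\<^sup>2) = Re (integral {-pi..pi} (\<lambda>x. f x * cnj (f x)))"
  proof -
    have "((\<lambda>x. f x * cnj (f x)) has_integral integral {-pi..pi} (\<lambda>x. f x * cnj (f x))) {-pi..pi}"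
      using cff by (intro integrable_integral integrable_continuous_real)
    then have "((\<lambda>x. Re (f x * cnj (f x))) has_integral Re (integral {-pi..pi} (\<lambda>x. f x * cnj (f
        x)))) {-pi..pi}"
      by (rule has_integral_linear[OF _ bounded_linear_Re, unfolded o_def])
    moreover have "(cmod (f x))\<^sup>2 = Re (f x * cnj (f x))" for x
      unfolding cmod_power2 by (simp add: power2_eq_square)
    ultimately show ?thesis by (simp only: integral_unique)
  qed
  then have "integral {-pi..pi} (\<lambda>x. (cmod (f x))\<^sup>2) = 0" using int0 by simp
  then have "(cmod (f x))\<^sup>2 = 0"
    using f x by (subst (asm) integral_eq_0_iff) (auto intro!: continuous_intros)
  then show ?thesis by simp
qed

text \<open>Converts unordered sums into limits of symmetric partial sums.\<close>

lemma filterlim_freqs: "filterlim freqs (finite_subsets_at_top UNIV) sequentially"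
  unfolding filterlim_finite_subsets_at_top
proof (intro allI impI)
  fix X :: "int set" assume X: "finite X \<and> X \<subseteq> UNIV"
  define m where "m = Max (insert 0 ((\<lambda>l. nat \<bar>l\<bar>) ` X))"
  have "nat \<bar>l\<bar> \<le> m" if "l \<in> X" for l unfolding m_def using that X by (intro Max_ge) auto
  then have "X \<subseteq> freqs m'" if "m \<le> m'" for m' using that by (fastforce simp: freqs_def)
  then show "\<forall>\<^sub>F m in sequentially. finite (freqs m) \<and> X \<subseteq> freqs m \<and> freqs m \<subseteq> UNIV"
    unfolding eventually_sequentially by auto
qed

text \<open>Weierstrass M-test. Coefficients and evaluation point may both depend on the parameter;
  taking it to be (t, x) yields joint continuity in time and space.\<close>

lemma fourier_series_uniform_limit:
  assumes "\<And>l y. y \<in> Y \<Longrightarrow> cmod (a y l) \<le> M l" "M summable_on UNIV"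
  shows "uniform_limit Y (\<lambda>m y. trigpoly (freqs m) (a y) (r y)) (\<lambda>y. \<Sum>\<^sub>\<infinity>l. a y l * cis (of_int l * r
      y)) sequentially"
proof -
  have "uniform_limit Y (\<lambda>X y. \<Sum>l\<in>X. a y l * cis (of_int l * r y)) (\<lambda>y. \<Sum>\<^sub>\<infinity>l. a y l * cis (of_int l
      * r y))
     (finite_subsets_at_top UNIV)"
    using assms by (intro Weierstrass_m_test_general[where M = M]) (auto simp: norm_mult)
  from filterlim_compose[OF this filterlim_freqs] show ?thesis by (simp add: trigpoly_def)
qed

lemma fourier_coeff_series:
  assumes "\<And>l. cmod (a l) \<le> M l" "M summable_on UNIV"
  shows "fourier_coeff (\<lambda>x. \<Sum>\<^sub>\<infinity>l. a l * cis (of_int l * x)) l = a l"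
    and "continuous_on S (\<lambda>x. \<Sum>\<^sub>\<infinity>l. a l * cis (of_int l * x))"
proof -
  have lim: "uniform_limit X (\<lambda>m. trigpoly (freqs m) a) (\<lambda>x. \<Sum>\<^sub>\<infinity>l. a l * cis (of_int l * x))
      sequentially" for X
    using fourier_series_uniform_limit[of X "\<lambda>_. a" M "\<lambda>x. x"] assms by simp
  have "(\<lambda>m. fourier_coeff (trigpoly (freqs m) a) l) \<longlonglongrightarrow>
      fourier_coeff (\<lambda>x. \<Sum>\<^sub>\<infinity>l. a l * cis (of_int l * x)) l"
    by (intro tendsto_fourier_coeff lim continuous_intros) simp
  moreover have "(\<lambda>m. fourier_coeff (trigpoly (freqs m) a) l) \<longlonglongrightarrow> a l"
  proof (rule tendsto_eventually)
    show "\<forall>\<^sub>F m in sequentially. fourier_coeff (trigpoly (freqs m) a) l = a l"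
      unfolding eventually_sequentially
      by (intro exI[of _ "nat \<bar>l\<bar>"]) (auto simp: fourier_coeff_trigpoly freqs_def)
  qed
  ultimately show "fourier_coeff (\<lambda>x. \<Sum>\<^sub>\<infinity>l. a l * cis (of_int l * x)) l = a l"
      by (rule LIMSEQ_unique)
  show "continuous_on S (\<lambda>x. \<Sum>\<^sub>\<infinity>l. a l * cis (of_int l * x))"
    by (rule uniform_limit_theorem[OF _ lim]) (auto intro!: always_eventually
        continuous_on_trigpoly)
qed

text \<open>The series converges uniformly to a continuous function with the same coefficients as
  \<open>f\<close>, and \<open>fourier_coeff_eq_0_imp\<close> identifies the two.\<close>

lemma fourier_partial_sums_uniform_limit:
  assumes f: "continuous_on {-pi..pi} f" and per: "f (- pi) = f pi"
    and M: "\<And>l. cmod (fourier_coeff f l) \<le> M l" "M summable_on UNIV"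
  shows "uniform_limit {-pi..pi} (\<lambda>m. trigpoly (freqs m) (fourier_coeff f)) f sequentially"
proof -
  define S where "S x = (\<Sum>\<^sub>\<infinity>l. fourier_coeff f l * cis (of_int l * x))" for x
  note series = fourier_coeff_series[of "fourier_coeff f", OF M, folded S_def[abs_def]]
  have eq: "f x = S x" if "x \<in> {-pi..pi}" for x
  proof -
    have "f x - S x = 0"
    proof (rule fourier_coeff_eq_0_imp[OF _ _ _ that])
      show "continuous_on {-pi..pi} (\<lambda>x. f x - S x)" by (intro continuous_intros f series)
      have "cis (of_int l * (- pi)) = cis (of_int l * pi)" for l
      proof -
        have "cis (of_int l * pi) = cis (of_int l * (- pi)) * cis (2 * pi * of_int l)"
          by (simp add: cis_mult algebra_simps)
        then show ?thesis by simp
      qed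
      then have "S (- pi) = S pi" unfolding S_def by (simp only:)
      then show "f (- pi) - S (- pi) = f pi - S pi" using per by simp
      show "fourier_coeff (\<lambda>x. f x - S x) l = 0" for l
        by (subst fourier_coeff_diff[OF f series(2)]) (simp add: series(1))
    qed
    then show ?thesis by simp
  qed
  have "uniform_limit {-pi..pi} (\<lambda>m. trigpoly (freqs m) (fourier_coeff f)) S sequentially"
    using fourier_series_uniform_limit[of "{-pi..pi}" "\<lambda>_. fourier_coeff f" M "\<lambda>x. x"] M
        by (simp add: S_def[abs_def])
  then show ?thesis by (subst uniform_limit_cong'[where h = f and i = S]) (auto simp: eq)
qed

lemma cubic_eq: "cubic f x = f x * cnj (f x) * f x"
  by (simp add: cubic_def complex_norm_square del: of_real_power)

text \<open>The cubic terms of the partial sums converge uniformly, and their coefficients are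
  finite convolutions. An infinite convolution is thereby avoided.\<close>

lemma tendsto_tri_fourier_coeff:
  assumes f: "continuous_on {-pi..pi} f" and per: "f (- pi) = f pi"
    and M: "\<And>l. cmod (fourier_coeff f l) \<le> M l" "M summable_on UNIV"
  shows "(\<lambda>m. tri (freqs m) (fourier_coeff f) (fourier_coeff f) (fourier_coeff f) l) \<longlonglongrightarrow>
      fourier_coeff (cubic f) l"
proof -
  have lim: "uniform_limit {-pi..pi} (\<lambda>m. trigpoly (freqs m) (fourier_coeff f)) f sequentially"
    by (rule fourier_partial_sums_uniform_limit[OF assms])
  have bdd: "bounded (h ` {-pi..pi})" if "continuous_on {-pi..pi} h" for h :: "real \<Rightarrow> complex"
    using that by (intro compact_imp_bounded compact_continuous_image) auto
  have "uniform_limit {-pi..pi} (\<lambda>m. cubic (trigpoly (freqs m) (fourier_coeff f))) (cubic f)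
      sequentially"
    unfolding cubic_eq[abs_def]
    by (intro uniform_lim_mult bounded_linear.uniform_limit[OF bounded_linear_cnj] lim bdd
        continuous_intros f)
  then have "(\<lambda>m. fourier_coeff (cubic (trigpoly (freqs m) (fourier_coeff f))) l) \<longlonglongrightarrow>
      fourier_coeff (cubic f) l"
    by (rule tendsto_fourier_coeff) (auto simp: cubic_eq[abs_def] intro!: continuous_intros)
  then show ?thesis by (simp add: fourier_coeff_cubic_trigpoly)
qed

lemma in_sobolev_hs_le:
  assumes "in_sobolev \<mu> f" "sobolev_norm \<mu> f \<le> B" "finite F"
  shows "hs \<mu> F (fourier_coeff f) \<le> B"
proof -
  have "(hs \<mu> F (fourier_coeff f))\<^sup>2 \<le>
      (\<Sum>\<^sub>\<infinity>l. (1 + (of_int l)\<^sup>2) powr \<mu> * (cmod (fourier_coeff f l))\<^sup>2)"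
    unfolding hs_power2 using assms by (intro finite_sum_le_infsum) (auto simp: in_sobolev_def)
  then have "hs \<mu> F (fourier_coeff f) \<le> sobolev_norm \<mu> f"
    unfolding sobolev_norm_def by (rule real_le_rsqrt)
  with assms(2) show ?thesis by linarith
qed

lemma summable_on_weight:
  fixes c r :: real
  assumes "1 / 2 < r"
  shows "(\<lambda>l::int. c * (1 + (of_int l)\<^sup>2) powr (- r)) summable_on UNIV"
proof (rule summable_on_cmult_right, rule nonneg_bdd_above_summable_on)
  show "bdd_above (sum (\<lambda>l::int. (1 + (real_of_int l)\<^sup>2) powr (- r)) ` {F. F \<subseteq> UNIV \<and> finite F})"
  proof (rule bdd_aboveI)
    fix x assume "x \<in> sum (\<lambda>l::int. (1 + (real_of_int l)\<^sup>2) powr (- r)) ` {F. F \<subseteq> UNIV \<and> finite F}"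
    then obtain F where "finite F" "x = (\<Sum>l\<in>F. (1 + (real_of_int l)\<^sup>2) powr (- r))" by auto
    then show "x \<le> 2 * (\<Sum>n. (1 + (real n)\<^sup>2) powr (- r))"
      using sum_int_even_le[of "\<lambda>l. (1 + (real_of_int l)\<^sup>2) powr (- r)" F] summable_weight[OF assms]
          by simp
  qed
qed auto

text \<open>The equation holds pointwise in x, so the time derivative has to be moved under the
  integral. The Leibniz rule asks for a jointly continuous time derivative, which
  \<open>fnls_solution\<close> does not postulate. It follows from the equation, because the
  fractional Laplacian is a uniformly convergent series.\<close>

lemma fnls_fourier_coeff:
  assumes s: "1 / 2 < s" "s \<le> 1" and \<mu>: "5 \<le> \<mu>"
    and sol: "fnls_solution s T u0 u"
    and B: "\<And>t. t \<in> {0..T} \<Longrightarrow> in_sobolev \<mu> (u t)" "\<And>t. t \<in> {0..T} \<Longrightarrow> sobolev_norm \<mu> (u t) \<le> B"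
    and t: "t \<in> {0..T}"
  shows "((\<lambda>t. fourier_coeff (u t) l) has_vector_derivative
      - \<i> * of_real (\<bar>of_int l\<bar> powr (2 * s)) * fourier_coeff (u t) l + \<i> * fourier_coeff (cubic (u
          t)) l) (at t within {0..T})"
    and "(\<lambda>m. tri (freqs m) (fourier_coeff (u t)) (fourier_coeff (u t)) (fourier_coeff (u t)) l) \<longlonglongrightarrow>
        fourier_coeff (cubic (u t)) l"
proof -
  \<comment> \<open>A common majorant for the coefficients of \<open>u t\<close> and of its
    fractional Laplacian. The symbol is at most 1 + l^2 and costs one power; \<mu> \<ge> 5 leaves an
    exponent of at least 3/2, enough for summability.\<close>
  define M where "M l = B * (1 + (of_int l)\<^sup>2) powr (- (\<mu> / 2 - 1))" for l :: int
  have M_sum: "M summable_on UNIV" unfolding M_def[abs_def] using \<mu>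
      by (intro summable_on_weight) simp
  have coeff_le: "cmod (fourier_coeff (u t) l) \<le> B * (1 + (of_int l)\<^sup>2) powr (- (\<mu> / 2))"
      if "t \<in> {0..T}" for t l
  proof -
    have "weight \<mu> l * cmod (fourier_coeff (u t) l) \<le> B"
      using in_sobolev_hs_le[OF B[OF that], of "{l}"] by (simp add: hs_def)
    then have "cmod (fourier_coeff (u t) l) * weight \<mu> l \<le> B" by (simp only: mult.commute)
    then have "cmod (fourier_coeff (u t) l) \<le> B / weight \<mu> l"
      by (rule pos_le_divide_eq[THEN iffD2, OF weight_pos])
    also have "B / weight \<mu> l = B * (1 + (of_int l)\<^sup>2) powr (- (\<mu> / 2))"
      unfolding weight_def powr_minus divide_inverse ..
    finally show ?thesis .
  qed
  have B0: "0 \<le> B" using in_sobolev_hs_le[OF B[OF t], of "{}"] by (simp add: hs_def)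
  have base: "1 \<le> 1 + (real_of_int l)\<^sup>2" for l by simp
  have lap_le: "cmod (of_real (\<bar>of_int l\<bar> powr (2 * s)) * fourier_coeff (u t) l) \<le> M l"
      if "t \<in> {0..T}" for t l
  proof -
    have "\<bar>real_of_int l\<bar> powr (2 * s) \<le> 1 + (real_of_int l)\<^sup>2"
    proof (cases "l = 0")
      case False
      then have "1 \<le> \<bar>real_of_int l\<bar>" by linarith
      then have "\<bar>real_of_int l\<bar> powr (2 * s) \<le> \<bar>real_of_int l\<bar> powr 2" using s
          by (intro powr_mono) auto
      also have "\<dots> = (real_of_int l)\<^sup>2" using False by simp
      finally show ?thesis by simp
    qed simp
    then have "cmod (of_real (\<bar>of_int l\<bar> powr (2 * s)) * fourier_coeff (u t) l) \<le>
        (1 + (real_of_int l)\<^sup>2) * (B * (1 + (of_int l)\<^sup>2) powr (- (\<mu> / 2)))"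
      unfolding norm_mult using coeff_le[OF that] by (intro mult_mono) auto
    also have "\<dots> = B * ((1 + (real_of_int l)\<^sup>2) powr 1 * (1 + (of_int l)\<^sup>2) powr (- (\<mu> / 2)))"
      using base[of l] by (simp del: powr_one_gt_zero_iff add: powr_one)
    also have "\<dots> = M l" unfolding M_def powr_add[symmetric] by simp
    finally show ?thesis .
  qed
  have coeff_le_M: "cmod (fourier_coeff (u t) l) \<le> M l" if "t \<in> {0..T}" for t l
  proof -
    have "cmod (fourier_coeff (u t) l) \<le> B * (1 + (of_int l)\<^sup>2) powr (- (\<mu> / 2))"
        by (rule coeff_le[OF that])
    also have "\<dots> \<le> M l" unfolding M_def using B0 by (intro mult_left_mono powr_mono) auto
    finally show ?thesis .
  qed
  have cont: "continuous_on ({0..T} \<times> UNIV) (\<lambda>(t, x). u t x)" using sol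
      by (simp add: fnls_solution_def)
  have cont_u: "continuous_on S (\<lambda>y. u (p y) (r y))"
    if "continuous_on S p" "continuous_on S r" "\<And>y. y \<in> S \<Longrightarrow> p y \<in> {0..T}"
        for S :: "'b::topological_space set" and p r
  proof -
    have "(\<lambda>y. (p y, r y)) ` S \<subseteq> {0..T} \<times> UNIV" using that(3) by auto
    from continuous_on_compose2[OF cont continuous_on_Pair[OF that(1,2)] this] show ?thesis by simp
  qed
  have cont_ut: "continuous_on S (u t)" if "t \<in> {0..T}" for t S
    using that by (intro cont_u continuous_intros) auto
  have per: "u t (- pi) = u t pi" if "t \<in> {0..T}" for t
  proof -
    have "periodic_2pi (u t)" using sol that by (simp add: fnls_solution_def)
    then have "u t (- pi + 2 * pi) = u t (- pi)" unfolding periodic_2pi_def by blast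
    then show ?thesis by simp
  qed
  show "(\<lambda>m. tri (freqs m) (fourier_coeff (u t)) (fourier_coeff (u t)) (fourier_coeff (u t)) l) \<longlonglongrightarrow>
      fourier_coeff (cubic (u t)) l"
    by (rule tendsto_tri_fourier_coeff[OF cont_ut[OF t] per[OF t] coeff_le_M[OF t] M_sum])

  define a where "a t l = of_real (\<bar>of_int l\<bar> powr (2 * s)) * fourier_coeff (u t) l" for t l
  have frac: "frac_laplacian s (u t) x = (\<Sum>\<^sub>\<infinity>l. a t l * cis (of_int l * x))" for t x
    by (simp add: frac_laplacian_def a_def)
  define ut where "ut t x = - \<i> * frac_laplacian s (u t) x + \<i> * cubic (u t) x" for t x
  have deriv: "((\<lambda>\<tau>. u \<tau> x) has_vector_derivative ut t x) (at t within {0..T})" if tT: "t \<in> {0..T}"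
      for t x
  proof -
    obtain u' where u': "((\<lambda>\<tau>. u \<tau> x) has_vector_derivative u') (at t within {0..T})"
      "\<i> * u' - frac_laplacian s (u t) x + cubic (u t) x = 0"
      using sol tT unfolding fnls_solution_def by blast
    have "\<i> * u' = frac_laplacian s (u t) x - cubic (u t) x" using u'(2)
        by (simp add: algebra_simps add_eq_0_iff)
    then have "- \<i> * (\<i> * u') = - \<i> * (frac_laplacian s (u t) x - cubic (u t) x)" by simp
    then have "u' = ut t x" unfolding ut_def by (simp add: algebra_simps flip: mult.assoc)
    with u'(1) show ?thesis by simp
  qed
  have cont_coeff: "continuous_on {0..T} (\<lambda>t. fourier_coeff (u t) l)" for l
  proof -
    have "continuous_on {0..T} (\<lambda>t. integral (cbox (-pi) pi) (\<lambda>x. u t x * cis (- (of_int l * x))) /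
        of_real (2 * pi))"
      by (intro continuous_intros integral_continuous_on_param)
         (auto simp: case_prod_beta intro!: continuous_intros cont_u)
    then show ?thesis
      by (rule continuous_on_eq) (simp add: fourier_coeff_eq_integral[OF cont_ut])
  qed
  \<comment> \<open>Each partial sum is jointly continuous by \<open>cont_coeff\<close>, and the
    majorant makes the convergence uniform in (t, x).\<close>
  have cont_frac: "continuous_on ({0..T} \<times> UNIV) (\<lambda>y. frac_laplacian s (u (fst y)) (snd y))"
  proof (rule uniform_limit_theorem)
    show "uniform_limit ({0..T} \<times> UNIV) (\<lambda>m y. trigpoly (freqs m) (a (fst y)) (snd y)) (\<lambda>y.
        frac_laplacian s (u (fst y)) (snd y)) sequentially"
      unfolding frac using lap_le M_sum
          by (intro fourier_series_uniform_limit[where M = M]) (auto simp: a_def)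
    show "\<forall>\<^sub>F m in sequentially. continuous_on ({0..T} \<times> UNIV) (\<lambda>y. trigpoly (freqs m) (a (fst y))
        (snd y))"
      unfolding trigpoly_def a_def
      by (intro always_eventually allI continuous_intros continuous_on_compose2[OF cont_coeff, of _
          fst]) auto
  qed simp
  have cont_ut': "continuous_on ({0..T} \<times> cbox (-pi) pi) (\<lambda>(t, x). ut t x * cis (- (of_int l * x)))"
    unfolding ut_def cubic_eq case_prod_beta
    by (intro continuous_intros continuous_on_subset[OF cont_frac] cont_u) auto
  have "((\<lambda>t. integral (cbox (-pi) pi) (\<lambda>x. u t x * cis (- (of_int l * x)))) has_vector_derivative
      integral (cbox (-pi) pi) (\<lambda>x. ut t x * cis (- (of_int l * x)))) (at t within {0..T})"
  proof (rule leibniz_rule_vector_derivative[OF _ _ cont_ut' t])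
    show "((\<lambda>t. u t x * cis (- (of_int l * x))) has_vector_derivative
        ut t x * cis (- (of_int l * x))) (at t within {0..T})"
      if "t \<in> {0..T}" for t x
      by (intro has_vector_derivative_mult_left deriv that)
    show "(\<lambda>x. u t x * cis (- (of_int l * x))) integrable_on cbox (- pi) pi" if "t \<in> {0..T}" for t
      using cont_ut[OF that] by (intro integrable_continuous continuous_intros)
  qed simp
  then have "((\<lambda>t. integral (cbox (-pi) pi) (\<lambda>x. u t x * cis (- (of_int l * x))) / of_real (2 * pi))
      has_vector_derivative
      integral (cbox (-pi) pi) (\<lambda>x. ut t x * cis (- (of_int l * x))) / of_real (2 * pi)) (at t
          within {0..T})"
    by (rule has_vector_derivative_divide)
  note D = this
  have cont_utx: "continuous_on {-pi..pi} (frac_laplacian s (u t))" "continuous_on {-pi..pi} (cubic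
      (u t))"
    "continuous_on {-pi..pi} (ut t)"
  proof -
    show 1: "continuous_on {-pi..pi} (frac_laplacian s (u t))"
      unfolding frac[abs_def] using lap_le[OF t] M_sum
          by (intro fourier_coeff_series(2)[where M = M]) (auto simp: a_def)
    show 2: "continuous_on {-pi..pi} (cubic (u t))"
      unfolding cubic_eq[abs_def] by (intro continuous_intros cont_ut t)
    show "continuous_on {-pi..pi} (ut t)" unfolding ut_def[abs_def] by (intro continuous_intros 1 2)
  qed
  have "((\<lambda>t. fourier_coeff (u t) l) has_vector_derivative
      fourier_coeff (ut t) l) (at t within {0..T})"
    unfolding fourier_coeff_eq_integral[OF cont_utx(3)]
    by (rule has_vector_derivative_transform[OF t _ D[unfolded cbox_interval]])
       (rule fourier_coeff_eq_integral[OF cont_ut])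
  moreover have "fourier_coeff (ut t) l =
      - \<i> * of_real (\<bar>of_int l\<bar> powr (2 * s)) * fourier_coeff (u t) l + \<i> * fourier_coeff (cubic (u
      t)) l"
  proof -
    have "fourier_coeff (ut t) l =
        - \<i> * fourier_coeff (frac_laplacian s (u t)) l + \<i> * fourier_coeff (cubic (u t)) l"
      unfolding ut_def[abs_def] fourier_coeff_cmult[symmetric]
      by (intro fourier_coeff_add continuous_intros cont_utx)
    also have "fourier_coeff (frac_laplacian s (u t)) l = a t l"
      unfolding frac[abs_def] using lap_le[OF t] M_sum
          by (intro fourier_coeff_series(1)[where M = M]) (auto simp: a_def)
    finally show ?thesis by (simp add: a_def mult.assoc)
  qed
  ultimately show "((\<lambda>t. fourier_coeff (u t) l) has_vector_derivative
      - \<i> * of_real (\<bar>of_int l\<bar> powr (2 * s)) * fourier_coeff (u t) l + \<i> * fourier_coeff (cubic (u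
          t)) l) (at t within {0..T})"
    by simp
qed

section \<open>The fully discrete scheme\<close>

lemma trig_space_diff:
  assumes "f \<in> trig_space N" "g \<in> trig_space N"
  shows "(\<lambda>x. f x - g x) \<in> trig_space N"
proof -
  obtain a b where "f = trigpoly (freqs N) a" "g = trigpoly (freqs N) b"
    using assms unfolding trig_space_iff by blast
  then show ?thesis by (simp add: trigpoly_diff)
qed

lemma is_step_iff:
  "is_step s N p k v Y \<longleftrightarrow> Y 0 = v \<and> (\<forall>j\<le>stages p. Y j \<in> trig_space N) \<and>
     (\<forall>j\<in>{1..stages p}. midpoint_step s (freqs N) (k * yoshida_coeff p j)
        (fourier_coeff (Y (j - 1))) (fourier_coeff (Y j)))"
proof -
  have "(\<forall>x. Y j x = Y (j - 1) x + of_real (k * yoshida_coeff p j) *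
          semidiscrete_rhs s N (\<lambda>y. (Y j y + Y (j - 1) y) / 2) x) \<longleftrightarrow>
    midpoint_step s (freqs N) (k * yoshida_coeff p j) (fourier_coeff (Y (j - 1))) (fourier_coeff (Y
        j))"
    if "\<forall>j\<le>stages p. Y j \<in> trig_space N" "j \<in> {1..stages p}" for j
  proof -
    have "Y j \<in> trig_space N" "Y (j - 1) \<in> trig_space N" using that by auto
    then show ?thesis
      using midpoint_step_trigpoly_iff[of N "fourier_coeff (Y j)" "fourier_coeff (Y (j - 1))" "k *
          yoshida_coeff p j" s]
      by (simp only: trig_space_eq[symmetric])
  qed
  then show ?thesis unfolding is_step_def by blast
qed

lemma is_step_midpoint_step:
  assumes "is_step s N p k v Y" "Suc j \<le> stages p"
  shows "midpoint_step s (freqs N) (k * yoshida_coeff p (Suc j)) (fourier_coeff (Y j))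
      (fourier_coeff (Y (Suc j)))"
proof -
  have "Suc j \<in> {1..stages p}" using assms(2) by simp
  then have "midpoint_step s (freqs N) (k * yoshida_coeff p (Suc j)) (fourier_coeff (Y (Suc j - 1)))
      (fourier_coeff (Y (Suc j)))"
    using assms(1) unfolding is_step_iff by blast
  then show ?thesis by simp
qed

lemma is_step_mass:
  assumes "is_step s N p k v Y" "j \<le> stages p"
  shows "hs 0 (freqs N) (fourier_coeff (Y j)) = hs 0 (freqs N) (fourier_coeff v)"
  using assms(2)
proof (induction j)
  case 0
  then show ?case using assms(1) by (simp add: is_step_def)
next
  case (Suc j)
  from midpoint_step_mass[OF is_step_midpoint_step[OF assms(1) Suc.prems]] Suc show ?case by simp
qed

text \<open>Mass conservation reproduces the same L2 smallness at every stage, so uniqueness of one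
  stage can be applied inductively.\<close>

lemma is_step_unique:
  assumes Y: "is_step s N p k v Y" and Y': "is_step s N p k v Y'"
    and \<eta>: "\<And>j. j \<in> {1..stages p} \<Longrightarrow> \<bar>k * yoshida_coeff p j\<bar> \<le> \<eta>"
    and h: "6 * \<eta> * card (freqs N) * (hs 0 (freqs N) (fourier_coeff v))\<^sup>2 \<le> 1"
    and "j \<le> stages p"
  shows "Y j = Y' j"
  using assms(5)
proof (induction j)
  case 0
  then show ?case using Y Y' by (simp add: is_step_def)
next
  case (Suc j)
  then have j: "Suc j \<in> {1..stages p}" and eq: "Y j = Y' j" by auto
  have "6 * \<bar>k * yoshida_coeff p (Suc j)\<bar> * card (freqs N) * (hs 0 (freqs N) (fourier_coeff (Y
      j)))\<^sup>2
     \<le> 6 * \<eta> * card (freqs N) * (hs 0 (freqs N) (fourier_coeff v))\<^sup>2"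
    using \<eta>[OF j] is_step_mass[OF Y, of j] Suc.prems by (intro mult_mono) auto
  then have small: "6 * \<bar>k * yoshida_coeff p (Suc j)\<bar> * card (freqs N) * (hs 0 (freqs N)
      (fourier_coeff (Y j)))\<^sup>2 \<le> 1"
    using h by linarith
  have step: "midpoint_step s (freqs N) (k * yoshida_coeff p (Suc j)) (fourier_coeff (Y j))
      (fourier_coeff (Y (Suc j)))"
    "midpoint_step s (freqs N) (k * yoshida_coeff p (Suc j)) (fourier_coeff (Y j)) (fourier_coeff
        (Y' (Suc j)))"
    using is_step_midpoint_step[OF Y Suc.prems] is_step_midpoint_step[OF Y' Suc.prems]
        by (simp_all only: eq)
  have "\<forall>l\<in>freqs N. fourier_coeff (Y (Suc j)) l = fourier_coeff (Y' (Suc j)) l"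
    using midpoint_step_unique[OF finite_freqs small step] by blast
  then have eq: "trigpoly (freqs N) (fourier_coeff (Y (Suc j))) =
      trigpoly (freqs N) (fourier_coeff (Y' (Suc j)))"
    by (intro trigpoly_cong) auto
  have trig: "Y (Suc j) \<in> trig_space N" "Y' (Suc j) \<in> trig_space N"
    using Y Y' Suc.prems by (auto simp: is_step_def)
  have "Y (Suc j) = trigpoly (freqs N) (fourier_coeff (Y (Suc j)))"
      by (rule trig_space_eq[OF trig(1)])
  also note eq
  also have "trigpoly (freqs N) (fourier_coeff (Y' (Suc j))) = Y' (Suc j)"
      by (rule trig_space_eq[OF trig(2), symmetric])
  finally show ?case .
qed

lemma is_step_exists:
  assumes v: "v \<in> trig_space N"
    and \<eta>: "\<And>j. j \<in> {1..stages p} \<Longrightarrow> \<bar>k * yoshida_coeff p j\<bar> \<le> \<eta>"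
    and h: "6 * \<eta> * card (freqs N) * (hs 0 (freqs N) (fourier_coeff v))\<^sup>2 \<le> 1"
    and C: "\<And>a b c. hs s (freqs N) (tri (freqs N) a b c) \<le>
        C * hs s (freqs N) a * hs s (freqs N) b * hs s (freqs N) c" "0 \<le> C"
  shows "\<exists>Y. is_step s N p k v Y"
proof -
  let ?A = "freqs N"
  \<comment> \<open>The stages are chosen recursively. A choice is known to solve its equation only
    if the previous mass is that of \<open>v\<close>; \<open>step\<close> assumes this and
    \<open>mass\<close> discharges it by induction.\<close>
  define y where "y = rec_nat (fourier_coeff v)
    (\<lambda>j y. SOME z. midpoint_step s ?A (k * yoshida_coeff p (Suc j)) y z)"
  have y0: "y 0 = fourier_coeff v" by (simp add: y_def)
  have ySuc: "y (Suc j) = (SOME z. midpoint_step s ?A (k * yoshida_coeff p (Suc j)) (y j) z)" for j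
    by (simp add: y_def)
  have step: "midpoint_step s ?A (k * yoshida_coeff p (Suc j)) (y j) (y (Suc j))"
    if "Suc j \<le> stages p" "hs 0 ?A (y j) = hs 0 ?A (fourier_coeff v)" for j
  proof -
    have "6 * \<bar>k * yoshida_coeff p (Suc j)\<bar> * card ?A * (hs 0 ?A (y j))\<^sup>2
       \<le> 6 * \<eta> * card ?A * (hs 0 ?A (fourier_coeff v))\<^sup>2"
      using \<eta>[of "Suc j"] that by (intro mult_mono) auto
    then have "6 * \<bar>k * yoshida_coeff p (Suc j)\<bar> * card ?A * (hs 0 ?A (y j))\<^sup>2 \<le> 1" using h
        by linarith
    from midpoint_step_exists[OF finite_freqs this C]
    have "\<exists>z. midpoint_step s ?A (k * yoshida_coeff p (Suc j)) (y j) z" by metis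
    then show ?thesis unfolding ySuc by (rule someI_ex)
  qed
  have mass: "j \<le> stages p \<Longrightarrow> hs 0 ?A (y j) = hs 0 ?A (fourier_coeff v)" for j
  proof (induction j)
    case (Suc j)
    then show ?case using midpoint_step_mass[OF step[of j]] by simp
  qed (simp add: y0)
  have "is_step s N p k v (\<lambda>j. trigpoly ?A (y j))"
    unfolding is_step_def
  proof (intro conjI ballI)
    show "trigpoly ?A (y 0) = v" using trig_space_eq[OF v] by (simp add: y0)
    fix j assume "j \<in> {1..stages p}"
    then obtain i where "j = Suc i" "Suc i \<le> stages p" by (cases j) auto
    then show "\<forall>x. trigpoly ?A (y j) x =
        trigpoly ?A (y (j - 1)) x + of_real (k * yoshida_coeff p j) *
       semidiscrete_rhs s N (\<lambda>x. (trigpoly ?A (y j) x + trigpoly ?A (y (j - 1)) x) / 2) x"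
      unfolding midpoint_step_trigpoly_iff using step[of i] mass[of i] by simp
  qed simp
  then show ?thesis by blast
qed

lemma semidiscrete_solution_coeff:
  assumes sol: "semidiscrete_solution s N T u0 uN" and t: "t \<in> {0..T}" and l: "l \<in> freqs N"
  shows "((\<lambda>t. fourier_coeff (uN t) l) has_vector_derivative
      - \<i> * of_real (\<bar>of_int l\<bar> powr (2 * s)) * fourier_coeff (uN t) l +
      \<i> * tri (freqs N) (fourier_coeff (uN t)) (fourier_coeff (uN t)) (fourier_coeff (uN t)) l) (at
          t within {0..T})"
proof -
  have trig: "uN t \<in> trig_space N" if "t \<in> {0..T}" for t
    using sol that by (simp add: semidiscrete_solution_def)
  have rhs: "semidiscrete_rhs s N (uN t) =
      trigpoly (freqs N) (\<lambda>l. - \<i> * of_real (\<bar>of_int l\<bar> powr (2 * s)) * fourier_coeff (uN t) l +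
      \<i> * tri (freqs N) (fourier_coeff (uN t)) (fourier_coeff (uN t)) (fourier_coeff (uN t)) l)"
    using semidiscrete_rhs_trigpoly[of s N "fourier_coeff (uN t)"] trig_space_eq[OF trig[OF t]]
        by simp
  have "((\<lambda>t. fourier_coeff (uN t) l) has_vector_derivative
      fourier_coeff (semidiscrete_rhs s N (uN t)) l) (at t within {0..T})"
  proof (rule fourier_coeff_has_vector_derivative[OF trig _ t l])
    show "semidiscrete_rhs s N (uN t) \<in> trig_space N" unfolding rhs by simp
    show "((\<lambda>t. uN t x) has_vector_derivative semidiscrete_rhs s N (uN t) x) (at t within {0..T})"
        for x
      using sol t by (simp add: semidiscrete_solution_def)
  qed
  then show ?thesis using l by (simp add: rhs fourier_coeff_trigpoly)
qed

section \<open>From finite frequency sets back to Sobolev and L2 norms\<close>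

lemma hs_Un_le:
  assumes "finite A" "finite B"
  shows "hs s (A \<union> B) c \<le> hs s A c + hs s B c"
proof (rule power2_le_imp_le)
  have "(hs s (A \<union> B) c)\<^sup>2 \<le> (hs s A c)\<^sup>2 + (hs s B c)\<^sup>2"
    unfolding hs_power2 using assms by (simp add: sum_Un sum_nonneg)
  also have "\<dots> \<le> (hs s A c + hs s B c)\<^sup>2" by (simp add: power2_sum)
  finally show "(hs s (A \<union> B) c)\<^sup>2 \<le> (hs s A c + hs s B c)\<^sup>2" .
qed simp

lemma sobolev_norm_le:
  assumes "\<And>F. finite F \<Longrightarrow> hs s F (fourier_coeff f) \<le> b"
  shows "sobolev_norm s f \<le> b"
proof -
  let ?g = "\<lambda>l::int. (1 + (of_int l)\<^sup>2) powr s * (cmod (fourier_coeff f l))\<^sup>2"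
  have b0: "0 \<le> b" using assms[of "{}"] by (simp add: hs_def)
  have le: "sum ?g F \<le> b\<^sup>2" if "finite F" for F
    using assms[OF that] power_mono[of "hs s F (fourier_coeff f)" b 2] by (simp add: hs_power2)
  have "?g summable_on UNIV"
    by (rule nonneg_bdd_above_summable_on) (auto intro!: bdd_aboveI[of _ "b\<^sup>2"] le)
  then have "infsum ?g UNIV \<le> b\<^sup>2" by (rule infsum_le_finite_sums) (rule le)
  then show ?thesis unfolding sobolev_norm_def using b0 by (intro real_le_lsqrt) auto
qed

text \<open>Split at frequency N. Beyond it the coefficients of \<open>f\<close> vanish, so the
  difference reduces to the tail of \<open>g\<close>.\<close>

lemma sobolev_norm_diff_le:
  assumes f: "f \<in> trig_space N" and g: "continuous_on {-pi..pi} g"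
    and B: "\<And>F. finite F \<Longrightarrow> hs \<mu> F (fourier_coeff g) \<le> B" and "1 \<le> N" "s \<le> \<mu>"
    and \<delta>: "hs s (freqs N) (\<lambda>l. fourier_coeff f l - fourier_coeff g l) \<le> \<delta>"
  shows "sobolev_norm s (\<lambda>x. f x - g x) \<le> \<delta> + real N powr (s - \<mu>) * B"
proof (rule sobolev_norm_le)
  fix F :: "int set" assume F: "finite F"
  let ?d = "\<lambda>l. fourier_coeff f l - fourier_coeff g l"
  have d: "fourier_coeff (\<lambda>x. f x - g x) = ?d"
    using fourier_coeff_diff[OF trig_space_continuous[OF f] g] by (simp add: fun_eq_iff)
  have "hs s F ?d \<le> hs s (freqs N \<union> (F - freqs N)) ?d" using F by (intro hs_subset) auto
  also have "\<dots> \<le> hs s (freqs N) ?d + hs s (F - freqs N) ?d" using F by (intro hs_Un_le) auto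
  also have "hs s (F - freqs N) ?d \<le> hs s (F - freqs N) (fourier_coeff g)"
    using fourier_coeff_trig_space[OF f] by (intro hs_mono_cmod) auto
  also have "\<dots> \<le> real N powr (s - \<mu>) * B" using F assms by (intro hs_tail_le) auto
  finally show "hs s F (fourier_coeff (\<lambda>x. f x - g x)) \<le> \<delta> + real N powr (s - \<mu>) * B"
    unfolding d using \<delta> by linarith
qed

text \<open>The constants match because the squared \<open>L2_norm\<close> is 2 pi times the squared
  l2 norm of the coefficients, 2N + 1 is at most 3N, and 3 is less than pi.\<close>

lemma step_size_condition:
  assumes "3 * (L2_norm (fourier_proj N u0))\<^sup>2 * k * real N * b < 1" "1 \<le> N" "0 < k" "0 \<le> b"
  shows "6 * (k * b) * card (freqs N) * (hs 0 (freqs N) (fourier_coeff (fourier_proj N u0)))\<^sup>2 \<le> 1"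
proof -
  let ?h = "(hs 0 (freqs N) (fourier_coeff (fourier_proj N u0)))\<^sup>2"
  have L2: "(L2_norm (fourier_proj N u0))\<^sup>2 = 2 * pi * ?h"
    by (rule L2_norm_trig_space) (simp add: fourier_proj_eq)
  have "6 * (k * b) * card (freqs N) * ?h \<le> 6 * (k * b) * (3 * real N) * ?h"
    using assms by (intro mult_right_mono mult_left_mono) (auto simp: card_freqs)
  also have "\<dots> = 3 * (6 * ?h * k * real N * b)" by simp
  also have "\<dots> \<le> pi * (6 * ?h * k * real N * b)"
    using assms pi_gt3 by (intro mult_right_mono) auto
  also have "\<dots> = 3 * (L2_norm (fourier_proj N u0))\<^sup>2 * k * real N * b" unfolding L2 by simp
  finally show ?thesis using assms(1) by linarith
qed

lemma fully_discrete_solution_exists_unique: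
  assumes \<eta>: "\<And>j. j \<in> {1..stages p} \<Longrightarrow> \<bar>k * yoshida_coeff p j\<bar> \<le> \<eta>"
    and h: "6 * \<eta> * card (freqs N) * (hs 0 (freqs N) (fourier_coeff (fourier_proj N u0)))\<^sup>2 \<le> 1"
    and C: "\<And>a b c. hs s (freqs N) (tri (freqs N) a b c) \<le>
        C * hs s (freqs N) a * hs s (freqs N) b * hs s (freqs N) c" "0 \<le> C"
  obtains U Y where "fully_discrete_solution s N p k M u0 U Y"
    "\<And>n. hs 0 (freqs N) (fourier_coeff (U n)) = hs 0 (freqs N) (fourier_coeff (fourier_proj N u0))"
    "\<And>U' Y' n. fully_discrete_solution s N p k M u0 U' Y' \<Longrightarrow> n \<le> M \<Longrightarrow> U' n = U n"
    "\<And>U' Y' n j. fully_discrete_solution s N p k M u0 U' Y' \<Longrightarrow> n < M \<Longrightarrow> j \<le> stages p \<Longrightarrow> Y' n j = Y n j"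
proof -
  \<comment> \<open>Turns a step into a function of its starting value. \<open>U\<close> is then an
    iteration over all n, and the mass invariant below shows that every choice along it is a genuine
    step.\<close>
  define S where "S v = (SOME Y. is_step s N p k v Y)" for v
  define U where "U = rec_nat (fourier_proj N u0) (\<lambda>n v. S v (stages p))"
  have U0: "U 0 = fourier_proj N u0" and USuc: "U (Suc n) = S (U n) (stages p)" for n
      by (auto simp: U_def)
  have "U n \<in> trig_space N \<and> hs 0 (freqs N) (fourier_coeff (U n)) =
      hs 0 (freqs N) (fourier_coeff (fourier_proj N u0))
     \<and> is_step s N p k (U n) (S (U n))" for n
  proof (induction n)
    case 0
    have "fourier_proj N u0 \<in> trig_space N" by (simp add: fourier_proj_eq)
    moreover from this have "\<exists>Y. is_step s N p k (fourier_proj N u0) Y"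
      using h C by (intro is_step_exists[OF _ \<eta>]) auto
    then have "is_step s N p k (U 0) (S (U 0))" unfolding U0 S_def by (rule someI_ex)
    ultimately show ?case by (simp add: U0)
  next
    case (Suc n)
    then have step: "is_step s N p k (U n) (S (U n))" by simp
    then have "U (Suc n) \<in> trig_space N" unfolding USuc by (simp add: is_step_def)
    moreover have mass: "hs 0 (freqs N) (fourier_coeff (U (Suc n))) =
        hs 0 (freqs N) (fourier_coeff (fourier_proj N u0))"
      unfolding USuc using is_step_mass[OF step] Suc by simp
    ultimately have "\<exists>Y. is_step s N p k (U (Suc n)) Y"
      using h C by (intro is_step_exists[OF _ \<eta>]) auto
    then have "is_step s N p k (U (Suc n)) (S (U (Suc n)))" unfolding S_def by (rule someI_ex)
    with mass \<open>U (Suc n) \<in> trig_space N\<close> show ?case by simp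
  qed
  then have U_trig: "U n \<in> trig_space N"
    and mass: "hs 0 (freqs N) (fourier_coeff (U n)) =
        hs 0 (freqs N) (fourier_coeff (fourier_proj N u0))"
    and step: "is_step s N p k (U n) (S (U n))" for n by auto
  have step_eq: "Y' j = S (U n) j" if "is_step s N p k (U n) Y'" "j \<le> stages p" for Y' n j
    using h mass[of n] by (intro is_step_unique[OF that(1) step \<eta> _ that(2)]) auto
  have U_eq: "U' n = U n" if "fully_discrete_solution s N p k M u0 U' Y'" "n \<le> M" for U' Y' n
    using that(2)
  proof (induction n)
    case 0
    then show ?case using that by (simp add: fully_discrete_solution_def U0)
  next
    case (Suc n)
    then have "is_step s N p k (U n) (Y' n)" "U' (Suc n) = Y' n (stages p)"
      using that unfolding fully_discrete_solution_def by (metis Suc_le_eq less_imp_le)+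
    then show ?case using step_eq by (simp add: USuc)
  qed
  show thesis
  proof
    show "fully_discrete_solution s N p k M u0 U (\<lambda>n. S (U n))"
      by (simp add: fully_discrete_solution_def U0 USuc U_trig step)
    show "Y' n j = S (U n) j" if "fully_discrete_solution s N p k M u0 U' Y'" "n < M" "j \<le> stages p"
        for U' Y' n j
      using that U_eq[OF that(1), of n] by (intro step_eq) (auto simp: fully_discrete_solution_def)
  qed (fact mass U_eq)+
qed

text \<open>A discrete Gronwall inequality with bootstrap: the recursion is available only while
  \<open>e n\<close> is at most 1, and the smallness hypothesis keeps the final bound at most
  1.\<close>

lemma error_recursion:
  fixes e :: "nat \<Rightarrow> real"
  assumes "e 0 = 0" and "0 \<le> X" "0 \<le> \<rho>" "real M * exp (\<rho> * real M) * X \<le> 1"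
    and step: "\<And>n. n < M \<Longrightarrow> e n \<le> 1 \<Longrightarrow> e (Suc n) \<le> exp \<rho> * e n + X"
    and "n \<le> M"
  shows "e n \<le> real M * exp (\<rho> * real M) * X"
proof -
  have mono: "real n * exp (\<rho> * real n) * X \<le> real M * exp (\<rho> * real M) * X" if "n \<le> M" for n
    using that assms by (intro mult_right_mono mult_mono) (auto intro: mult_left_mono)
  have "e n \<le> real n * exp (\<rho> * real n) * X"
    using \<open>n \<le> M\<close>
  proof (induction n)
    case (Suc n)
    then have IH: "e n \<le> real n * exp (\<rho> * real n) * X" by simp
    have "e (Suc n) \<le> exp \<rho> * e n + X"
      using Suc.prems IH mono[of n] assms(4) by (intro step) auto
    also have "\<dots> \<le> exp \<rho> * (real n * exp (\<rho> * real n) * X) + exp (\<rho> * real (Suc n)) * X"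
    proof (intro add_mono mult_left_mono IH)
      show "X \<le> exp (\<rho> * real (Suc n)) * X"
        using assms by (simp add: mult_le_cancel_right1)
    qed simp
    also have "\<dots> = real (Suc n) * exp (\<rho> * real (Suc n)) * X"
      by (simp add: distrib_left exp_add algebra_simps)
    finally show ?case .
  qed (simp add: assms(1))
  with mono[OF \<open>n \<le> M\<close>] show ?thesis by linarith
qed

text \<open>The step from \<open>U n\<close> is compared with the step from the value of
  \<open>uN\<close> at the same time: stability bounds the distance of the last stages, and the
  local error supplies the rest. \<open>uN\<close> is bounded by B - 1 so that \<open>U n\<close>
  stays within B while the error is at most 1.\<close>

lemma temporal_error:
  fixes C T k B D \<beta> :: real
  assumes C: "\<And>a b c. hs s (freqs N) (tri (freqs N) a b c) \<le>
      C * hs s (freqs N) a * hs s (freqs N) b * hs s (freqs N) c" "0 \<le> C"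
    and \<beta>: "\<And>j. j \<in> {1..stages p} \<Longrightarrow> \<bar>yoshida_coeff p j\<bar> \<le> \<beta>" "0 \<le> \<beta>" and k: "0 < k"
    and B: "12 * C * (k * \<beta>) * (5 ^ stages p * B)\<^sup>2 \<le> 1"
    and h: "6 * (k * \<beta>) * card (freqs N) * (hs 0 (freqs N) (fourier_coeff (fourier_proj N u0)))\<^sup>2 \<le>
        1"
    and U: "fully_discrete_solution s N p k M u0 U Y"
      "\<And>n. hs 0 (freqs N) (fourier_coeff (U n)) =
          hs 0 (freqs N) (fourier_coeff (fourier_proj N u0))"
    and uN: "semidiscrete_solution s N T u0 uN" "T = real M * k" 
      "\<And>t. t \<in> {0..T} \<Longrightarrow> hs s (freqs N) (fourier_coeff (uN t)) \<le> B - 1"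
    and Z: "\<And>n. n < M \<Longrightarrow> is_step s N p k (uN (real n * k)) (Z n)"
    and \<Theta>: "\<And>n. n < M \<Longrightarrow> sobolev_norm s (\<lambda>x. uN (real (Suc n) * k) x - Z n (stages p) x) \<le>
        D * k ^ (\<alpha> + 1)" "0 \<le> D"
    and small: "T * exp (24 * real (stages p) * C * (5 ^ stages p * B)\<^sup>2 * \<beta> * T) * D * k ^ \<alpha> \<le> 1"
    and n: "n \<le> M"
  shows "hs s (freqs N) (\<lambda>l. fourier_coeff (U n) l - fourier_coeff (uN (real n * k)) l)
    \<le> T * exp (24 * real (stages p) * C * (5 ^ stages p * B)\<^sup>2 * \<beta> * T) * D * k ^ \<alpha>"
proof -
  let ?A = "freqs N" and ?q = "stages p"
  define \<Lambda> where "\<Lambda> = 24 * real ?q * C * (5 ^ ?q * B)\<^sup>2 * \<beta>"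
  define e where "e n = hs s ?A (\<lambda>l. fourier_coeff (U n) l - fourier_coeff (uN (real n * k)) l)"
      for n
  have time: "real n * k \<in> {0..T}" if "n \<le> M" for n
    using that k unfolding uN(2) by (auto intro: mult_right_mono)
  have uN_trig: "uN t \<in> trig_space N" if "t \<in> {0..T}" for t
    using uN(1) that by (simp add: semidiscrete_solution_def)
  have uN0: "uN 0 = fourier_proj N u0" using uN(1) by (simp add: semidiscrete_solution_def)
  have uN_mass: "hs 0 ?A (fourier_coeff (uN t)) = hs 0 ?A (fourier_coeff (fourier_proj N u0))"
      if "t \<in> {0..T}" for t
    using semidiscrete_mass[of T ?A "\<lambda>t. fourier_coeff (uN t)", OF semidiscrete_solution_coeff[OF
        uN(1)] that]
    by (simp add: uN0)
  have eta: "\<bar>k * yoshida_coeff p j\<bar> \<le> k * \<beta>" if "j \<in> {1..?q}" for j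
    using \<beta>(1)[OF that] k by (simp add: abs_mult)
  have rec: "e (Suc n) \<le> exp (\<Lambda> * k) * e n + D * k ^ (\<alpha> + 1)" if n: "n < M" and en: "e n \<le> 1" for n
  proof -
    have Un: "U n \<in> trig_space N" "is_step s N p k (U n) (Y n)" "U (Suc n) = Y n ?q"
      using U(1) n by (auto simp: fully_discrete_solution_def)
    note stepY = Un(2)[unfolded is_step_iff] and stepZ = Z[OF n, unfolded is_step_iff]
    have uNn: "hs s ?A (fourier_coeff (uN (real n * k))) \<le> B - 1" using n by (intro uN(3) time) simp
    have "hs s ?A (fourier_coeff (U n)) \<le>
        hs s ?A (\<lambda>l. (fourier_coeff (U n) l - fourier_coeff (uN (real n * k)) l) + fourier_coeff (uN
        (real n * k)) l)"
      by simp
    also have "\<dots> \<le> e n + hs s ?A (fourier_coeff (uN (real n * k)))" unfolding e_def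
        by (rule hs_triangle)
    finally have UB: "hs s ?A (fourier_coeff (U n)) \<le> B" using en uNn by linarith
    have "hs s ?A (\<lambda>l. fourier_coeff (Y n ?q) l - fourier_coeff (Z n ?q) l) \<le>
       exp (24 * real ?q * C * (5 ^ ?q * B)\<^sup>2 * (k * \<beta>)) * hs s ?A (\<lambda>l. fourier_coeff (Y n 0) l -
           fourier_coeff (Z n 0) l)"
    proof (rule stages_stable[where h = "\<lambda>j. k * yoshida_coeff p j" and Y =
        "\<lambda>j. fourier_coeff (Y n j)" and Y' = "\<lambda>j. fourier_coeff (Z n j)",
          OF finite_freqs eta _ C B])
      show "6 * (k * \<beta>) * card ?A * (hs 0 ?A (fourier_coeff (Y n 0)))\<^sup>2 \<le> 1"
        using h stepY U(2) by simp
      show "6 * (k * \<beta>) * card ?A * (hs 0 ?A (fourier_coeff (Z n 0)))\<^sup>2 \<le> 1"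
        using h stepZ uN_mass[OF time[of n]] n by simp
      show "hs s ?A (fourier_coeff (Y n 0)) \<le> B" "hs s ?A (fourier_coeff (Z n 0)) \<le> B"
        using stepY stepZ UB uNn by auto
    qed (use k \<beta>(2) stepY stepZ in auto)
    also have "\<dots> = exp (\<Lambda> * k) * e n" using stepY stepZ by (simp add: \<Lambda>_def e_def mult_ac)
    finally have 1: "hs s ?A (\<lambda>l. fourier_coeff (Y n ?q) l - fourier_coeff (Z n ?q) l) \<le>
        exp (\<Lambda> * k) * e n" .
    let ?\<theta> = "\<lambda>x. uN (real (Suc n) * k) x - Z n ?q x"
    have tr: "uN (real (Suc n) * k) \<in> trig_space N" "Z n ?q \<in> trig_space N"
      using n stepZ by (auto intro!: uN_trig time simp del: of_nat_Suc)
    have fc: "fourier_coeff ?\<theta> =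
        (\<lambda>l. fourier_coeff (uN (real (Suc n) * k)) l - fourier_coeff (Z n ?q) l)"
      using fourier_coeff_diff[OF trig_space_continuous[OF tr(1)] trig_space_continuous[OF tr(2)]]
          by (simp add: fun_eq_iff)
    have 2: "hs s ?A (\<lambda>l. fourier_coeff (uN (real (Suc n) * k)) l - fourier_coeff (Z n ?q) l) \<le>
        D * k ^ (\<alpha> + 1)"
      using \<Theta>(1)[OF n] unfolding sobolev_norm_trig_space[OF trig_space_diff[OF tr]] fc .
    have "e (Suc n) = hs s ?A (\<lambda>l. (fourier_coeff (Y n ?q) l - fourier_coeff (Z n ?q) l) -
        (fourier_coeff (uN (real (Suc n) * k)) l - fourier_coeff (Z n ?q) l))"
      unfolding e_def Un(3) by (simp del: of_nat_Suc)
    also have "\<dots> \<le> exp (\<Lambda> * k) * e n + D * k ^ (\<alpha> + 1)"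
      using hs_triangle_diff 1 2 by (meson add_mono order.trans)
    finally show ?thesis .
  qed
  \<comment> \<open>Since M k = T, summing M local errors turns one factor k into T and leaves the
    power \<alpha>.\<close>
  have eq: "real M * exp (\<Lambda> * k * real M) * (D * k ^ (\<alpha> + 1)) = T * exp (\<Lambda> * T) * D * k ^ \<alpha>"
    unfolding uN(2) by (simp add: mult_ac)
  have "e n \<le> real M * exp (\<Lambda> * k * real M) * (D * k ^ (\<alpha> + 1))"
  proof (rule error_recursion[where e = e, OF _ _ _ _ rec n])
    show "e 0 = 0" using U(1) by (simp add: e_def uN0 fully_discrete_solution_def hs_def L2_set_0')
    show "real M * exp (\<Lambda> * k * real M) * (D * k ^ (\<alpha> + 1)) \<le> 1"
      using small unfolding \<Lambda>_def[symmetric] eq .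
  qed (use k C(2) \<beta>(2) \<Theta>(2) in \<open>auto simp: \<Lambda>_def\<close>)
  then show ?thesis unfolding eq unfolding e_def \<Lambda>_def .
qed

theorem theorem3p2:
  fixes s :: real and p \<alpha> :: nat
  assumes "1 / 2 < s" and "s \<le> 1" and "1 \<le> p" and "1 < \<alpha>"
  shows "\<exists>\<mu>0::real. \<forall>\<mu>\<ge>\<mu>0. \<forall>T>0. \<forall>(u0 :: real \<Rightarrow> complex) (u :: real \<Rightarrow> real \<Rightarrow> complex) C\<^sub>\<Theta>::real.
    smooth u0 \<longrightarrow> periodic_2pi u0 \<longrightarrow>
    fnls_solution s T u0 u \<longrightarrow> bounded_in_sobolev \<mu> T u \<longrightarrow>
    (\<exists>k0>0. \<exists>C>0. \<forall>(k::real) (N::nat) (M::nat) uN Z.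
       0 < k \<longrightarrow> k \<le> k0 \<longrightarrow> 1 \<le> N \<longrightarrow> T = real M * k \<longrightarrow>
       3 * (L2_norm (fourier_proj N u0))\<^sup>2 * k * real N *
         (MAX j\<in>{1..stages p}. \<bar>yoshida_coeff p j\<bar>) < 1 \<longrightarrow>
       semidiscrete_solution s N T u0 uN \<longrightarrow>
       (\<forall>n<M. is_step s N p k (uN (real n * k)) (Z n)) \<longrightarrow>
       (\<forall>n<M. sobolev_norm s (\<lambda>x. uN (real (Suc n) * k) x - Z n (stages p) x)
                \<le> C\<^sub>\<Theta> * k ^ (\<alpha> + 1)) \<longrightarrow>
       (\<exists>U Y. fully_discrete_solution s N p k M u0 U Y \<and>
          (\<forall>U' Y'. fully_discrete_solution s N p k M u0 U' Y' \<longrightarrow>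
             (\<forall>n\<le>M. U' n = U n) \<and> (\<forall>n<M. \<forall>j\<le>stages p. Y' n j = Y n j)) \<and>
          (\<forall>n\<le>M. sobolev_norm s (\<lambda>x. U n x - u (real n * k) x)
                   \<le> C * (k ^ \<alpha> + real N powr (s - \<mu>)))))"
\<comment> \<open>\<mu> \<ge> 5 is what \<open>fnls_fourier_coeff\<close> requires, and it also
  ensures s < \<mu>.\<close>
proof (rule exI[of _ 5], intro allI impI)
  fix \<mu> T :: real and u0 :: "real \<Rightarrow> complex" and u :: "real \<Rightarrow> real \<Rightarrow> complex" and C\<^sub>\<Theta> :: real
  assume \<mu>: "5 \<le> \<mu>" and T: "0 < T" and sol: "fnls_solution s T u0 u" and "bounded_in_sobolev \<mu> T u"
  then obtain B0 where B0: "\<And>t. t \<in> {0..T} \<Longrightarrow> in_sobolev \<mu> (u t)" "\<And>t. t \<in> {0..T} \<Longrightarrow> sobolev_norm \<mu> (u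
      t) \<le> B0"
    unfolding bounded_in_sobolev_def by blast
  have s\<mu>: "s < \<mu>" using assms \<mu> by simp
  have u_hs: "hs \<mu> F (fourier_coeff (u t)) \<le> B0" if "t \<in> {0..T}" "finite F" for t F
    using in_sobolev_hs_le[OF B0] that by blast
  have B0_nonneg: "0 \<le> B0" using u_hs[of 0 "{}"] T by (simp add: hs_def)
  obtain C where C: "0 < C"
    "\<And>A B a b c. finite A \<Longrightarrow> finite B \<Longrightarrow> hs s B (tri A a b c) \<le> C * hs s A a * hs s A b * hs s A c"
    using tri_bound[OF assms(1,2)] by blast
  obtain K where K: "0 < K"
    "\<And>N c t. \<lbrakk>1 \<le> N; \<And>t l. t \<in> {0..T} \<Longrightarrow> l \<in> freqs N \<Longrightarrow> ((\<lambda>t. c t l) has_vector_derivative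
        - \<i> * of_real (\<bar>of_int l\<bar> powr (2 * s)) * c t l + \<i> * tri (freqs N) (c t) (c t) (c t) l) (at
            t within {0..T});
      \<And>l. l \<in> freqs N \<Longrightarrow> c 0 l = fourier_coeff (u 0) l; t \<in> {0..T}\<rbrakk>
     \<Longrightarrow> hs s (freqs N) (\<lambda>l. c t l - fourier_coeff (u t) l) \<le> K * real N powr (s - \<mu>)"
  proof (rule semidiscrete_error[OF assms(1,2) s\<mu> T fnls_fourier_coeff(1)[OF assms(1,2) \<mu> sol B0]
      u_hs
        fnls_fourier_coeff(2)[OF assms(1,2) \<mu> sol B0]], goal_cases)
    case (9 K)
    from 9(2,3) show ?case by (rule 9(1))
  qed
  define q where "q = stages p"
  define \<beta> where "\<beta> = (MAX j\<in>{1..q}. \<bar>yoshida_coeff p j\<bar>)"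
  \<comment> \<open>\<open>K\<close> bounds the spatial error because N^(s - \<mu>) is at most 1,
    \<open>B0\<close> bounds the exact solution, and 1 is the margin required by
    \<open>temporal_error\<close>.\<close>
  define B where "B = K + B0 + 1"
  \<comment> \<open>\<open>C\<^sub>\<Theta>\<close> is an arbitrary real, while the recursion works
    with a nonnegative constant.\<close>
  define D where "D = \<bar>C\<^sub>\<Theta>\<bar>"
  define E where "E = T * exp (24 * real q * C * (5 ^ q * B)\<^sup>2 * \<beta> * T) * D"
  define L where "L = 12 * C * \<beta> * (5 ^ q * B)\<^sup>2"
  have q: "1 \<le> q" by (simp add: q_def stages_def)
  have \<beta>_ge: "\<bar>yoshida_coeff p j\<bar> \<le> \<beta>" if "j \<in> {1..q}" for j
    unfolding \<beta>_def using that by (intro Max_ge) auto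
  have \<beta>0: "0 \<le> \<beta>" using \<beta>_ge[of 1] q by force
  have E0: "0 \<le> E" using T by (simp add: E_def D_def)
  have L0: "0 \<le> L" using C \<beta>0 by (simp add: L_def)
  have u0: "u 0 = u0" using sol by (auto simp: fnls_solution_def fun_eq_iff)
  \<comment> \<open>Ensures L k \<le> 1, which keeps the stages in their ball, and E k \<le> 1,
    which closes the bootstrap. The added 1 also gives k \<le> 1 and hence k^\<alpha> \<le> k. No
    quantity here depends on N.\<close>
  define k0 where "k0 = min (1 / (L + 1)) (1 / (E + 1))"
  have k0_pos: "0 < k0" using E0 L0 by (simp add: k0_def)
  \<comment> \<open>Contributions of the time discretization, of the semidiscretization below
    frequency N, and of the tail of \<open>u\<close>.\<close>
  define C' where "C' = E + K + B0"
  show "\<exists>k0>0. \<exists>C>0. \<forall>(k::real) (N::nat) (M::nat) uN Z.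
       0 < k \<longrightarrow> k \<le> k0 \<longrightarrow> 1 \<le> N \<longrightarrow> T = real M * k \<longrightarrow>
       3 * (L2_norm (fourier_proj N u0))\<^sup>2 * k * real N *
         (MAX j\<in>{1..stages p}. \<bar>yoshida_coeff p j\<bar>) < 1 \<longrightarrow>
       semidiscrete_solution s N T u0 uN \<longrightarrow>
       (\<forall>n<M. is_step s N p k (uN (real n * k)) (Z n)) \<longrightarrow>
       (\<forall>n<M. sobolev_norm s (\<lambda>x. uN (real (Suc n) * k) x - Z n (stages p) x)
                \<le> C\<^sub>\<Theta> * k ^ (\<alpha> + 1)) \<longrightarrow>
       (\<exists>U Y. fully_discrete_solution s N p k M u0 U Y \<and>
          (\<forall>U' Y'. fully_discrete_solution s N p k M u0 U' Y' \<longrightarrow>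
             (\<forall>n\<le>M. U' n = U n) \<and> (\<forall>n<M. \<forall>j\<le>stages p. Y' n j = Y n j)) \<and>
          (\<forall>n\<le>M. sobolev_norm s (\<lambda>x. U n x - u (real n * k) x)
                   \<le> C * (k ^ \<alpha> + real N powr (s - \<mu>))))"
  proof (rule exI[of _ k0], rule conjI[OF k0_pos exI[of _ C']], intro conjI allI impI)
    show "0 < C'" using E0 K B0_nonneg by (simp add: C'_def)
    fix k :: real and N M :: nat and uN Z
    assume k: "0 < k" "k \<le> k0" and N: "1 \<le> N" and TM: "T = real M * k"
      and cfl: "3 * (L2_norm (fourier_proj N u0))\<^sup>2 * k * real N * (MAX j\<in>{1..stages p}.
          \<bar>yoshida_coeff p j\<bar>) < 1"
      and uN: "semidiscrete_solution s N T u0 uN"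
      and Z: "\<forall>n<M. is_step s N p k (uN (real n * k)) (Z n)"
      and \<Theta>: "\<forall>n<M. sobolev_norm s (\<lambda>x. uN (real (Suc n) * k) x - Z n (stages p) x) \<le>
          C\<^sub>\<Theta> * k ^ (\<alpha> + 1)"
    let ?A = "freqs N"
    let ?r = "real N powr (s - \<mu>)"
    have h: "6 * (k * \<beta>) * card ?A * (hs 0 ?A (fourier_coeff (fourier_proj N u0)))\<^sup>2 \<le> 1"
      using cfl N k \<beta>0 by (intro step_size_condition) (auto simp: \<beta>_def q_def)
    have eta: "\<bar>k * yoshida_coeff p j\<bar> \<le> k * \<beta>" if "j \<in> {1..stages p}" for j
      using \<beta>_ge[of j] k that by (simp add: abs_mult q_def)
    have CA: "hs s ?A (tri ?A a b c) \<le> C * hs s ?A a * hs s ?A b * hs s ?A c" for a b c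
      by (rule C(2)) auto
    obtain U Y where UY: "fully_discrete_solution s N p k M u0 U Y"
      and U_mass: "\<And>n. hs 0 ?A (fourier_coeff (U n)) = hs 0 ?A (fourier_coeff (fourier_proj N u0))"
      and U_unique: "\<And>U' Y' n. fully_discrete_solution s N p k M u0 U' Y' \<Longrightarrow> n \<le> M \<Longrightarrow> U' n = U n"
      and Y_unique: "\<And>U' Y' n j. fully_discrete_solution s N p k M u0 U' Y' \<Longrightarrow> n < M \<Longrightarrow> j \<le>
          stages p \<Longrightarrow> Y' n j = Y n j"
      using fully_discrete_solution_exists_unique[OF eta h CA less_imp_le[OF C(1)]] by blast
    have space: "hs s ?A (\<lambda>l. fourier_coeff (uN t) l - fourier_coeff (u t) l) \<le> K * ?r"
        if "t \<in> {0..T}" for t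
    proof (rule K(2)[where c = "\<lambda>t. fourier_coeff (uN t)", OF N _ _ that])
      fix l assume l: "l \<in> ?A"
      have "uN 0 = trigpoly ?A (fourier_coeff u0)" using uN
          by (simp add: semidiscrete_solution_def fourier_proj_eq)
      then show "fourier_coeff (uN 0) l = fourier_coeff (u 0) l" using l
          by (simp add: u0 fourier_coeff_trigpoly)
    qed (rule semidiscrete_solution_coeff[OF uN])
    have r1: "?r \<le> 1" using powr_mono[of "s - \<mu>" 0 "real N"] N s\<mu> by simp
    have uN_hs: "hs s ?A (fourier_coeff (uN t)) \<le> B - 1" if "t \<in> {0..T}" for t
    proof -
      have "hs s ?A (fourier_coeff (uN t)) \<le>
          hs s ?A (\<lambda>l. (fourier_coeff (uN t) l - fourier_coeff (u t) l) + fourier_coeff (u t) l)"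
        by simp
      also have "\<dots> \<le> K * ?r + hs \<mu> ?A (fourier_coeff (u t))"
        using space[OF that] hs_mono_exponent[of s \<mu> ?A] s\<mu>
            by (intro order.trans[OF hs_triangle] add_mono) auto
      also have "\<dots> \<le> K * 1 + B0" using r1 K u_hs[OF that] by (intro add_mono mult_left_mono) auto
      finally show ?thesis by (simp add: B_def)
    qed
    have k1: "L * k \<le> 1" "E * k \<le> 1" "k \<le> 1"
    proof -
      have "k * (L + 1) \<le> 1" "k * (E + 1) \<le> 1"
        using k E0 L0 by (auto simp: k0_def pos_le_divide_eq)
      moreover have "0 \<le> k * L" "0 \<le> k * E" using k E0 L0 by auto
      ultimately show "L * k \<le> 1" "E * k \<le> 1" "k \<le> 1" using k by (auto simp: algebra_simps)
    qed
    have "k ^ \<alpha> \<le> k ^ 1" using k k1 assms(4) by (intro power_decreasing) auto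
    then have Ek: "E * k ^ \<alpha> \<le> 1" using k1 E0 mult_left_mono[of "k ^ \<alpha>" k E] by simp
    have time: "hs s ?A (\<lambda>l. fourier_coeff (U n) l - fourier_coeff (uN (real n * k)) l) \<le> E * k ^ \<alpha>"
        if "n \<le> M" for n
      unfolding E_def q_def
    proof (rule temporal_error[OF CA _ _ \<beta>0 k(1) _ h UY U_mass uN TM uN_hs _ _ _ _ that])
      show "12 * C * (k * \<beta>) * (5 ^ stages p * B)\<^sup>2 \<le> 1" using k1(1)
          by (simp add: L_def q_def mult_ac)
      show "sobolev_norm s (\<lambda>x. uN (real (Suc n) * k) x - Z n (stages p) x) \<le> D * k ^ (\<alpha> + 1)"
          if "n < M" for n
      proof -
        have "C\<^sub>\<Theta> * k ^ (\<alpha> + 1) \<le> D * k ^ (\<alpha> + 1)" using k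
            by (intro mult_right_mono) (auto simp: D_def)
        then show ?thesis using \<Theta> that order.trans by blast
      qed
      show "T * exp (24 * real (stages p) * C * (5 ^ stages p * B)\<^sup>2 * \<beta> * T) * D * k ^ \<alpha> \<le> 1"
        using Ek by (simp add: E_def q_def)
    qed (use C Z \<beta>_ge in \<open>auto simp: D_def q_def\<close>)
    have error: "sobolev_norm s (\<lambda>x. U n x - u (real n * k) x) \<le> C' * (k ^ \<alpha> + ?r)" if "n \<le> M" for n
    proof -
      have t: "real n * k \<in> {0..T}" using that k unfolding TM by (auto intro: mult_right_mono)
      have cont: "continuous_on ({0..T} \<times> UNIV) (\<lambda>(t, x). u t x)" using sol
          by (simp add: fnls_solution_def)
      have "(\<lambda>x. (real n * k, x)) ` {-pi..pi} \<subseteq> {0..T} \<times> UNIV" using t by auto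
      from continuous_on_compose2[OF cont _ this] have "continuous_on {-pi..pi} (u (real n * k))"
        by (simp add: continuous_on_Pair)
      then have "sobolev_norm s (\<lambda>x. U n x - u (real n * k) x) \<le> (E * k ^ \<alpha> + K * ?r) + ?r * B0"
      proof (intro sobolev_norm_diff_le[OF _ _ u_hs[OF t] N])
        show "U n \<in> trig_space N" using UY that by (simp add: fully_discrete_solution_def)
        have "hs s ?A (\<lambda>l. fourier_coeff (U n) l - fourier_coeff (u (real n * k)) l) =
          hs s ?A (\<lambda>l. (fourier_coeff (U n) l - fourier_coeff (uN (real n * k)) l) + (fourier_coeff
              (uN (real n * k)) l - fourier_coeff (u (real n * k)) l))"
          by simp
        also have "\<dots> \<le> E * k ^ \<alpha> + K * ?r"
          using time[OF that] space[OF t] by (intro order.trans[OF hs_triangle] add_mono)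
        finally show "hs s ?A (\<lambda>l. fourier_coeff (U n) l - fourier_coeff (u (real n * k)) l) \<le>
            E * k ^ \<alpha> + K * ?r" .
      qed (use s\<mu> in auto)
      also have "\<dots> \<le> C' * k ^ \<alpha> + C' * ?r"
      proof -
        have "E * k ^ \<alpha> \<le> C' * k ^ \<alpha>" using k K B0_nonneg
            by (intro mult_right_mono) (auto simp: C'_def)
        moreover have "(K + B0) * ?r \<le> C' * ?r" using E0
            by (intro mult_right_mono) (auto simp: C'_def)
        ultimately show ?thesis by (simp add: algebra_simps)
      qed
      finally show ?thesis by (simp add: distrib_left)
    qed
    show "\<exists>U Y. fully_discrete_solution s N p k M u0 U Y \<and>
          (\<forall>U' Y'. fully_discrete_solution s N p k M u0 U' Y' \<longrightarrow>
             (\<forall>n\<le>M. U' n = U n) \<and> (\<forall>n<M. \<forall>j\<le>stages p. Y' n j = Y n j)) \<and>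
          (\<forall>n\<le>M. sobolev_norm s (\<lambda>x. U n x - u (real n * k) x)
                   \<le> C' * (k ^ \<alpha> + real N powr (s - \<mu>)))"
      using UY U_unique Y_unique error by blast
  qed
qed

end
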